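(* Let $q=2^s$ and $r=2^t$ with integers $s,t\ge1$, let $\ell\ge1$, $m\ge1$, $d\ge2$ be integers with $m\le\ell$, and let $\lambda\in\mathbb{F}_q^*$ with $\lambda\ne1$. Let $(\lambda_1,\dots,\lambda_\ell)\in(\mathbb{F}_q^* )^\ell$ and $(\varepsilon_1,\varepsilon_2)\in(\mathbb{F}_q^* )^2$, extend $(\lambda_n)$ to all $n\ge1$ by \[ \lambda_{\ell+rm'+1} = (\varepsilon_2/\varepsilon_1)\,\varepsilon_2^{(-1)^{m'+1}}\lambda_{m'+1}^r,\qquad \lambda_{\ell+rm'+i} = (\varepsilon_1/\varepsilon_2)^{(-1)^i}\quad (m'\ge0,\ 2\le i\le r), \] and let $\Phi := [\lambda_1T, \lambda_2T, \lambda_3T, \dots]\in\mathbb{F}_q((T^{-1}))$. (1) Assume $\lambda_1=\lambda$, $\lambda_i=1$ for all $2\le i\le m$, $\varepsilon_1=\varepsilon_2=1$, and, if $m<\ell$, $\lambda_{m+1}\ne1$. Then \[ w_2^*(\Phi)\ge\frac{m}{\ell}(r-1),\qquad w_2(\Phi)\ge 1+\frac{m}{\ell}(r-1). \] If moreover $\frac{\ell}{m}\le\frac{2(r-1)}{d+\sqrt{d^2+4(2r-1)d+4}}$, then $w_n^*(\Phi)=\frac{m}{\ell}(r-1)$ and $w_n(\Phi)=1+\frac{m}{\ell}(r-1)$ for all integers $2\le n\le d$. (2) Assume $r$ is a power of $q$, $\varepsilon_1=\varepsilon_2=1$ and $\lambda_i=\lambda$ for all $1\le i\le\ell$. Then \[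 w_2^*(\Phi)\ge r-1-\frac{r(r-1)(r-4)}{2\ell r+(r-1)(r-2)},\qquad w_2(\Phi)\ge r-\frac{r(r-1)(r-3)}{2\ell r+(r-1)(r-2)}. \] If moreover \[ 2rd\le\left(r-2-\frac{r(r-1)(r-4)}{2\ell r+(r-1)(r-2)}\right)\left(r-d-\frac{r(r-1)(r-4)}{2\ell r+(r-1)(r-2)}\right), \] then for all integers $2\le n\le d$, \[ w_n^*(\Phi)=r-1-\frac{r(r-1)(r-4)}{2\ell r+(r-1)(r-2)},\qquad w_n(\Phi)=r-\frac{r(r-1)(r-3)}{2\ell r+(r-1)(r-2)}. \]
   Context: $\mathbb{F}_q((T^{-1}))$ is the field of Laurent series $\xi=\sum_{j\ge N}a_jT^{-j}$ with absolute value $|\xi|=q^{-N}$ when $a_N\ne0$, $|0|=0$, extended uniquely to an algebraic closure. $[a_0,a_1,\dots]$ denotes a continued fraction with $a_i\in\mathbb{F}_q[T]$, $\deg_T a_j\ge1$ for $j\ge1$. (The series $\Phi$ is the unique root with $|\Phi|\ge q$ of a certain equation of the form $AX^{r+1}+BX^r+CX+D=0$ with $A,B,C,D\in\mathbb{F}_q[T]$; this is not needed for the statement.) The height $H(P)$ of $P\in(\mathbb{F}_q[T])[X]$ is the maximum absolute value of its coefficients. For $\alpha$ algebraic over $\mathbb{F}_q(T)$, its minimal polynomial is the unique non-constant irreducible primitive $P\in(\mathbb{F}_q[T])[X]$ with leading coefficient monic in $T$ and $P(\alpha)=0$; $H(\alpha):=H(P)$, $\deg\alpha:=\deg P$. For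 $n\ge1$, $w_n(\xi)$ is the supremum of real $w$ with $0<|P(\xi)|\le H(P)^{-w}$ for infinitely many $P\in(\mathbb{F}_q[T])[X]$ of degree $\le n$, and $w_n^*(\xi)$ is the supremum of real $w^*$ with $0<|\xi-\alpha|\le H(\alpha)^{-w^*-1}$ for infinitely many algebraic $\alpha$ of degree $\le n$. *)

theory Defs
  imports "HOL-Computational_Algebra.Computational_Algebra"
          "HOL-Computational_Algebra.Formal_Laurent_Series"
          "HOL-Algebra.Algebraic_Closure_Type"
          "HOL-Library.Extended_Real"
begin

text \<open>We model F_q((T^{-1})) as the Laurent series 'a fls in the variable X = T^{-1},
  over a finite field 'a with q = CARD('a) elements. T itself is fls_X_inv.\<close>

definition fabs :: "'a::{field,finite} fls \<Rightarrow> real" where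
  "fabs x = (if x = 0 then 0 else real (card (UNIV :: 'a set)) powr (- real_of_int (fls_subdegree x)))"

definition polyT :: "'a::field poly \<Rightarrow> 'a fls" where
  "polyT p = poly (map_poly fls_const p) fls_X_inv"

definition evalT :: "'a::field poly poly \<Rightarrow> 'a fls \<Rightarrow> 'a fls" where
  "evalT P \<xi> = poly (map_poly polyT P) \<xi>"

definition heightT :: "'a::{field,finite} poly poly \<Rightarrow> real" where
  "heightT P = Max ((\<lambda>i. fabs (polyT (coeff P i))) ` {0..degree P})"

fun cf_fin :: "(nat \<Rightarrow> 'b::field) \<Rightarrow> nat \<Rightarrow> 'b" where
  "cf_fin a 0 = a 0"
| "cf_fin a (Suc n) = a 0 + inverse (cf_fin (\<lambda>k. a (Suc k)) n)"

definition minpoly_fls :: "'a::field fls alg_closure \<Rightarrow> 'a fls poly" where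
  "minpoly_fls \<beta> = (THE p. lead_coeff p = 1 \<and> irreducible p \<and> poly (map_poly to_ac p) \<beta> = 0)"

text \<open>The unique extension of the absolute value to the algebraic closure
  (F_q((T^{-1})) is complete): |beta| = |N(beta)|^(1/[K(beta):K]) = |c_0|^(1/k), where
  c_0 is the constant coefficient of the degree-k minimal polynomial.\<close>
definition acabs :: "'a::{field,finite} fls alg_closure \<Rightarrow> real" where
  "acabs \<beta> = (if \<beta> = 0 then 0 else
     fabs (coeff (minpoly_fls \<beta>) 0) powr (1 / real (degree (minpoly_fls \<beta>))))"

definition embT :: "'a::field poly \<Rightarrow> 'a fls alg_closure" where
  "embT p = to_ac (polyT p)"

definition algebraicT :: "'a::field fls alg_closure \<Rightarrow> bool" where
  "algebraicT \<alpha> \<longleftrightarrow> (\<exists>P::'a poly poly. P \<noteq> 0 \<and> poly (map_poly embT P) \<alpha> = 0)"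

definition minpolyT :: "'a::field fls alg_closure \<Rightarrow> 'a poly poly" where
  "minpolyT \<alpha> = (THE P. degree P \<ge> 1 \<and> irreducible P \<and> (\<forall>c. (\<forall>i. c dvd coeff P i) \<longrightarrow> is_unit c) \<and>
      lead_coeff (lead_coeff P) = 1 \<and> poly (map_poly embT P) \<alpha> = 0)"

definition heightA :: "'a::{field,finite} fls alg_closure \<Rightarrow> real" where
  "heightA \<alpha> = heightT (minpolyT \<alpha>)"

definition degA :: "'a::field fls alg_closure \<Rightarrow> nat" where
  "degA \<alpha> = degree (minpolyT \<alpha>)"

definition w_exp :: "nat \<Rightarrow> 'a::{field,finite} fls \<Rightarrow> ereal" where
  "w_exp n \<xi> = Sup (ereal ` {w::real. infinite {P::'a poly poly. degree P \<le> n \<and>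
       0 < fabs (evalT P \<xi>) \<and> fabs (evalT P \<xi>) \<le> heightT P powr (- w)}})"

definition wstar_exp :: "nat \<Rightarrow> 'a::{field,finite} fls \<Rightarrow> ereal" where
  "wstar_exp n \<xi> = Sup (ereal ` {w::real. infinite {\<alpha>. algebraicT \<alpha> \<and> degA \<alpha> \<le> n \<and>
       0 < acabs (to_ac \<xi> - \<alpha>) \<and> acabs (to_ac \<xi> - \<alpha>) \<le> heightA \<alpha> powr (- w - 1)}})"

end

theory Submission
  imports Defs "HOL-Library.Cardinality"
begin

text \<open>
  For \<open>\<epsilon>\<^sub>1 = \<epsilon>\<^sub>2 = 1\<close> the \<open>l\<close>-th complete quotient of \<open>\<Phi>\<close> is an affine image of the Frobenius
  power \<open>\<Phi>\<^sup>r\<close>. In characteristic two this map, followed by \<open>l\<close> continued fraction steps, sends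
  quadratic irrationals to quadratic irrationals, and it acts in a controlled way on the defining
  equation \<open>A X\<^sup>2 + B X + C = 0\<close>, on the distance to \<open>\<Phi>\<close> and on the distance \<open>|B / A|\<close> of the
  conjugates. Iterating it from \<open>[\<lambda>T, T, T, \<dots>]\<close> in case (1) and from \<open>[\<lambda>T, \<lambda>T, \<dots>]\<close> in case (2)
  gives quadratic approximations \<open>z\<^sub>k\<close> of \<open>\<Phi>\<close> whose heights grow like powers of \<open>r\<close>; they yield the
  lower bounds. For the upper bounds, a polynomial \<open>P\<close> that does not vanish at \<open>z\<^sub>k\<close> and its conjugate
  \<open>z\<^sub>k'\<close> satisfies \<open>1 \<le> |A\<^sub>k\<^sup>n P(z\<^sub>k) P(z\<^sub>k')|\<close>, because the right-hand side is the absolute value of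
  an element of \<open>F\<^sub>q[T]\<close>; with a suitable \<open>k\<close> this bounds \<open>|P(\<Phi>)|\<close> from below.
\<close>

section \<open>The absolute value\<close>

text \<open>The affine map is forced by the matrix \<open>J = (T, 1; 1, 0)\<close>. In
  characteristic two \<open>J ^ r = T ^ (r - 1) J + u\<close>, so \<open>r\<close> steps with
  partial quotient \<open>T\<close> have an explicit matrix, and Frobenius turns one quotient
  \<open>c T\<close> into the block \<open>c ^ r T, T, ..., T\<close> of length \<open>r\<close>,
  which is the rule for \<lambda>_n. The exponents require the exact heights, hence the exact common
  factor of the transformed coefficients. Continued fraction steps keep \<open>B\<close>, because a
  shift by \<open>c T\<close> does not change a trace in characteristic two, and they create no
  common factor; Frobenius may create a power of \<open>T\<close>. In case (1) \<open>B = T\<close>,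
  and congruences for \<open>A\<close> and \<open>C\<close> let \<open>T ^ (2 r - 2)\<close> cancel,
  so \<open>B\<close> stays \<open>T\<close> and the conjugates are at distance
  \<open>q / |A|\<close>. In case (2) nothing cancels after the start; \<open>B\<close> is a growing
  monomial, the conjugates stay farther apart, and the two exponents differ by less than 1. The
  inequality on \<open>d\<close> ensures that the loss caused by having only heights in geometric
  progression on the logarithmic scale does not push a nonvanishing \<open>P\<close> beyond the
  exponent of the \<open>z_k\<close>.\<close>

lemma card_field_gt_1 [simp]: "Suc 0 < CARD('a::{field,finite})"
proof -
  have "card {0, 1 :: 'a} \<le> CARD('a)"
    by (rule card_mono) auto
  then show ?thesis
    by simp
qed

lemma card_field_gt_1_real [simp]: "1 < real CARD('a::{field,finite})"
  using card_field_gt_1[where 'a = 'a] by simp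

lemma card_field_pos_real [simp]: "0 < real CARD('a::{field,finite})"
  by (simp add: card_gt_0_iff)

lemma fabs_0 [simp]: "fabs 0 = 0"
  by (simp add: fabs_def)

lemma fabs_nonzero:
  fixes x :: "'a::{field,finite} fls"
  shows "x \<noteq> 0 \<Longrightarrow> fabs x = real CARD('a) powr (- real_of_int (fls_subdegree x))"
  by (simp add: fabs_def)

lemma fabs_pos [simp]: "0 < fabs x \<longleftrightarrow> x \<noteq> 0"
  by (simp add: fabs_def)

lemma fabs_nonneg [simp]: "0 \<le> fabs x"
  by (simp add: fabs_def)

lemma fabs_eq_0_iff [simp]: "fabs x = 0 \<longleftrightarrow> x = 0"
  using fabs_pos[of x] fabs_nonneg[of x] by (metis fabs_0 less_irrefl)

lemma fabs_1 [simp]: "fabs 1 = 1"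
  by (simp add: fabs_def)

lemma fabs_minus [simp]: "fabs (- x) = fabs x"
  by (simp add: fabs_def)

lemma fabs_mult: "fabs (x * y) = fabs x * fabs y"
  by (auto simp: fabs_def powr_add [symmetric] algebra_simps)

lemma fabs_power: "fabs (x ^ n) = fabs x ^ n"
  by (induction n) (auto simp: fabs_mult)

lemma fabs_inverse: "fabs (inverse x) = inverse (fabs x)"
  by (auto simp: fabs_def powr_minus)

lemma fabs_divide: "fabs (x / y) = fabs x / fabs y"
  by (simp add: field_class.field_divide_inverse fabs_mult fabs_inverse)

lemma fabs_minus_commute: "fabs (x - y) = fabs (y - x)"
  using fabs_minus[of "x - y"] by simp

lemma fabs_add_le: "fabs (x + y) \<le> max (fabs x) (fabs y)"
proof (cases "x = 0 \<or> y = 0 \<or> x + y = 0")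
  case True
  then show ?thesis by (auto simp: le_max_iff_disj)
next
  case False
  then have "min (fls_subdegree x) (fls_subdegree y) \<le> fls_subdegree (x + y)"
    using fls_plus_subdegree by blast
  then have "fls_subdegree x \<le> fls_subdegree (x + y) \<or> fls_subdegree y \<le> fls_subdegree (x + y)"
    by linarith
  then have "fabs (x + y) \<le> fabs x \<or> fabs (x + y) \<le> fabs y"
    using False by (auto simp: fabs_nonzero intro: powr_mono)
  then show ?thesis
    by (simp add: le_max_iff_disj)
qed

lemma fabs_diff_le: "fabs (x - y) \<le> max (fabs x) (fabs y)"
  using fabs_add_le[of x "- y"] by simp

lemma fabs_add_bound: "fabs x \<le> b \<Longrightarrow> fabs y \<le> b \<Longrightarrow> fabs (x + y) \<le> b"
  using fabs_add_le[of x y] by linarith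

lemma fabs_diff_bound: "fabs x \<le> b \<Longrightarrow> fabs y \<le> b \<Longrightarrow> fabs (x - y) \<le> b"
  using fabs_diff_le[of x y] by linarith

lemma fabs_diff_less: "fabs x < b \<Longrightarrow> fabs y < b \<Longrightarrow> fabs (x - y) < b"
  using fabs_diff_le[of x y] by linarith

lemma fabs_add_less: "fabs x < b \<Longrightarrow> fabs y < b \<Longrightarrow> fabs (x + y) < b"
  using fabs_add_le[of x y] by linarith

lemma fabs_add_eq1: "fabs y < fabs x \<Longrightarrow> fabs (x + y) = fabs x"
  using fabs_add_le[of x y] fabs_diff_le[of "x + y" y] by (auto simp: max_def split: if_splits)

lemma fabs_add_eq2: "fabs x < fabs y \<Longrightarrow> fabs (x + y) = fabs y"
  using fabs_add_eq1[of x y] by (simp add: add.commute)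

lemma fabs_eqI: "fabs (x - y) < fabs y \<Longrightarrow> fabs x = fabs y"
  using fabs_add_eq1[of "x - y" y] by simp

lemma fabs_sum_le:
  assumes "\<And>i. i \<in> A \<Longrightarrow> fabs (f i) \<le> b" "0 \<le> b"
  shows "fabs (sum f A) \<le> b"
  using assms(1)
  by (induction A rule: infinite_finite_induct) (auto simp: assms(2) intro!: fabs_add_bound)

lemma fabs_sum_less:
  assumes "\<And>i. i \<in> A \<Longrightarrow> fabs (f i) < b" "0 < b"
  shows "fabs (sum f A) < b"
  using assms(1)
  by (induction A rule: infinite_finite_induct) (auto simp: assms(2) intro!: fabs_add_less)

lemma fabs_const [simp]: "fabs (fls_const c) = (if c = 0 then 0 else 1)"
  by (simp add: fabs_def)

lemma fabs_X_inv [simp]: "fabs (fls_X_inv :: 'a::{field,finite} fls) = real CARD('a)"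
  by (simp add: fabs_def)

lemma fabs_X_inv_power:
  "fabs (fls_X_inv ^ n :: 'a::{field,finite} fls) = real CARD('a) ^ n"
  by (simp add: fabs_power)

section \<open>Ring homomorphisms and polynomial evaluation\<close>

locale ring_hom_fun =
  fixes h :: "'b::comm_ring_1 \<Rightarrow> 'c::comm_ring_1"
  assumes hom_0: "h 0 = 0" and hom_1: "h 1 = 1"
    and hom_add: "h (x + y) = h x + h y" and hom_mult: "h (x * y) = h x * h y"
begin

lemma hom_minus: "h (- x) = - h x"
  using hom_add[of x "- x"] by (simp add: hom_0 eq_neg_iff_add_eq_0 add.commute)

lemma hom_diff: "h (x - y) = h x - h y"
  using hom_add[of x "- y"] by (simp add: hom_minus)

lemma hom_power: "h (x ^ n) = h x ^ n"
  by (induction n) (auto simp: hom_1 hom_mult)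

lemma hom_sum: "h (sum f A) = (\<Sum>i\<in>A. h (f i))"
  by (induction A rule: infinite_finite_induct) (auto simp: hom_0 hom_add)

lemma map_hom_pCons: "map_poly h (pCons a p) = pCons (h a) (map_poly h p)"
  by (rule map_poly_pCons) (rule hom_0)

lemma map_hom_add: "map_poly h (p + q) = map_poly h p + map_poly h q"
  by (rule poly_eqI) (simp add: coeff_map_poly hom_0 hom_add)

lemma map_hom_diff: "map_poly h (p - q) = map_poly h p - map_poly h q"
  by (rule poly_eqI) (simp add: coeff_map_poly hom_0 hom_diff)

lemma map_hom_smult: "map_poly h (smult a p) = smult (h a) (map_poly h p)"
  by (rule poly_eqI) (simp add: coeff_map_poly hom_0 hom_mult)

lemma map_hom_mult: "map_poly h (p * q) = map_poly h p * map_poly h q"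
  by (rule poly_eqI) (simp add: coeff_map_poly hom_0 hom_sum hom_mult coeff_mult)

lemma map_hom_1: "map_poly h 1 = 1"
  by (rule poly_eqI) (auto simp: coeff_map_poly hom_0 hom_1 coeff_1)

lemma hom_poly: "h (poly p x) = poly (map_poly h p) (h x)"
  by (induction p) (auto simp: map_hom_pCons hom_0 hom_add hom_mult)

end

interpretation const_hom: ring_hom_fun "fls_const :: 'a::comm_ring_1 \<Rightarrow> 'a fls"
  by unfold_locales (simp_all add: fls_plus_const fls_const_mult_const)

interpretation ac_hom: ring_hom_fun "to_ac :: 'a::field \<Rightarrow> 'a alg_closure"
  by unfold_locales simp_all

interpretation polyT_hom: ring_hom_fun "polyT :: 'a::field poly \<Rightarrow> 'a fls"
  by unfold_locales (simp_all add: polyT_def const_hom.map_hom_1 const_hom.map_hom_add const_hom.map_hom_mult)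

interpretation embT_hom: ring_hom_fun "embT :: 'a::field poly \<Rightarrow> 'a fls alg_closure"
  by unfold_locales
    (simp_all add: embT_def polyT_hom.hom_0 polyT_hom.hom_1 polyT_hom.hom_add polyT_hom.hom_mult)

lemmas polyT_simps [simp] = polyT_hom.hom_0 polyT_hom.hom_1 polyT_hom.hom_add polyT_hom.hom_mult
  polyT_hom.hom_minus polyT_hom.hom_diff polyT_hom.hom_power

lemma polyT_pCons: "polyT (pCons a p) = fls_const a + fls_X_inv * polyT p"
  by (simp add: polyT_def map_poly_pCons)

lemma polyT_monom [simp]: "polyT (monom a n) = fls_const a * fls_X_inv ^ n"
  by (simp add: polyT_def map_poly_monom poly_monom)

lemma fabs_polyT:
  fixes p :: "'a::{field,finite} poly"
  assumes "p \<noteq> 0"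
  shows "fabs (polyT p) = real CARD('a) ^ degree p"
  using assms
proof (induction p)
  case (pCons a p)
  show ?case
  proof (cases "p = 0")
    case True
    with pCons show ?thesis by (auto simp: polyT_pCons)
  next
    case False
    then have eq: "fabs (fls_X_inv * polyT p) = real CARD('a) ^ Suc (degree p)"
      using pCons by (simp add: fabs_mult)
    have "fabs (fls_const a) \<le> 1"
      by simp
    also have "1 < real CARD('a) ^ Suc (degree p)"
      by (rule one_less_power) auto
    finally have "fabs (fls_const a) < fabs (fls_X_inv * polyT p)"
      unfolding eq .
    then show ?thesis
      using False eq by (simp add: polyT_pCons fabs_add_eq2)
  qed
qed auto

lemma polyT_eq_0_iff [simp]: "polyT p = 0 \<longleftrightarrow> p = (0 :: 'a::{field,finite} poly)"
  using fabs_polyT[of p] by (metis card_field_pos_real fabs_0 less_irrefl polyT_hom.hom_0 zero_less_power)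

lemma fabs_polyT_ge_1: "p \<noteq> 0 \<Longrightarrow> 1 \<le> fabs (polyT p)"
  using fabs_polyT[of p] by (simp add: one_le_power less_imp_le)

lemma embT_eq_0_iff [simp]: "embT p = 0 \<longleftrightarrow> p = (0 :: 'a::{field,finite} poly)"
  by (simp add: embT_def)

lemma evalT_pCons: "evalT (pCons a p) x = polyT a + x * evalT p x"
  by (simp add: evalT_def polyT_hom.map_hom_pCons)

lemma evalT_0 [simp]: "evalT 0 x = 0"
  by (simp add: evalT_def)

lemma evalT_mult: "evalT (p * q) x = evalT p x * evalT q x"
  by (simp add: evalT_def polyT_hom.map_hom_mult)

lemma poly_map_embT: "poly (map_poly embT P) (to_ac x) = to_ac (evalT P x)"
proof -
  have "map_poly embT P = map_poly to_ac (map_poly polyT P)"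
    by (subst map_poly_map_poly) (auto simp: comp_def embT_def [abs_def])
  then show ?thesis
    by (simp add: evalT_def ac_hom.hom_poly)
qed

section \<open>The Gauss norm\<close>

text \<open>Taken over Laurent series and not over F_q[T]: on images under \<open>polyT\<close> it
  is the height, but \<open>evalT_le_acabs\<close> also applies it to minimal polynomials over the
  completed field.\<close>

definition gnorm :: "'a::{field,finite} fls poly \<Rightarrow> real" where
  "gnorm p = Max ((\<lambda>i. fabs (coeff p i)) ` {0..degree p})"

lemma fabs_coeff_le_gnorm: "fabs (coeff p i) \<le> gnorm p"
proof (cases "i \<le> degree p")
  case True
  then show ?thesis unfolding gnorm_def by (intro Max_ge) auto
next
  case False
  then have "fabs (coeff p i) \<le> fabs (coeff p 0)" by (simp add: coeff_eq_0)
  also have "\<dots> \<le> gnorm p" unfolding gnorm_def by (intro Max_ge) auto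
  finally show ?thesis .
qed

lemma gnorm_attained: "\<exists>i. fabs (coeff p i) = gnorm p"
proof -
  have "gnorm p \<in> (\<lambda>i. fabs (coeff p i)) ` {0..degree p}"
    unfolding gnorm_def by (rule Max_in) auto
  then show ?thesis by auto
qed

lemma gnorm_le: "(\<And>i. fabs (coeff p i) \<le> b) \<Longrightarrow> gnorm p \<le> b"
  using gnorm_attained[of p] by metis

lemma gnorm_nonneg [simp]: "0 \<le> gnorm p"
  using fabs_coeff_le_gnorm[of p 0] fabs_nonneg[of "coeff p 0"] by linarith

lemma gnorm_0 [simp]: "gnorm 0 = 0"
  by (simp add: gnorm_def)

lemma gnorm_pos: "p \<noteq> 0 \<Longrightarrow> 0 < gnorm p"
  using fabs_coeff_le_gnorm[of p "degree p"] fabs_pos[of "lead_coeff p"]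
  by (metis leading_coeff_0_iff less_le_trans)

lemma gnorm_add_bound: "gnorm p \<le> b \<Longrightarrow> gnorm q \<le> b \<Longrightarrow> gnorm (p + q) \<le> b"
  by (rule gnorm_le) (auto intro!: fabs_add_bound intro: order_trans[OF fabs_coeff_le_gnorm])

text \<open>The product of the first coefficients of maximal absolute value of the two factors
  strictly dominates all other summands of its coefficient in the product.\<close>

lemma gnorm_mult: "gnorm (p * q) = gnorm p * gnorm q"
proof (cases "p = 0 \<or> q = 0")
  case True
  then show ?thesis by auto
next
  case False
  then have pos: "0 < gnorm p" "0 < gnorm q" by (auto intro: gnorm_pos)
  define i where "i = (LEAST i. fabs (coeff p i) = gnorm p)"
  define j where "j = (LEAST j. fabs (coeff q j) = gnorm q)"
  have i: "fabs (coeff p i) = gnorm p" and j: "fabs (coeff q j) = gnorm q"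
    unfolding i_def j_def by (rule LeastI_ex, rule gnorm_attained)+
  have i_less: "fabs (coeff p k) < gnorm p" if "k < i" for k
    using not_less_Least[of k "\<lambda>i. fabs (coeff p i) = gnorm p"] that fabs_coeff_le_gnorm[of p k]
    by (auto simp: i_def)
  have j_less: "fabs (coeff q k) < gnorm q" if "k < j" for k
    using not_less_Least[of k "\<lambda>j. fabs (coeff q j) = gnorm q"] that fabs_coeff_le_gnorm[of q k]
    by (auto simp: j_def)
  have "fabs (\<Sum>k\<in>{..i + j} - {i}. coeff p k * coeff q (i + j - k)) < gnorm p * gnorm q"
  proof (rule fabs_sum_less)
    fix k assume "k \<in> {..i + j} - {i}"
    then consider "k < i" | "i < k" "i + j - k < j" by fastforce
    then show "fabs (coeff p k * coeff q (i + j - k)) < gnorm p * gnorm q"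
    proof cases
      case 1
      then show ?thesis unfolding fabs_mult
        by (intro le_less_trans[OF mult_left_mono mult_strict_right_mono] i_less
          fabs_coeff_le_gnorm fabs_nonneg pos)
    next
      case 2
      then show ?thesis unfolding fabs_mult
        by (intro le_less_trans[OF mult_right_mono mult_strict_left_mono] j_less
          fabs_coeff_le_gnorm fabs_nonneg pos)
    qed
  qed (use pos in simp)
  then have "fabs (coeff (p * q) (i + j)) = gnorm p * gnorm q"
    unfolding coeff_mult
    by (subst sum.remove[of _ i]) (auto simp: fabs_mult i j fabs_add_eq1)
  then have "gnorm p * gnorm q \<le> gnorm (p * q)"
    by (metis fabs_coeff_le_gnorm)
  moreover have "gnorm (p * q) \<le> gnorm p * gnorm q"
    by (rule gnorm_le) (auto simp: coeff_mult fabs_mult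
      intro!: fabs_sum_le mult_mono fabs_coeff_le_gnorm)
  ultimately show ?thesis by simp
qed

lemma degree_map_polyT [simp]:
  "degree (map_poly polyT (P :: 'a::{field,finite} poly poly)) = degree P"
  by (rule degree_map_poly) simp

lemma coeff_map_polyT [simp]: "coeff (map_poly polyT P) i = polyT (coeff P i)"
  by (simp add: coeff_map_poly)

lemma heightT_eq_gnorm: "heightT P = gnorm (map_poly polyT P)"
  by (simp add: heightT_def gnorm_def)

lemma heightT_mult: "heightT (P * Q) = heightT P * heightT Q"
  by (simp add: heightT_eq_gnorm polyT_hom.map_hom_mult gnorm_mult)

lemma fabs_coeff_le_heightT: "fabs (polyT (coeff P i)) \<le> heightT P"
  using fabs_coeff_le_gnorm[of "map_poly polyT P" i] by (simp add: heightT_eq_gnorm)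

lemma heightT_ge_1: "P \<noteq> 0 \<Longrightarrow> 1 \<le> heightT P"
  using fabs_coeff_le_heightT[of P "degree P"] fabs_polyT_ge_1[of "lead_coeff P"] by simp

lemma heightT_const: "heightT [:c:] = fabs (polyT c)"
  by (simp add: heightT_def)

lemma evalT_le:
  fixes P :: "'a::{field,finite} poly poly"
  assumes "degree P \<le> n" "fabs x \<le> real CARD('a)"
  shows "fabs (evalT P x) \<le> heightT P * real CARD('a) ^ n"
  unfolding evalT_def poly_altdef
proof (rule fabs_sum_le)
  fix i assume "i \<in> {..degree (map_poly polyT P)}"
  then have "i \<le> n" using assms by simp
  have "fabs x ^ i \<le> real CARD('a) ^ i" by (rule power_mono) (use assms in auto)
  also have "\<dots> \<le> real CARD('a) ^ n" by (rule power_increasing) (use \<open>i \<le> n\<close> in \<open>auto simp: less_imp_le Suc_leI\<close>)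
  finally show "fabs (coeff (map_poly polyT P) i * x ^ i) \<le> heightT P * real CARD('a) ^ n"
    unfolding fabs_mult fabs_power
    using fabs_coeff_le_heightT[of P i] by (intro mult_mono) (auto simp: heightT_eq_gnorm)
qed (simp add: heightT_eq_gnorm)

lemma finite_polys_coeffs_in:
  assumes "finite S"
  shows "finite {p. degree p \<le> n \<and> (\<forall>i. coeff p i \<in> S)}"
proof (rule finite_subset)
  show "{p. degree p \<le> n \<and> (\<forall>i. coeff p i \<in> S)} \<subseteq>
    Poly ` {xs. set xs \<subseteq> S \<and> length xs = Suc n}"
  proof clarify
    fix p assume p: "degree p \<le> n" "\<forall>i. coeff p i \<in> S"
    have "p = Poly (map (coeff p) [0..<Suc n])"
      using p(1) by (intro poly_eqI) (auto simp: coeff_Poly_eq nth_default_def coeff_eq_0 simp del: upt_Suc)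
    then show "p \<in> Poly ` {xs. set xs \<subseteq> S \<and> length xs = Suc n}"
      using p(2) by (intro image_eqI[of _ _ "map (coeff p) [0..<Suc n]"]) auto
  qed
  show "finite (Poly ` {xs. set xs \<subseteq> S \<and> length xs = Suc n})"
    using assms by (intro finite_imageI finite_lists_length_eq)
qed

text \<open>The Northcott property: bounded height bounds the degrees in \<open>T\<close> of all
  coefficients, and the constant field is finite. It turns "infinitely many" in the definitions of
  the exponents into "of unbounded height".\<close>

lemma finite_bounded_height:
  "finite {P :: 'a::{field,finite} poly poly. degree P \<le> n \<and> heightT P \<le> b}"
proof -
  obtain k where k: "b < real CARD('a) ^ k"
    using real_arch_pow[of "real CARD('a)" b] by auto
  have "{P :: 'a poly poly. degree P \<le> n \<and> heightT P \<le> b} \<subseteq>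
    {P. degree P \<le> n \<and> (\<forall>i. coeff P i \<in> {p. degree p \<le> k \<and> (\<forall>i. coeff p i \<in> UNIV)})}"
  proof clarsimp
    fix P :: "'a poly poly" and i assume P: "heightT P \<le> b"
    show "degree (coeff P i) \<le> k"
    proof (cases "coeff P i = 0")
      case False
      then have "real CARD('a) ^ degree (coeff P i) < real CARD('a) ^ k"
        using fabs_coeff_le_heightT[of P i] P k fabs_polyT[of "coeff P i"] by linarith
      then have "degree (coeff P i) < k"
        by (rule power_less_imp_less_exp[rotated]) (rule card_field_gt_1_real)
      then show ?thesis by simp
    qed simp
  qed
  then show ?thesis
    by (rule finite_subset) (intro finite_polys_coeffs_in, simp)
qed

section \<open>Minimal polynomials\<close>

lemma irreducible_divisor_exists:
  fixes c :: "'a::field poly"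
  assumes "c \<noteq> 0" "\<not> is_unit c"
  obtains p where "irreducible p" "p dvd c"
proof -
  obtain p where p: "p dvd c" "\<not> is_unit p"
    and min: "\<And>d. d dvd c \<Longrightarrow> \<not> is_unit d \<Longrightarrow> degree p \<le> degree d"
    using assms ex_has_least_nat[of "\<lambda>d. d dvd c \<and> \<not> is_unit d" c degree] by auto
  have "p \<noteq> 0" using assms p by auto
  have "irreducible p"
  proof (rule irreducibleI)
    fix a b assume ab: "p = a * b"
    with \<open>p \<noteq> 0\<close> have nz: "a \<noteq> 0" "b \<noteq> 0" by auto
    show "is_unit a \<or> is_unit b"
    proof (rule ccontr)
      assume "\<not> ?thesis"
      then have "degree p \<le> degree a" "b \<noteq> 0" "degree b \<noteq> 0"
        using ab p nz min[of a] dvd_trans[of a p c] by (auto simp: is_unit_iff_degree)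
      then show False using ab nz by (simp add: degree_mult_eq)
    qed
  qed fact+
  with p(1) show ?thesis using that by blast
qed

definition primitive_poly :: "'a::algebraic_semidom poly \<Rightarrow> bool" where
  "primitive_poly F \<longleftrightarrow> (\<forall>c. (\<forall>i. c dvd coeff F i) \<longrightarrow> is_unit c)"

text \<open>Gauss's lemma, in the form needed after pseudo-division. An irreducible factor
  \<open>p\<close> of \<open>c\<close> stays prime as a constant polynomial and cannot divide the
  primitive \<open>F\<close>; so it divides the cofactor and cancels. Induction on the degree of
  \<open>c\<close>.\<close>

lemma primitive_dvd_smult_cancel:
  fixes F P :: "'a::field poly poly"
  assumes "primitive_poly F" "c \<noteq> 0" "F dvd smult c P"
  shows "F dvd P"
  using assms(2,3)
proof (induction "degree c" arbitrary: c rule: less_induct)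
  case less
  show ?case
  proof (cases "is_unit c")
    case True
    then obtain d where "c * d = 1" by (auto elim!: dvdE)
    then have "P = smult d (smult c P)" by (simp add: mult.commute)
    then show ?thesis using less.prems by (metis dvd_smult)
  next
    case False
    then obtain p where p: "irreducible p" "p dvd c"
      using irreducible_divisor_exists less.prems by blast
    then obtain e where e: "c = p * e" by auto
    have nz: "p \<noteq> 0" "e \<noteq> 0" "\<not> is_unit p"
      using less.prems e p by (auto simp: irreducible_def)
    obtain G where G: "smult c P = F * G" using less.prems by auto
    have prime: "prime_elem [:p:]"
      using p field_poly_irreducible_imp_prime lift_prime_elem_poly by blast
    have "[:p:] dvd F * G"
      by (simp add: G [symmetric] e const_poly_dvd_iff)
    then have "[:p:] dvd F \<or> [:p:] dvd G"
      using prime prime_elem_dvd_mult_iff by blast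
    moreover have "\<not> [:p:] dvd F"
      using assms(1) nz by (auto simp: primitive_poly_def const_poly_dvd_iff)
    ultimately obtain G' where "G = [:p:] * G'" by auto
    with G nz have "smult e P = F * G'"
      by (simp add: e flip: smult_smult) (metis mult_smult_right smult_cancel)
    moreover have "degree e < degree c"
      using nz by (simp add: e degree_mult_eq is_unit_iff_degree)
    ultimately show ?thesis using less.hyps[of e] nz by simp
  qed
qed

lemma degree_1_eq: "degree p = 1 \<Longrightarrow> p = [:coeff p 0, coeff p 1:]"
  by (rule poly_eqI) (auto simp: coeff_pCons coeff_eq_0 split: nat.split)

abbreviation annihilates :: "'a::field poly poly \<Rightarrow> 'a fls alg_closure \<Rightarrow> bool" where
  "annihilates P \<alpha> \<equiv> poly (map_poly embT P) \<alpha> = 0"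

text \<open>Two nested minimal choices replace a gcd of the coefficients: least degree in
  \<open>X\<close>, then least degree in \<open>T\<close> of the leading coefficient. Dividing by a
  nonconstant common factor would lower the latter.\<close>

lemma primitive_annihilator_exists:
  fixes \<alpha> :: "'a::{field,finite} fls alg_closure"
  assumes "algebraicT \<alpha>"
  obtains F where "F \<noteq> 0" "primitive_poly F" "lead_coeff (lead_coeff F) = 1" "annihilates F \<alpha>"
    "\<And>P. P \<noteq> 0 \<Longrightarrow> annihilates P \<alpha> \<Longrightarrow> degree F \<le> degree P"
proof -
  define A where "A = {P :: 'a poly poly. P \<noteq> 0 \<and> annihilates P \<alpha>}"
  obtain P1 where "P1 \<in> A" using assms by (auto simp: algebraicT_def A_def)
  then have "\<exists>P0. P0 \<in> A \<and> (\<forall>P. P \<in> A \<longrightarrow> degree P0 \<le> degree P)"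
    by (rule ex_has_least_nat[of "\<lambda>P. P \<in> A" P1 degree])
  then obtain P0 where P0: "P0 \<in> A" "\<And>P. P \<in> A \<Longrightarrow> degree P0 \<le> degree P"
    by auto
  have "\<exists>G. (G \<in> A \<and> degree G = degree P0) \<and>
      (\<forall>P. P \<in> A \<and> degree P = degree P0 \<longrightarrow> degree (lead_coeff G) \<le> degree (lead_coeff P))"
    by (rule ex_has_least_nat[of "\<lambda>P. P \<in> A \<and> degree P = degree P0" P0 "\<lambda>P. degree (lead_coeff P)"])
      (use P0 in simp)
  then obtain G where G: "G \<in> A" "degree G = degree P0"
    and min: "\<And>P. P \<in> A \<Longrightarrow> degree P = degree P0 \<Longrightarrow> degree (lead_coeff G) \<le> degree (lead_coeff P)"
    by auto
  define u where "u = inverse (lead_coeff (lead_coeff G))"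
  define F where "F = smult [:u:] G"
  have G0: "G \<noteq> 0" using G A_def by auto
  then have u: "u \<noteq> 0" by (simp add: u_def)
  have degF: "degree F = degree G" "degree (lead_coeff F) = degree (lead_coeff G)"
    using u by (simp_all add: F_def)
  have FA: "F \<in> A"
    using G u by (auto simp: A_def F_def embT_hom.map_hom_smult)
  have "primitive_poly F"
    unfolding primitive_poly_def
  proof (intro allI impI)
    fix c assume "\<forall>i. c dvd coeff F i"
    then obtain H where H: "F = [:c:] * H"
      by (metis const_poly_dvd_iff dvdE)
    have nz: "c \<noteq> 0" "H \<noteq> 0" using FA H by (auto simp: A_def)
    have "H \<in> A"
      using FA H nz by (auto simp: A_def embT_hom.map_hom_smult)
    moreover have "degree H = degree F" using H nz by simp
    ultimately have "degree (lead_coeff F) \<le> degree (lead_coeff H)"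
      using min[of H] degF G by simp
    moreover have "degree (lead_coeff F) = degree c + degree (lead_coeff H)"
      using H nz by (simp add: degree_mult_eq)
    ultimately show "is_unit c"
      using nz by (simp add: is_unit_iff_degree)
  qed
  moreover have "lead_coeff (lead_coeff F) = 1"
    using G0 by (simp add: F_def u_def)
  moreover have "degree F \<le> degree P" if "P \<noteq> 0" "annihilates P \<alpha>" for P
    using that P0(2)[of P] degF G by (simp add: A_def)
  ultimately show ?thesis
    using FA that by (auto simp: A_def)
qed

lemma minpolyT_exists:
  fixes \<alpha> :: "'a::{field,finite} fls alg_closure"
  assumes "algebraicT \<alpha>"
  obtains F where "1 \<le> degree F" "irreducible F" "primitive_poly F" "lead_coeff (lead_coeff F) = 1"
    "\<And>P. annihilates P \<alpha> \<longleftrightarrow> F dvd P"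
proof -
  obtain F :: "'a poly poly" where F: "F \<noteq> 0" "primitive_poly F" "lead_coeff (lead_coeff F) = 1"
      "annihilates F \<alpha>"
    and min: "\<And>P. P \<noteq> 0 \<Longrightarrow> annihilates P \<alpha> \<Longrightarrow> degree F \<le> degree P"
    using primitive_annihilator_exists[OF assms] by metis
  have deg: "1 \<le> degree F"
  proof (rule ccontr)
    assume "\<not> ?thesis"
    then obtain c where "F = [:c:]" by (metis degree_eq_zeroE not_less_eq_eq One_nat_def le_zero_eq)
    with F show False by (simp add: embT_hom.map_hom_pCons)
  qed
  have unit: "is_unit H" if "F = G * H" "annihilates G \<alpha>" for G H
  proof -
    have nz: "G \<noteq> 0" "H \<noteq> 0" using that F by auto
    with min[of G] that have "degree H = 0" by (simp add: degree_mult_eq)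
    then obtain c where c: "H = [:c:]" by (auto elim: degree_eq_zeroE)
    with that have "\<forall>i. c dvd coeff F i" by simp
    with F have "is_unit c" by (auto simp: primitive_poly_def)
    with c show ?thesis by (simp add: is_unit_const_poly_iff)
  qed
  have "irreducible F"
  proof (rule irreducibleI)
    show "\<not> is_unit F" using deg by (auto simp: is_unit_poly_iff)
    fix G H assume GH: "F = G * H"
    with F have "annihilates G \<alpha> \<or> annihilates H \<alpha>"
      by (simp add: embT_hom.map_hom_mult)
    with GH unit show "is_unit G \<or> is_unit H"
      by (metis mult.commute)
  qed (use F in auto)
  moreover have "annihilates P \<alpha> \<longleftrightarrow> F dvd P" for P
  proof
    assume P: "annihilates P \<alpha>"
    \<comment> \<open>F_q[T] is not a field, so division by \<open>F\<close> is only available up to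
      a multiplier \<open>a\<close>; primitivity of \<open>F\<close> removes it at the end.\<close>
    obtain a q where aq: "a \<noteq> 0" "smult a P = F * q + pseudo_mod P F"
      using pseudo_mod(1)[OF F(1)] by metis
    have "annihilates (smult a P) \<alpha>" using P by (simp add: embT_hom.map_hom_smult)
    then have "annihilates (pseudo_mod P F) \<alpha>"
      unfolding aq using F by (simp add: embT_hom.map_hom_add embT_hom.map_hom_mult)
    then have "pseudo_mod P F = 0"
      using min[of "pseudo_mod P F"] pseudo_mod(2)[OF F(1), of P] by force
    then have "F dvd smult a P" using aq by simp
    then show "F dvd P" using primitive_dvd_smult_cancel F aq by blast
  qed (use F in \<open>auto simp: embT_hom.map_hom_mult\<close>)
  ultimately show ?thesis
    using that deg F by blast
qed

lemma minpolyT_properties: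
  fixes \<alpha> :: "'a::{field,finite} fls alg_closure"
  assumes "algebraicT \<alpha>"
  shows "1 \<le> degree (minpolyT \<alpha>)" "annihilates P \<alpha> \<longleftrightarrow> minpolyT \<alpha> dvd P"
proof -
  obtain F :: "'a poly poly" where F: "1 \<le> degree F" "irreducible F" "primitive_poly F"
      "lead_coeff (lead_coeff F) = 1"
    and dvd: "\<And>P. annihilates P \<alpha> \<longleftrightarrow> F dvd P"
    using minpolyT_exists[OF assms] by metis
  have "minpolyT \<alpha> = F"
    unfolding minpolyT_def
  proof (rule the_equality)
    show "degree F \<ge> 1 \<and> irreducible F \<and> (\<forall>c. (\<forall>i. c dvd coeff F i) \<longrightarrow> is_unit c) \<and>
      lead_coeff (lead_coeff F) = 1 \<and> poly (map_poly embT F) \<alpha> = 0"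
      using F dvd[of F] by (simp add: primitive_poly_def)
  next
    fix G :: "'a poly poly"
    assume G: "degree G \<ge> 1 \<and> irreducible G \<and> (\<forall>c. (\<forall>i. c dvd coeff G i) \<longrightarrow> is_unit c) \<and>
      lead_coeff (lead_coeff G) = 1 \<and> poly (map_poly embT G) \<alpha> = 0"
    with dvd obtain K where K: "G = F * K" by blast
    then have "is_unit F \<or> is_unit K" using G irreducibleD by blast
    moreover have "\<not> is_unit F" using F by (simp add: irreducible_def)
    ultimately obtain c where "K = [:c:]" "is_unit c" by (auto simp: is_unit_poly_iff)
    then obtain e where "K = [:[:e:]:]" by (auto simp: is_unit_poly_iff)
    then show "G = F" using K G F by (auto simp flip: one_pCons split: if_splits)
  qed
  with F dvd show "1 \<le> degree (minpolyT \<alpha>)" "annihilates P \<alpha> \<longleftrightarrow> minpolyT \<alpha> dvd P"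
    by simp_all
qed

lemma minpolyT_nonzero: "algebraicT \<alpha> \<Longrightarrow> minpolyT \<alpha> \<noteq> (0 :: 'a::{field,finite} poly poly)"
  using minpolyT_properties(1)[of \<alpha>] by auto

text \<open>Irrationality excludes a linear minimal polynomial, so the cofactor is constant in
  \<open>X\<close>; being a common divisor of the coefficients, it is a unit. The constant
  \<open>u\<close> remains because \<open>A\<close> need not be monic in \<open>T\<close>.\<close>

lemma minpolyT_quadratic:
  fixes A B C :: "'a::{field,finite} poly" and \<alpha> :: "'a fls alg_closure"
  assumes "A \<noteq> 0" and prim: "primitive_poly [:C, B, A:]" and root: "annihilates [:C, B, A:] \<alpha>"
    and irrational: "\<And>U V. embT U * \<alpha> + embT V = 0 \<Longrightarrow> U = 0"
  shows "algebraicT \<alpha>" "\<exists>u. u \<noteq> 0 \<and> [:C, B, A:] = smult [:u:] (minpolyT \<alpha>)"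
proof -
  show alg: "algebraicT \<alpha>"
    unfolding algebraicT_def using root \<open>A \<noteq> 0\<close> by (intro exI[of _ "[:C, B, A:]"]) auto
  let ?F = "minpolyT \<alpha>"
  obtain G where G: "[:C, B, A:] = ?F * G"
    using minpolyT_properties(2)[OF alg] root by blast
  have nz: "?F \<noteq> 0" "G \<noteq> 0" using G \<open>A \<noteq> 0\<close> by auto
  have "degree ?F \<noteq> 1"
  proof
    assume "degree ?F = 1"
    then obtain U V where UV: "?F = [:V, U:]" "U \<noteq> 0"
      using degree_1_eq[of ?F] by (metis degree_pCons_0 pCons_0_0 zero_neq_one)
    have "annihilates ?F \<alpha>" using minpolyT_properties(2)[OF alg, of ?F] by simp
    then have "embT U * \<alpha> + embT V = 0"
      unfolding UV by (simp add: embT_hom.map_hom_pCons algebra_simps)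
    with irrational UV show False by blast
  qed
  moreover have "degree ?F + degree G = 2"
    using arg_cong[OF G, of degree] \<open>A \<noteq> 0\<close> nz by (simp add: degree_mult_eq)
  ultimately have "degree G = 0" using minpolyT_properties(1)[OF alg] by linarith
  then obtain g where g: "G = [:g:]" by (auto elim: degree_eq_zeroE)
  have "\<forall>i. g dvd coeff [:C, B, A:] i" unfolding G g by simp
  then have "is_unit g" using prim unfolding primitive_poly_def by blast
  then obtain u where "g = [:u:]" by (auto simp: is_unit_poly_iff)
  moreover have "u \<noteq> 0" using nz g \<open>g = [:u:]\<close> by auto
  ultimately show "\<exists>u. u \<noteq> 0 \<and> [:C, B, A:] = smult [:u:] ?F"
    unfolding G g by (intro exI[of _ u]) simp
qed

lemma minpoly_fls_exists:
  fixes \<beta> :: "'a::field fls alg_closure"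
  obtains M where "lead_coeff M = 1" "irreducible M"
    "\<And>Q. poly (map_poly to_ac Q) \<beta> = 0 \<longleftrightarrow> M dvd Q"
proof -
  obtain P :: "'a fls poly" where P: "P \<noteq> 0" "poly (map_poly to_ac P) \<beta> = 0"
    using alg_closure_algebraic[of \<beta>] by metis
  obtain G where G: "G \<noteq> 0" "poly (map_poly to_ac G) \<beta> = 0"
    and min: "\<And>Q. Q \<noteq> 0 \<Longrightarrow> poly (map_poly to_ac Q) \<beta> = 0 \<Longrightarrow> degree G \<le> degree Q"
  proof -
    let ?R = "\<lambda>Q. Q \<noteq> 0 \<and> poly (map_poly to_ac Q) \<beta> = 0"
    have "\<exists>G. ?R G \<and> (\<forall>Q. ?R Q \<longrightarrow> degree G \<le> degree Q)"
      by (rule ex_has_least_nat[of ?R P degree]) (use P in simp)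
    then show ?thesis using that by auto
  qed
  define M where "M = smult (inverse (lead_coeff G)) G"
  have M: "M \<noteq> 0" "poly (map_poly to_ac M) \<beta> = 0" "lead_coeff M = 1" "degree M = degree G"
    using G by (simp_all add: M_def ac_hom.map_hom_smult)
  have unit: "is_unit H" if "M = F * H" "poly (map_poly to_ac F) \<beta> = 0" for F H
  proof -
    have nz: "F \<noteq> 0" "H \<noteq> 0" using that M by auto
    with min[of F] that M have "degree H = 0" by (simp add: degree_mult_eq)
    with nz show ?thesis by (simp add: is_unit_iff_degree)
  qed
  have "irreducible M"
  proof (rule irreducibleI)
    show "\<not> is_unit M"
    proof
      assume "is_unit M"
      then obtain c where "M = [:c:]" by (auto simp: is_unit_poly_iff)
      with M show False by (simp add: ac_hom.map_hom_pCons)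
    qed
    fix F H assume FH: "M = F * H"
    with M have "poly (map_poly to_ac F) \<beta> = 0 \<or> poly (map_poly to_ac H) \<beta> = 0"
      by (simp add: ac_hom.map_hom_mult)
    with FH unit show "is_unit F \<or> is_unit H"
      by (metis mult.commute)
  qed (use M in auto)
  moreover have "poly (map_poly to_ac Q) \<beta> = 0 \<longleftrightarrow> M dvd Q" for Q
  proof
    assume Q: "poly (map_poly to_ac Q) \<beta> = 0"
    have "poly (map_poly to_ac (Q mod M)) \<beta> = 0"
      using Q M by (simp add: minus_mult_div_eq_mod [symmetric] ac_hom.map_hom_diff ac_hom.map_hom_mult)
    then have "Q mod M = 0"
      using min[of "Q mod M"] degree_mod_less[OF M(1), of Q] M by force
    then show "M dvd Q" by auto
  qed (use M in \<open>auto simp: ac_hom.map_hom_mult\<close>)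
  ultimately show ?thesis
    using that M by blast
qed

lemma minpoly_fls_properties:
  fixes \<beta> :: "'a::field fls alg_closure"
  shows "lead_coeff (minpoly_fls \<beta>) = 1" "irreducible (minpoly_fls \<beta>)"
    "poly (map_poly to_ac Q) \<beta> = 0 \<longleftrightarrow> minpoly_fls \<beta> dvd Q"
proof -
  obtain M :: "'a fls poly" where M: "lead_coeff M = 1" "irreducible M"
    and dvd: "\<And>Q. poly (map_poly to_ac Q) \<beta> = 0 \<longleftrightarrow> M dvd Q"
    using minpoly_fls_exists[of \<beta>] by metis
  have "minpoly_fls \<beta> = M"
    unfolding minpoly_fls_def
  proof (rule the_equality)
    show "lead_coeff M = 1 \<and> irreducible M \<and> poly (map_poly to_ac M) \<beta> = 0"
      using M dvd[of M] by simp
  next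
    fix G assume G: "lead_coeff G = 1 \<and> irreducible G \<and> poly (map_poly to_ac G) \<beta> = 0"
    with dvd obtain K where K: "G = M * K" by blast
    then have "is_unit M \<or> is_unit K" using G irreducibleD by blast
    moreover have "\<not> is_unit M" using M by (simp add: irreducible_def)
    ultimately obtain c where "K = [:c:]" by (auto simp: is_unit_poly_iff)
    then show "G = M" using K G M by (auto split: if_splits)
  qed
  with M dvd show "lead_coeff (minpoly_fls \<beta>) = 1" "irreducible (minpoly_fls \<beta>)"
    "poly (map_poly to_ac Q) \<beta> = 0 \<longleftrightarrow> minpoly_fls \<beta> dvd Q"
    by simp_all
qed

lemma degree_minpoly_fls_pos: "1 \<le> degree (minpoly_fls \<beta>)"
proof (rule ccontr)
  assume "\<not> ?thesis"
  then have "degree (minpoly_fls \<beta>) = 0" by simp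
  moreover have "minpoly_fls \<beta> \<noteq> 0" using minpoly_fls_properties(1)[of \<beta>] by auto
  ultimately have "is_unit (minpoly_fls \<beta>)" by (simp add: is_unit_iff_degree)
  with minpoly_fls_properties(2)[of \<beta>] show False by (simp add: irreducible_def)
qed

lemma acabs_to_ac: "acabs (to_ac x) = fabs x"
proof (cases "x = 0")
  case False
  let ?M = "minpoly_fls (to_ac x)"
  have "?M dvd [:- x, 1:]"
    by (simp add: minpoly_fls_properties(3) [symmetric] ac_hom.map_hom_pCons)
  then have "degree ?M \<le> 1" using dvd_imp_degree_le[of ?M "[:- x, 1:]"] by simp
  with degree_minpoly_fls_pos[of "to_ac x"] have deg: "degree ?M = 1" by simp
  then obtain c e where M: "?M = [:c, e:]"
    using degree_1_eq by blast
  with deg minpoly_fls_properties(1)[of "to_ac x"] have "e = 1" by (auto split: if_splits)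
  have "poly (map_poly to_ac ?M) (to_ac x) = 0"
    by (simp add: minpoly_fls_properties(3))
  then have "to_ac (c + x) = 0"
    unfolding M \<open>e = 1\<close> by (simp add: ac_hom.map_hom_pCons)
  then have "c = - x" by (simp only: to_ac_eq_0_iff eq_neg_iff_add_eq_0)
  with False show ?thesis
    by (simp add: acabs_def M \<open>e = 1\<close>)
qed (simp add: acabs_def)

lemma gnorm_pcompose_le:
  assumes "\<And>i. fabs (coeff p i) \<le> b" "gnorm q \<le> s" "1 \<le> s" "degree p \<le> n"
  shows "gnorm (pcompose p q) \<le> b * s ^ n"
  using assms(1,4)
proof (induction p arbitrary: n)
  case 0
  then show ?case using assms(3) by simp
next
  case (pCons a p)
  have b: "fabs a \<le> b" "\<And>i. fabs (coeff p i) \<le> b"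
    using pCons.prems(1)[of 0] pCons.prems(1)[of "Suc _"] by auto
  then have b0: "0 \<le> b" using fabs_nonneg[of a] by linarith
  have "gnorm [:a:] \<le> b * s ^ n"
    using b b0 mult_left_mono[of 1 "s ^ n" b] one_le_power[OF assms(3), of n]
    by (intro gnorm_le) (auto simp: coeff_pCons split: nat.split)
  moreover have "gnorm (q * pcompose p q) \<le> b * s ^ n"
  proof (cases n)
    case 0
    then have "p = 0" using pCons.prems(2) by (auto split: if_splits)
    then show ?thesis using b0 assms(3) by simp
  next
    case (Suc k)
    then have "degree p \<le> k" using pCons.prems(2) by (auto split: if_splits)
    then have "gnorm q * gnorm (pcompose p q) \<le> s * (b * s ^ k)"
      using pCons.IH b b0 assms by (intro mult_mono) auto
    then show ?thesis by (simp add: gnorm_mult Suc algebra_simps)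
  qed
  ultimately show ?case
    by (simp add: pcompose_pCons gnorm_add_bound)
qed

lemma map_poly_to_ac_pcompose:
  "map_poly to_ac (pcompose p q) = pcompose (map_poly to_ac p) (map_poly to_ac q)"
  by (induction p)
    (simp_all add: pcompose_pCons ac_hom.map_hom_pCons ac_hom.map_hom_add ac_hom.map_hom_mult)

text \<open>The minimal polynomial of \<open>\<xi> - \<alpha>\<close> divides \<open>P(\<xi> - Y)\<close>; comparing constant coefficients
  and Gauss norms gives the bound without using that \<open>acabs\<close> is an absolute value.\<close>

lemma evalT_le_acabs:
  fixes \<xi> :: "'a::{field,finite} fls"
  assumes "fabs \<xi> \<le> real CARD('a)" "degree P \<le> n" "annihilates P \<alpha>"
    and le1: "acabs (to_ac \<xi> - \<alpha>) \<le> 1"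
  shows "fabs (evalT P \<xi>) \<le> heightT P * real CARD('a) ^ n * acabs (to_ac \<xi> - \<alpha>)"
proof (cases "to_ac \<xi> = \<alpha>")
  case True
  then have "evalT P \<xi> = 0"
    using assms(3) poly_map_embT[of P \<xi>] by simp
  with True show ?thesis
    by (simp add: acabs_def)
next
  case False
  define \<beta> where "\<beta> = to_ac \<xi> - \<alpha>"
  define M where "M = minpoly_fls \<beta>"
  define R where "R = pcompose (map_poly polyT P) [:\<xi>, -1:]"
  have "\<beta> \<noteq> 0" using False by (simp add: \<beta>_def)
  have comp: "map_poly to_ac (map_poly polyT P) = map_poly embT P"
    by (subst map_poly_map_poly) (auto simp: comp_def embT_def [abs_def])
  have "poly (map_poly to_ac R) \<beta> = 0"
    using assms(3) unfolding R_def map_poly_to_ac_pcompose comp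
    by (simp add: poly_pcompose ac_hom.map_hom_pCons \<beta>_def)
  then obtain S where S: "R = M * S"
    using minpoly_fls_properties(3)[of R \<beta>] M_def by auto
  have gR: "gnorm R \<le> heightT P * real CARD('a) ^ n"
    unfolding R_def
  proof (rule gnorm_pcompose_le)
    show "gnorm [:\<xi>, -1:] \<le> real CARD('a)"
      using assms(1) card_field_gt_1_real[where 'a = 'a]
      by (intro gnorm_le) (auto simp: coeff_pCons split: nat.split simp del: card_field_gt_1_real)
  qed (use assms(2) in \<open>auto simp: fabs_coeff_le_heightT less_imp_le Suc_leI\<close>)
  have "1 \<le> gnorm M"
    using fabs_coeff_le_gnorm[of M "degree M"] minpoly_fls_properties(1)[of \<beta>] by (simp add: M_def)
  then have "gnorm S \<le> gnorm R"
    unfolding S gnorm_mult using mult_right_mono[of 1 "gnorm M" "gnorm S"] by simp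
  then have S0: "fabs (coeff S 0) \<le> heightT P * real CARD('a) ^ n"
    using fabs_coeff_le_gnorm[of S 0] gR by linarith
  define k where "k = degree M"
  have k: "1 \<le> k" unfolding k_def M_def by (rule degree_minpoly_fls_pos)
  have ac: "acabs \<beta> = fabs (coeff M 0) powr (1 / real k)"
    using \<open>\<beta> \<noteq> 0\<close> by (simp add: acabs_def M_def k_def)
  \<comment> \<open>The constant coefficient has size \<open>acabs \<beta> ^ k\<close>; the
    hypothesis \<open>le1\<close> allows \<open>k\<close> to be replaced by 1.\<close>
  have "fabs (coeff M 0) \<le> acabs \<beta>"
  proof (cases "coeff M 0 = 0")
    case False
    then have "fabs (coeff M 0) = acabs \<beta> ^ k"
      using k by (simp add: ac powr_powr flip: powr_realpow)
    also have "\<dots> \<le> acabs \<beta> ^ 1"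
      by (rule power_decreasing) (use k le1 in \<open>auto simp: \<beta>_def [symmetric] ac\<close>)
    finally show ?thesis by simp
  qed (simp add: ac)
  moreover have "evalT P \<xi> = coeff M 0 * coeff S 0"
    using arg_cong[OF S, of "\<lambda>p. poly p 0"]
    by (simp add: R_def poly_pcompose evalT_def flip: poly_0_coeff_0)
  ultimately show ?thesis
    using S0 by (auto simp: fabs_mult \<beta>_def mult.commute
        intro!: mult_mono intro: order_trans[OF fabs_nonneg])
qed

section \<open>Norms from a quadratic extension\<close>

lemma range_polyT_closed:
  "x \<in> range polyT \<Longrightarrow> y \<in> range polyT \<Longrightarrow> x + y \<in> range (polyT :: 'a::{field,finite} poly \<Rightarrow> _)"
  "x \<in> range polyT \<Longrightarrow> y \<in> range polyT \<Longrightarrow> x - y \<in> range (polyT :: 'a::{field,finite} poly \<Rightarrow> _)"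
  "x \<in> range polyT \<Longrightarrow> y \<in> range polyT \<Longrightarrow> x * y \<in> range (polyT :: 'a::{field,finite} poly \<Rightarrow> _)"
  "x \<in> range polyT \<Longrightarrow> x ^ n \<in> range (polyT :: 'a::{field,finite} poly \<Rightarrow> _)"
  by (auto simp flip: polyT_hom.hom_add polyT_hom.hom_diff polyT_hom.hom_mult polyT_hom.hom_power)

text \<open>The roots of \<open>A X^2 - B X + C\<close> in the Laurent series field, given by
  Vieta's formulas: trace and norm are what inversion, shifts and Frobenius transform in a simple
  way.\<close>

locale conjugate_pair =
  fixes A B C :: "'a::{field,finite} poly" and z z' :: "'a fls"
  assumes A_nonzero: "A \<noteq> 0"
    and trace: "polyT A * (z + z') = polyT B" and norm: "polyT A * (z * z') = polyT C"
begin

text \<open>Newton's recursion for power sums; after multiplication by \<open>A ^ n\<close> its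
  coefficients become \<open>B\<close> and \<open>C A\<close>.\<close>

lemma power_sum_integral: "polyT A ^ n * (z ^ n + z' ^ n) \<in> range polyT"
proof (induction n rule: less_induct)
  case (less n)
  consider "n = 0" | "n = 1" | m where "n = Suc (Suc m)"
    by (metis One_nat_def not0_implies_Suc)
  then show ?case
  proof cases
    case 1
    then have "polyT A ^ n * (z ^ n + z' ^ n) = polyT (1 + 1)"
      by (simp only: polyT_hom.hom_add polyT_hom.hom_1 power_0 mult_1_left)
    then show ?thesis by blast
  next
    case 2
    then show ?thesis by (auto simp: trace)
  next
    case 3
    have "polyT A ^ n * (z ^ n + z' ^ n) =
        polyT B * (polyT A ^ Suc m * (z ^ Suc m + z' ^ Suc m)) -
        polyT C * polyT A * (polyT A ^ m * (z ^ m + z' ^ m))"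
      unfolding trace [symmetric] norm [symmetric] 3 by (simp add: algebra_simps)
    also have "\<dots> \<in> range polyT"
      using 3 by (intro range_polyT_closed less rangeI) auto
    finally show ?thesis .
  qed
qed

lemma power_sum_integral': "j \<le> n \<Longrightarrow> polyT A ^ n * (z ^ j + z' ^ j) \<in> range polyT"
  using range_polyT_closed(3)[OF range_polyT_closed(4)[OF rangeI, of A "n - j"] power_sum_integral[of j]]
  by (simp add: mult.assoc [symmetric] power_add [symmetric])

text \<open>The factor \<open>z ^ j\<close> makes a Horner induction possible: splitting off the
  lowest coefficient of \<open>P\<close> raises \<open>j\<close> by one, and the coefficient itself
  meets a power sum.\<close>

lemma trace_integral:
  "degree P \<le> n \<Longrightarrow> polyT A ^ (n + j) * (z ^ j * evalT P z + z' ^ j * evalT P z') \<in> range polyT"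
proof (induction P arbitrary: n j)
  case 0
  have "(0 :: 'a fls) \<in> range polyT" using polyT_hom.hom_0 by (metis rangeI)
  then show ?case by simp
next
  case (pCons a P)
  have "polyT a * (polyT A ^ (n + j) * (z ^ j + z' ^ j)) +
      polyT A ^ (n + j) * (z ^ Suc j * evalT P z + z' ^ Suc j * evalT P z') \<in> range polyT"
  proof (intro range_polyT_closed(1) range_polyT_closed(3)[OF rangeI] power_sum_integral')
    show "polyT A ^ (n + j) * (z ^ Suc j * evalT P z + z' ^ Suc j * evalT P z') \<in> range polyT"
    proof (cases n)
      case 0
      then have "P = 0" using pCons.prems by (auto split: if_splits)
      moreover have "(0 :: 'a fls) \<in> range polyT" using polyT_hom.hom_0 by (metis rangeI)
      ultimately show ?thesis by simp
    next
      case (Suc k)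
      then have "degree P \<le> k" using pCons.prems by (auto split: if_splits)
      then show ?thesis using pCons.IH[of k "Suc j"] by (simp add: Suc)
    qed
  qed simp
  then show ?case
    by (simp add: evalT_pCons algebra_simps)
qed

text \<open>For \<open>P = a + X Q\<close> the norm is
  \<open>a^2 + a Tr(z Q(z)) + z z' N(Q(z))\<close>; the middle term is \<open>trace_integral\<close>
  with \<open>j = 1\<close>, and one factor \<open>A\<close> turns \<open>z z'\<close> into
  \<open>C\<close>.\<close>

lemma norm_integral: "degree P \<le> n \<Longrightarrow> polyT A ^ n * (evalT P z * evalT P z') \<in> range polyT"
proof (induction P arbitrary: n)
  case 0
  have "(0 :: 'a fls) \<in> range polyT" using polyT_hom.hom_0 by (metis rangeI)
  then show ?case by simp
next
  case (pCons a P)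
  have a: "polyT A ^ n * polyT a ^ 2 \<in> range polyT"
    by (intro range_polyT_closed rangeI)
  show ?case
  proof (cases n)
    case 0
    then have "P = 0" using pCons.prems by (auto split: if_splits)
    with a show ?thesis by (simp add: evalT_pCons power2_eq_square)
  next
    case (Suc k)
    then have k: "degree P \<le> k" using pCons.prems by (auto split: if_splits)
    have "polyT A ^ n * polyT a ^ 2 +
        (polyT a * (polyT A ^ (k + 1) * (z ^ 1 * evalT P z + z' ^ 1 * evalT P z')) +
        polyT C * (polyT A ^ k * (evalT P z * evalT P z'))) \<in> range polyT"
      by (intro range_polyT_closed(1) a range_polyT_closed(3)[OF rangeI] trace_integral pCons.IH k)
    then show ?thesis
      unfolding norm [symmetric] Suc by (simp add: evalT_pCons algebra_simps power2_eq_square)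
  qed
qed

lemma one_le_norm:
  assumes "degree P \<le> n" "evalT P z \<noteq> 0" "evalT P z' \<noteq> 0"
  shows "1 \<le> fabs (polyT A) ^ n * (fabs (evalT P z) * fabs (evalT P z'))"
proof -
  obtain p where p: "polyT A ^ n * (evalT P z * evalT P z') = polyT p"
    using norm_integral[OF assms(1)] by auto
  then have "polyT p \<noteq> 0" using assms A_nonzero by (metis mult_eq_0_iff polyT_eq_0_iff power_not_zero)
  then have "1 \<le> fabs (polyT p)" using fabs_polyT_ge_1[of p] by auto
  then show ?thesis by (simp flip: p add: fabs_mult fabs_power)
qed

abbreviation quad :: "'a poly poly" where
  "quad \<equiv> [:C, - B, A:]"

lemma evalT_quad: "evalT quad x = polyT A * ((x - z) * (x - z'))"
  by (simp add: evalT_pCons trace [symmetric] norm [symmetric] algebra_simps)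

lemma annihilates_quad: "annihilates quad \<alpha> \<longleftrightarrow> \<alpha> = to_ac z \<or> \<alpha> = to_ac z'"
proof -
  have "poly (map_poly embT quad) \<alpha> = to_ac (polyT A) * ((\<alpha> - to_ac z) * (\<alpha> - to_ac z'))"
    by (simp add: embT_hom.map_hom_pCons embT_hom.hom_minus)
      (simp add: embT_def trace [symmetric] norm [symmetric] algebra_simps)
  then show ?thesis using A_nonzero by simp
qed

end

locale irrational_conjugate_pair = conjugate_pair +
  assumes primitive: "primitive_poly [:C, - B, A:]"
    and irrational: "\<And>U V. polyT U * z + polyT V = 0 \<Longrightarrow> U = 0"
begin

lemma irrational': "polyT U * z' + polyT V = 0 \<Longrightarrow> U = 0"
proof -
  assume *: "polyT U * z' + polyT V = 0"
  have "polyT (- (A * U)) * z + polyT (U * B + A * V) =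
      polyT U * (polyT B - polyT A * (z + z')) + polyT A * (polyT U * z' + polyT V)"
    by (simp add: algebra_simps)
  also have "\<dots> = 0" by (simp add: trace *)
  finally have "- (A * U) = 0" by (rule irrational)
  then show ?thesis using A_nonzero by simp
qed

lemma minpolyT_conjugates:
  assumes "\<alpha> = to_ac z \<or> \<alpha> = to_ac z'"
  shows "algebraicT \<alpha>" "\<exists>u. u \<noteq> 0 \<and> quad = smult [:u:] (minpolyT \<alpha>)"
proof -
  have "U = 0" if "embT U * \<alpha> + embT V = 0" for U V
  proof -
    have "to_ac (polyT U * z + polyT V) = 0 \<or> to_ac (polyT U * z' + polyT V) = 0"
      using that assms unfolding embT_def by auto
    then show ?thesis
      using irrational irrational' by (metis to_ac_eq_0_iff)
  qed
  moreover have "annihilates quad \<alpha>" using assms annihilates_quad by blast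
  ultimately show "algebraicT \<alpha>" "\<exists>u. u \<noteq> 0 \<and> quad = smult [:u:] (minpolyT \<alpha>)"
    using minpolyT_quadratic[OF A_nonzero primitive] by blast+
qed

text \<open>Up to a constant from F_q, \<open>quad\<close> is the minimal polynomial of both of its
  roots.\<close>

lemma quad_dvd:
  assumes "evalT P z = 0 \<or> evalT P z' = 0"
  shows "quad dvd P"
proof -
  obtain \<alpha> where \<alpha>: "\<alpha> = to_ac z \<or> \<alpha> = to_ac z'" "annihilates P \<alpha>"
    using assms poly_map_embT by (metis to_ac_0)
  obtain u where u: "u \<noteq> 0" "quad = smult [:u:] (minpolyT \<alpha>)"
    using minpolyT_conjugates[OF \<alpha>(1)] by blast
  have "minpolyT \<alpha> dvd P"
    using minpolyT_properties(2) minpolyT_conjugates(1)[OF \<alpha>(1)] \<alpha> by blast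
  then obtain K where "P = minpolyT \<alpha> * K" by auto
  also have "\<dots> = quad * smult [:inverse u:] K"
    using u by (simp flip: one_pCons)
  finally show ?thesis by (rule dvdI)
qed

lemma degA_conjugate: "degA (to_ac z) = 2"
proof -
  obtain u where "u \<noteq> 0" "quad = smult [:u:] (minpolyT (to_ac z))"
    using minpolyT_conjugates by blast
  then have "degree quad = degree (minpolyT (to_ac z))" by simp
  then show ?thesis using A_nonzero by (simp add: degA_def)
qed

lemma heightA_conjugate: "heightA (to_ac z) = heightT quad"
proof -
  obtain u where u: "u \<noteq> 0" "quad = smult [:u:] (minpolyT (to_ac z))"
    using minpolyT_conjugates by blast
  have "heightT quad = heightT ([:[:u:]:] * minpolyT (to_ac z))" using u by simp
  also have "\<dots> = heightT (minpolyT (to_ac z))"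
    unfolding heightT_mult heightT_const using u by (simp add: polyT_pCons)
  finally show ?thesis by (simp add: heightA_def)
qed

end

text \<open>A bound \<open>b\<close> for all coefficients is used instead of the height because it
  is inherited by the tail polynomial in the Horner induction.\<close>

lemma evalT_lipschitz:
  fixes P :: "'a::{field,finite} poly poly"
  assumes x: "fabs x \<le> real CARD('a)" and y: "fabs y \<le> real CARD('a)"
  shows "degree P \<le> n \<Longrightarrow> (\<And>i. fabs (polyT (coeff P i)) \<le> b) \<Longrightarrow>
    fabs (evalT P x - evalT P y) \<le> b * real CARD('a) ^ n * fabs (x - y)"
proof (induction P arbitrary: n)
  case 0
  have "0 \<le> b" using 0(2)[of 0] by simp
  then show ?case by simp
next
  case (pCons a P)
  have b: "\<And>i. fabs (polyT (coeff P i)) \<le> b" using pCons.prems(2)[of "Suc _"] by simp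
  then have b0: "0 \<le> b" using fabs_nonneg order_trans by blast
  show ?case
  proof (cases n)
    case 0
    then have "P = 0" using pCons.prems by (auto split: if_splits)
    then show ?thesis using b0 by (simp add: evalT_pCons)
  next
    case (Suc k)
    then have k: "degree P \<le> k" using pCons.prems by (auto split: if_splits)
    have H: "heightT P \<le> b"
      unfolding heightT_eq_gnorm by (rule gnorm_le) (use b in simp)
    have "fabs (evalT P x) \<le> heightT P * real CARD('a) ^ k"
      by (rule evalT_le[OF k x])
    also have "\<dots> \<le> b * real CARD('a) ^ k"
      using H by (intro mult_right_mono) auto
    also have "\<dots> \<le> b * real CARD('a) ^ n"
      using b0 unfolding Suc by (intro mult_left_mono power_increasing) (auto simp: Suc_leI)
    finally have 1: "fabs ((x - y) * evalT P x) \<le> b * real CARD('a) ^ n * fabs (x - y)"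
      unfolding fabs_mult by (subst mult.commute) (intro mult_right_mono, auto)
    have "fabs y * fabs (evalT P x - evalT P y) \<le> real CARD('a) * (b * real CARD('a) ^ k * fabs (x - y))"
      by (intro mult_mono y pCons.IH k b) auto
    then have 2: "fabs (y * (evalT P x - evalT P y)) \<le> b * real CARD('a) ^ n * fabs (x - y)"
      unfolding fabs_mult by (simp add: Suc algebra_simps)
    have "evalT (pCons a P) x - evalT (pCons a P) y =
        (x - y) * evalT P x + y * (evalT P x - evalT P y)"
      by (simp add: evalT_pCons algebra_simps)
    then show ?thesis using fabs_add_bound[OF 1 2] by simp
  qed
qed

section \<open>Exponents from a dense sequence of quadratic approximations\<close>

lemma eventually_exponential_ge:
  fixes r x :: real
  assumes "1 < r" "0 < x"
  shows "\<exists>k0. \<forall>k\<ge>k0. c \<le> x * r ^ k"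
proof -
  obtain k0 where k0: "c / x < r ^ k0" using real_arch_pow[OF assms(1)] by blast
  have "c \<le> x * r ^ k" if "k0 \<le> k" for k
  proof -
    have "r ^ k0 \<le> r ^ k" using assms that by (intro power_increasing) auto
    with k0 have "c / x < r ^ k" by linarith
    then show ?thesis using assms by (simp add: field_simps less_imp_le)
  qed
  then show ?thesis by blast
qed

lemma card_field_neq_1 [simp]: "CARD('a::{field,finite}) \<noteq> Suc 0"
  using card_field_gt_1[where 'a = 'a] by linarith

lemma power_powr_eq:
  "(real CARD('a::{field,finite}) powr y) ^ n = real CARD('a) powr (real n * y)"
  by (simp add: powr_power mult.commute)

text \<open>To base \<open>q\<close>, the logarithms of \<open>|A k|\<close>,
  \<open>|\<xi> - z k|\<close> and \<open>|\<xi> - z' k|\<close> are affine in \<open>r ^ k\<close>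
  with slopes \<open>a\<close>, \<open>-g\<close>, \<open>-f\<close>. The summand 2 in the height
  reflects \<open>|z k * z' k| = q^2\<close> in the applications, where \<open>C k\<close> is the
  largest coefficient. That the same \<open>r\<close> governs every \<open>k\<close> is the density
  which the upper bounds exploit.\<close>

locale quadratic_approximations =
  fixes \<xi> :: "'a::{field,finite} fls"
    and A B C :: "nat \<Rightarrow> 'a poly" and z z' :: "nat \<Rightarrow> 'a fls"
    and r a f g ca cf cg :: real
  assumes pair: "\<And>k. irrational_conjugate_pair (A k) (B k) (C k) (z k) (z' k)"
    and r_gt_1: "1 < r" and a_pos: "0 < a" and f_pos: "0 < f" and f_le_a: "f \<le> a" and f_le_g: "f \<le> g"
    and xi_le: "fabs \<xi> \<le> real CARD('a)"
    and z_le: "\<And>k. fabs (z k) \<le> real CARD('a)" and z'_le: "\<And>k. fabs (z' k) \<le> real CARD('a)"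
    and fabs_A: "\<And>k. fabs (polyT (A k)) = real CARD('a) powr (a * r ^ k + ca)"
    and height: "\<And>k. heightT [:C k, - B k, A k:] = real CARD('a) powr (a * r ^ k + ca + 2)"
    and dist_z: "\<And>k. fabs (\<xi> - z k) = real CARD('a) powr (- (g * r ^ k + cg))"
    and dist_z': "\<And>k. fabs (\<xi> - z' k) = real CARD('a) powr (- (f * r ^ k + cf))"
begin

abbreviation "qpoly k \<equiv> [:C k, - B k, A k:]"

text \<open>Up to bounded factors the height is \<open>q ^ (a r ^ k)\<close>, the distance
  \<open>q ^ (- g r ^ k)\<close>, and \<open>|qpoly k|\<close> at \<xi> is
  \<open>q ^ ((a - g - f) r ^ k)\<close>; \<open>wstar\<close> and \<open>w\<close> are the
  exponents realized by these.\<close>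

definition "wstar = g / a - 1"

definition "w = wstar + f / a"

lemma g_pos: "0 < g"
  using f_pos f_le_g by linarith

lemma r_pos: "0 < r ^ k"
  using r_gt_1 by simp

lemma cpair: "conjugate_pair (A k) (B k) (C k) (z k) (z' k)"
  using pair irrational_conjugate_pair.axioms(1) by blast

lemma A_nz: "A k \<noteq> 0"
  using conjugate_pair.A_nonzero[OF cpair] .

lemma quad_nonzero: "qpoly k \<noteq> 0"
  using A_nz by simp

lemma evalT_quad_xi:
  "fabs (evalT (qpoly k) \<xi>) = real CARD('a) powr (a * r ^ k + ca - (g * r ^ k + cg) - (f * r ^ k + cf))"
  unfolding conjugate_pair.evalT_quad[OF cpair[of k]]
  by (simp only: fabs_mult fabs_A dist_z dist_z' powr_add [symmetric]) (simp add: algebra_simps)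

definition lheight :: "'a poly poly \<Rightarrow> real" where
  "lheight P = log (real CARD('a)) (heightT P)"

lemma heightT_eq: "P \<noteq> 0 \<Longrightarrow> heightT P = real CARD('a) powr lheight P"
  using heightT_ge_1[of P] by (simp add: lheight_def)

lemma lheight_nonneg: "P \<noteq> 0 \<Longrightarrow> 0 \<le> lheight P"
  using heightT_ge_1[of P] by (simp add: lheight_def zero_le_log_cancel_iff)

lemma lheight_mult: "P \<noteq> 0 \<Longrightarrow> R \<noteq> 0 \<Longrightarrow> lheight (P * R) = lheight P + lheight R"
  using heightT_ge_1[of P] heightT_ge_1[of R] by (simp add: lheight_def heightT_mult log_mult)

lemma lheight_quad: "lheight (qpoly k) = a * r ^ k + ca + 2"
  by (simp add: lheight_def height)

lemma evalT_conjugate_le: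
  assumes P: "P \<noteq> 0" "degree P \<le> n" and V: "fabs (evalT P \<xi>) \<le> real CARD('a) powr v"
    and x: "fabs x \<le> real CARD('a)" "fabs (\<xi> - x) = real CARD('a) powr (- e)"
  shows "fabs (evalT P x) \<le> real CARD('a) powr (max v (lheight P + real n - e))"
proof -
  have "fabs (evalT P x - evalT P \<xi>) \<le> heightT P * real CARD('a) ^ n * fabs (x - \<xi>)"
    by (rule evalT_lipschitz[OF x(1) xi_le P(2)]) (rule fabs_coeff_le_heightT)
  also have "\<dots> = real CARD('a) powr (lheight P + real n - e)"
    using x P by (simp add: fabs_minus_commute[of x] heightT_eq powr_add powr_diff powr_minus
        powr_realpow field_simps)
  finally have "fabs (evalT P x - evalT P \<xi>) \<le> real CARD('a) powr (max v (lheight P + real n - e))"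
    by (rule order_trans) (auto intro: powr_mono)
  moreover have "fabs (evalT P \<xi>) \<le> real CARD('a) powr (max v (lheight P + real n - e))"
    using V by (rule order_trans) (auto intro: powr_mono)
  ultimately show ?thesis
    using fabs_add_bound[of "evalT P x - evalT P \<xi>" _ "evalT P \<xi>"] by simp
qed

text \<open>The \<open>k\<close>-th approximation is chosen such that the two bounds for \<open>P(z k)\<close> and \<open>P(z' k)\<close>
  in terms of the height cannot both be the effective ones; \<open>k\<close> is minimal with this property.\<close>

lemma nonroot_lower_bound:
  assumes n: "2 * f \<le> real n * a" "real n * a < g + f"
    and cond: "2 * r * a * (real n * a - f) \<le> (g - 2 * a) * (g + f - real n * a)"
  shows "\<exists>c\<ge>0. \<forall>P. P \<noteq> 0 \<longrightarrow> degree P \<le> n \<longrightarrow> (\<forall>k. evalT P (z k) \<noteq> 0 \<and> evalT P (z' k) \<noteq> 0) \<longrightarrow>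
    real CARD('a) powr (- (wstar * lheight P + c)) \<le> fabs (evalT P \<xi>)"
proof -
  \<comment> \<open>With \<open>h\<close> the logarithmic height of \<open>P\<close>, the condition
    \<open>s * r ^ k > 2 * h + K\<close> excludes that both Lipschitz bounds are effective. For the
    least such \<open>k\<close>, one effective bound gives an exponent of at most \<open>E\<close>,
    up to the constant \<open>c1\<close>; the hypothesis \<open>cond\<close> is equivalent to
    \<open>E \<le> wstar\<close>.\<close>
  define s where "s = g + f - real n * a"
  define K where "K = max 0 (2 * real n - cg - cf + real n * ca)"
  define E where "E = 1 + 2 * r * (real n * a - f) / s"
  define c1 where "c1 = (real n * a - f) * (1 + r * K / s)"
  define c where "c = c1 + \<bar>real n * ca / 2\<bar> + \<bar>real n * ca\<bar> + real n + \<bar>cf\<bar> + \<bar>cg\<bar> + 1"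
  have s: "0 < s" using n by (simp add: s_def)
  have K: "0 \<le> K" by (simp add: K_def)
  have naf: "0 \<le> real n * a - f" using n f_pos by linarith
  have c1: "0 \<le> c1" unfolding c1_def using naf s K r_gt_1 by (intro mult_nonneg_nonneg) auto
  have "2 * r * (real n * a - f) * a \<le> (g - 2 * a) * s"
    using cond by (simp add: s_def algebra_simps)
  then have E: "E \<le> wstar"
    using s a_pos by (simp add: E_def wstar_def field_simps)
  have "real CARD('a) powr (- (wstar * lheight P + c)) \<le> fabs (evalT P \<xi>)"
    if P: "P \<noteq> 0" "degree P \<le> n" and roots: "\<And>k. evalT P (z k) \<noteq> 0 \<and> evalT P (z' k) \<noteq> 0" for P
  proof (rule ccontr)
    define h where "h = lheight P"
    have h: "0 \<le> h" using lheight_nonneg P by (simp add: h_def)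
    define y where "y = wstar * h + c"
    assume "\<not> ?thesis"
    then have V: "fabs (evalT P \<xi>) \<le> real CARD('a) powr (- y)" by (simp add: y_def h_def)
    obtain k1 where "2 * h + K + 1 \<le> s * r ^ k1"
      using eventually_exponential_ge[OF r_gt_1 s, of "2 * h + K + 1"] by blast
    then have "\<exists>k. 2 * h + K < s * r ^ k" by (intro exI[of _ k1]) linarith
    then obtain k where k: "2 * h + K < s * r ^ k"
      and min: "\<And>j. j < k \<Longrightarrow> s * r ^ j \<le> 2 * h + K"
      using exists_least_iff[of "\<lambda>k. 2 * h + K < s * r ^ k"] by (auto simp: not_less)
    have rk: "r ^ k \<le> 1 + r * (2 * h + K) / s"
    proof (cases k)
      case 0
      then show ?thesis using h K s r_gt_1 by simp
    next
      case (Suc j)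
      then have "r ^ j \<le> (2 * h + K) / s" using min[of j] s by (simp add: field_simps)
      then have "r * r ^ j \<le> r * ((2 * h + K) / s)" using r_gt_1 by (intro mult_left_mono) auto
      then show ?thesis by (simp add: Suc)
    qed
    have "(real n * a - f) * r ^ k \<le> (real n * a - f) * (1 + r * (2 * h + K) / s)"
      by (rule mult_left_mono[OF rk naf])
    also have "\<dots> = (E - 1) * h + c1"
      using s by (simp add: E_def c1_def field_simps)
    finally have "(real n * a - f) * r ^ k + h \<le> E * h + c1"
      by (simp add: algebra_simps)
    also have "\<dots> \<le> wstar * h + c1" using E h by (simp add: mult_right_mono)
    finally have main: "(real n * a - f) * r ^ k + h \<le> y - (c - c1)" by (simp add: y_def)
    define S Y Z N where "S = real n * (a * r ^ k)" and "Y = f * r ^ k" and "Z = g * r ^ k"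
      and "N = real n * ca"
    have "2 * Y \<le> S" "Y \<le> Z"
      unfolding S_def Y_def Z_def using n f_le_g r_pos[of k]
      by (simp_all add: mult_right_mono flip: mult.assoc)
    moreover have "S - Y + h \<le> y - (c - c1)"
      using main by (simp add: S_def Y_def algebra_simps)
    moreover have "2 * h + 2 * real n - cg - cf + N < Z + Y - S"
      using k by (simp add: s_def K_def S_def Y_def Z_def N_def algebra_simps)
    moreover have "c - c1 = \<bar>N / 2\<bar> + \<bar>N\<bar> + real n + \<bar>cf\<bar> + \<bar>cg\<bar> + 1"
      by (simp add: c_def N_def)
    \<comment> \<open>One inequality for each way in which the two maxima can be attained. The last
      expresses that \<open>k\<close> is large enough; the other three follow from
      \<open>main\<close>, hence from the minimality of \<open>k\<close>.\<close>
    ultimately have ineqs: "S + N < 2 * y" "S + N + (h + real n - (Z + cg)) < y"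
      "S + N + (h + real n - (Y + cf)) < y"
      "S + N + (h + real n - (Z + cg)) + (h + real n - (Y + cf)) < 0"
      using h by linarith+
    have XN: "real n * (a * r ^ k + ca) = S + N"
      by (simp add: S_def N_def algebra_simps)
    let ?e1 = "h + real n - (g * r ^ k + cg)" and ?e2 = "h + real n - (f * r ^ k + cf)"
    have "1 \<le> fabs (polyT (A k)) ^ n * (fabs (evalT P (z k)) * fabs (evalT P (z' k)))"
      using conjugate_pair.one_le_norm[OF cpair[of k] P(2)]
        roots by blast
    also have "\<dots> \<le> fabs (polyT (A k)) ^ n * (real CARD('a) powr (max (- y) ?e1) * real CARD('a) powr (max (- y) ?e2))"
      using evalT_conjugate_le[OF P V z_le dist_z] evalT_conjugate_le[OF P V z'_le dist_z']
      by (intro mult_left_mono mult_mono) (auto simp: h_def)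
    also have "\<dots> = real CARD('a) powr (real n * (a * r ^ k + ca) + max (- y) ?e1 + max (- y) ?e2)"
      by (simp only: fabs_A power_powr_eq) (simp only: powr_add mult.assoc)
    finally have "0 \<le> real n * (a * r ^ k + ca) + max (- y) ?e1 + max (- y) ?e2"
      using powr_le_cancel_iff[of "real CARD('a)" 0] by simp
    with ineqs show False
      unfolding XN S_def [symmetric] Y_def [symmetric] Z_def [symmetric] by linarith
  qed
  moreover have "0 \<le> c" using c1 by (simp add: c_def)
  ultimately show ?thesis by blast
qed

lemma a_times_w: "a * w = g + f - a"
  using a_pos by (simp add: w_def wstar_def field_simps)

text \<open>A polynomial vanishing at some \<open>z k\<close> or \<open>z' k\<close> is divisible by
  \<open>qpoly k\<close>, which is split off in an induction on the degree. Heights are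
  multiplicative and \<open>qpoly k\<close> satisfies the bound with exponent \<open>w\<close>, so
  only the constants accumulate; hence the factor \<open>1 + degree P\<close>.\<close>

lemma evalT_lower_bound:
  assumes n: "2 * f \<le> real n * a" "real n * a < g + f"
    and cond: "2 * r * a * (real n * a - f) \<le> (g - 2 * a) * (g + f - real n * a)"
  shows "\<exists>c. \<forall>P. P \<noteq> 0 \<longrightarrow> degree P \<le> n \<longrightarrow> real CARD('a) powr (- (w * lheight P + c)) \<le> fabs (evalT P \<xi>)"
proof -
  obtain c0 where c0: "0 \<le> c0"
    "\<And>P. P \<noteq> 0 \<Longrightarrow> degree P \<le> n \<Longrightarrow> (\<And>k. evalT P (z k) \<noteq> 0 \<and> evalT P (z' k) \<noteq> 0) \<Longrightarrow>
      real CARD('a) powr (- (wstar * lheight P + c0)) \<le> fabs (evalT P \<xi>)"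
    using nonroot_lower_bound[OF assms] by auto
  \<comment> \<open>The second entry is what \<open>qpoly k\<close> itself requires: by
    \<open>a_times_w\<close> the terms in \<open>r ^ k\<close> cancel and this constant is
    left.\<close>
  define c where "c = max c0 (cg + cf - ca - w * (ca + 2))"
  have "real CARD('a) powr (- (w * lheight P + c * (1 + real (degree P)))) \<le> fabs (evalT P \<xi>)"
    if "P \<noteq> 0" "degree P \<le> n" for P
    using that
  proof (induction "degree P" arbitrary: P rule: less_induct)
    case less
    have h: "0 \<le> lheight P" using less.prems lheight_nonneg by blast
    show ?case
    proof (cases "\<forall>k. evalT P (z k) \<noteq> 0 \<and> evalT P (z' k) \<noteq> 0")
      case True
      have "wstar * lheight P \<le> w * lheight P"
        using a_pos f_pos h by (intro mult_right_mono) (auto simp: w_def)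
      moreover have "c * 1 \<le> c * (1 + real (degree P))"
        using c0(1) by (intro mult_left_mono) (auto simp: c_def)
      ultimately have "real CARD('a) powr (- (w * lheight P + c * (1 + real (degree P)))) \<le>
          real CARD('a) powr (- (wstar * lheight P + c0))"
        by (intro powr_mono) (auto simp: c_def)
      also have "\<dots> \<le> fabs (evalT P \<xi>)" using c0(2) less.prems True by blast
      finally show ?thesis .
    next
      case False
      then obtain k where "evalT P (z k) = 0 \<or> evalT P (z' k) = 0" by blast
      then have "qpoly k dvd P"
        using irrational_conjugate_pair.quad_dvd[OF pair[of k]] by blast
      then obtain G where G: "P = qpoly k * G" by (rule dvdE)
      have nz: "G \<noteq> 0" "A k \<noteq> 0"
        using less.prems G A_nz by auto
      have deg: "degree P = 2 + degree G"
        unfolding G using nz by (subst degree_mult_eq) auto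
      have "real CARD('a) powr (- (w * lheight G + c * (1 + real (degree G)))) \<le> fabs (evalT G \<xi>)"
        using less.hyps[of G] less.prems deg nz by simp
      moreover have "real CARD('a) powr (- (w * lheight (qpoly k) + c)) \<le> fabs (evalT (qpoly k) \<xi>)"
      proof -
        have "w * (a * r ^ k) = (g + f - a) * r ^ k"
          using a_times_w by (metis mult.assoc mult.commute)
        then show ?thesis
          unfolding evalT_quad_xi lheight_quad by (intro powr_mono) (auto simp: c_def algebra_simps)
      qed
      ultimately have "real CARD('a) powr (- (w * lheight (qpoly k) + c)) *
          real CARD('a) powr (- (w * lheight G + c * (1 + real (degree G)))) \<le> fabs (evalT P \<xi>)"
        unfolding G evalT_mult fabs_mult by (intro mult_mono) auto
      then have "real CARD('a) powr (- (w * lheight (qpoly k) + c) + - (w * lheight G + c * (1 + real (degree G))))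
          \<le> fabs (evalT P \<xi>)"
        by (simp only: powr_add)
      moreover have "lheight P = lheight (qpoly k) + lheight G"
        unfolding G using lheight_mult[OF quad_nonzero nz(1)] .
      moreover have "0 \<le> c" using c0(1) by (simp add: c_def)
      ultimately show ?thesis
        by (elim order_trans[rotated], intro powr_mono) (auto simp: deg algebra_simps)
    qed
  qed
  note bound = this
  have "0 \<le> c" using c0(1) by (simp add: c_def)
  have "real CARD('a) powr (- (w * lheight P + c * (1 + real n))) \<le> fabs (evalT P \<xi>)"
    if "P \<noteq> 0" "degree P \<le> n" for P
  proof -
    have "c * (1 + real (degree P)) \<le> c * (1 + real n)"
      using \<open>0 \<le> c\<close> that by (intro mult_left_mono) auto
    then have "real CARD('a) powr (- (w * lheight P + c * (1 + real n))) \<le>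
        real CARD('a) powr (- (w * lheight P + c * (1 + real (degree P))))"
      by (intro powr_mono) auto
    with bound[OF that] show ?thesis by linarith
  qed
  then show ?thesis by blast
qed

lemma finite_bounded_lheight: "finite {P. P \<noteq> 0 \<and> degree P \<le> n \<and> lheight P \<le> b}"
proof (rule finite_subset)
  show "{P. P \<noteq> 0 \<and> degree P \<le> n \<and> lheight P \<le> b} \<subseteq> {P. degree P \<le> n \<and> heightT P \<le> real CARD('a) powr b}"
    by (auto simp: heightT_eq)
qed (rule finite_bounded_height)

lemma w_exp_le:
  assumes n: "2 * f \<le> real n * a" "real n * a < g + f"
    and cond: "2 * r * a * (real n * a - f) \<le> (g - 2 * a) * (g + f - real n * a)"
  shows "w_exp n \<xi> \<le> ereal w"
proof -
  obtain c where c: "\<And>P. P \<noteq> 0 \<Longrightarrow> degree P \<le> n \<Longrightarrow> real CARD('a) powr (- (w * lheight P + c)) \<le> fabs (evalT P \<xi>)"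
    using evalT_lower_bound[OF assms] by blast
  have "x \<le> w" if inf: "infinite {P. degree P \<le> n \<and> 0 < fabs (evalT P \<xi>) \<and>
      fabs (evalT P \<xi>) \<le> heightT P powr (- x)}" for x
  proof (rule ccontr)
    assume "\<not> x \<le> w"
    then have xw: "0 < x - w" by simp
    have "{P. degree P \<le> n \<and> 0 < fabs (evalT P \<xi>) \<and> fabs (evalT P \<xi>) \<le> heightT P powr (- x)}
      \<subseteq> {P. P \<noteq> 0 \<and> degree P \<le> n \<and> lheight P \<le> c / (x - w)}"
    proof clarify
      fix P assume P: "degree P \<le> n" "0 < fabs (evalT P \<xi>)" "fabs (evalT P \<xi>) \<le> heightT P powr (- x)"
      then have "P \<noteq> 0" by auto
      with P have "fabs (evalT P \<xi>) \<le> real CARD('a) powr (- x * lheight P)"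
        by (simp add: heightT_eq powr_powr mult.commute)
      with c[OF \<open>P \<noteq> 0\<close> P(1)] have "real CARD('a) powr (- (w * lheight P + c)) \<le> real CARD('a) powr (- x * lheight P)"
        by linarith
      then have "(x - w) * lheight P \<le> c" by (simp add: algebra_simps)
      then show "P \<noteq> 0 \<and> degree P \<le> n \<and> lheight P \<le> c / (x - w)"
        using xw \<open>P \<noteq> 0\<close> P by (simp add: field_simps)
    qed
    then show False using inf finite_subset finite_bounded_lheight by blast
  qed
  then show ?thesis
    unfolding w_exp_def by (intro Sup_least) auto
qed

lemma minpolyT_conjugate_dvd_height:
  assumes alg: "algebraicT \<alpha>" and root: "evalT (minpolyT \<alpha>) (z k) = 0 \<or> evalT (minpolyT \<alpha>) (z' k) = 0"
  shows "\<alpha> = to_ac (z k) \<or> \<alpha> = to_ac (z' k)" "a * r ^ k + ca + 2 \<le> lheight (minpolyT \<alpha>)"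
proof -
  have "qpoly k dvd minpolyT \<alpha>"
    using irrational_conjugate_pair.quad_dvd[OF pair[of k] root] .
  then obtain G where G: "minpolyT \<alpha> = qpoly k * G" by (rule dvdE)
  have nz: "G \<noteq> 0" "A k \<noteq> 0"
    using minpolyT_nonzero[OF alg] G A_nz by auto
  then have deg: "degree (minpolyT \<alpha>) = 2 + degree G"
    unfolding G by (subst degree_mult_eq) auto
  have "annihilates (minpolyT \<alpha>) \<alpha>"
    using minpolyT_properties(2)[OF alg, of "minpolyT \<alpha>"] by simp
  then have "annihilates (qpoly k) \<alpha> \<or> annihilates G \<alpha>"
    unfolding G embT_hom.map_hom_mult by simp
  moreover have "\<not> annihilates G \<alpha>"
    using minpolyT_properties(2)[OF alg, of G] dvd_imp_degree_le[of "minpolyT \<alpha>" G] nz deg by auto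
  ultimately show "\<alpha> = to_ac (z k) \<or> \<alpha> = to_ac (z' k)"
    using conjugate_pair.annihilates_quad[OF cpair[of k]] by blast
  show "a * r ^ k + ca + 2 \<le> lheight (minpolyT \<alpha>)"
    unfolding G lheight_mult[OF quad_nonzero nz(1)] lheight_quad using lheight_nonneg[OF nz(1)] by simp
qed

text \<open>A minimal polynomial vanishing at \<open>z k\<close> or \<open>z' k\<close> forces
  \<alpha> to be one of these points, whose distances are known, and \<open>f \<le> g\<close> makes
  \<open>z' k\<close> harmless. All other \<alpha> are covered by \<open>nonroot_lower_bound\<close>
  and \<open>evalT_le_acabs\<close>. No factor has to be split off, so the smaller exponent
  \<open>wstar\<close> survives.\<close>

lemma wstar_exp_le:
  assumes n: "2 * f \<le> real n * a" "real n * a < g + f"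
    and cond: "2 * r * a * (real n * a - f) \<le> (g - 2 * a) * (g + f - real n * a)"
  shows "wstar_exp n \<xi> \<le> ereal wstar"
proof -
  obtain c where c: "0 \<le> c" "\<And>P. P \<noteq> 0 \<Longrightarrow> degree P \<le> n \<Longrightarrow>
      (\<And>k. evalT P (z k) \<noteq> 0 \<and> evalT P (z' k) \<noteq> 0) \<Longrightarrow>
      real CARD('a) powr (- (wstar * lheight P + c)) \<le> fabs (evalT P \<xi>)"
    using nonroot_lower_bound[OF assms] by auto
  define c' where "c' = c + real n + \<bar>cg\<bar> + \<bar>cf\<bar> + (wstar + 1) * \<bar>ca\<bar>"
  have ws: "0 < wstar + 1" "a * (wstar + 1) = g"
    using g_pos a_pos by (simp_all add: wstar_def)
  have "x \<le> wstar" if inf: "infinite {\<alpha>. algebraicT \<alpha> \<and> degA \<alpha> \<le> n \<and>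
       0 < acabs (to_ac \<xi> - \<alpha>) \<and> acabs (to_ac \<xi> - \<alpha>) \<le> heightA \<alpha> powr (- x - 1)}" for x
  proof (rule ccontr)
    assume "\<not> x \<le> wstar"
    then have xw: "0 < x - wstar" by simp
    have "{\<alpha>. algebraicT \<alpha> \<and> degA \<alpha> \<le> n \<and>
        0 < acabs (to_ac \<xi> - \<alpha>) \<and> acabs (to_ac \<xi> - \<alpha>) \<le> heightA \<alpha> powr (- x - 1)}
      \<subseteq> (\<Union>P\<in>{P. P \<noteq> 0 \<and> degree P \<le> n \<and> lheight P \<le> c' / (x - wstar)}. {\<alpha>. annihilates P \<alpha>})"
    proof clarify
      fix \<alpha> assume alg: "algebraicT \<alpha>" and deg: "degA \<alpha> \<le> n"
        and pos: "0 < acabs (to_ac \<xi> - \<alpha>)" and le: "acabs (to_ac \<xi> - \<alpha>) \<le> heightA \<alpha> powr (- x - 1)"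
      define F where "F = minpolyT \<alpha>"
      have F: "F \<noteq> 0" "degree F \<le> n" "annihilates F \<alpha>"
        using minpolyT_nonzero[OF alg] deg minpolyT_properties(2)[OF alg, of F]
        by (auto simp: F_def degA_def)
      define h where "h = lheight F"
      have h: "0 \<le> h" using lheight_nonneg F by (simp add: h_def)
      have le': "acabs (to_ac \<xi> - \<alpha>) \<le> real CARD('a) powr ((- x - 1) * h)"
        using le F(1) by (simp add: heightA_def flip: F_def) (simp add: heightT_eq powr_powr h_def mult.commute)
      have "(x - wstar) * h \<le> c'"
      proof (cases "\<forall>k. evalT F (z k) \<noteq> 0 \<and> evalT F (z' k) \<noteq> 0")
        case True
        have "(- x - 1) * h \<le> 0" using ws xw h by (intro mult_nonpos_nonneg) auto
        then have "real CARD('a) powr ((- x - 1) * h) \<le> real CARD('a) powr 0" by (intro powr_mono) auto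
        then have "acabs (to_ac \<xi> - \<alpha>) \<le> 1" using le' by simp
        then have "fabs (evalT F \<xi>) \<le> heightT F * real CARD('a) ^ n * acabs (to_ac \<xi> - \<alpha>)"
          using evalT_le_acabs[OF xi_le] F by blast
        also have "\<dots> \<le> heightT F * real CARD('a) ^ n * real CARD('a) powr ((- x - 1) * h)"
          using le' F by (intro mult_left_mono) (auto simp: heightT_eq)
        also have "\<dots> = real CARD('a) powr (h + real n + (- x - 1) * h)"
          using F by (simp add: heightT_eq powr_add powr_realpow h_def)
        finally have "fabs (evalT F \<xi>) \<le> real CARD('a) powr (h + real n + (- x - 1) * h)" .
        moreover have "real CARD('a) powr (- (wstar * h + c)) \<le> fabs (evalT F \<xi>)"
          unfolding h_def by (rule c(2)[OF F(1,2)]) (use True in blast)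
        ultimately have "real CARD('a) powr (- (wstar * h + c)) \<le>
            real CARD('a) powr (h + real n + (- x - 1) * h)" by linarith
        then have "- (wstar * h + c) \<le> h + real n + (- x - 1) * h" by simp
        then have "(x - wstar) * h \<le> c + real n" by (simp add: algebra_simps)
        also have "\<dots> \<le> c'" using ws by (simp add: c'_def)
        finally show ?thesis .
      next
        case False
        then obtain k where k: "evalT F (z k) = 0 \<or> evalT F (z' k) = 0" by blast
        have \<alpha>: "\<alpha> = to_ac (z k) \<or> \<alpha> = to_ac (z' k)" and hk: "a * r ^ k + ca + 2 \<le> h"
          using minpolyT_conjugate_dvd_height[OF alg] k by (auto simp: F_def h_def)
        have "acabs (to_ac \<xi> - \<alpha>) = fabs (\<xi> - z k) \<or> acabs (to_ac \<xi> - \<alpha>) = fabs (\<xi> - z' k)"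
          using \<alpha> by (auto simp: acabs_to_ac simp flip: to_ac_diff)
        then have "- (g * r ^ k + cg) \<le> (- x - 1) * h \<or> - (f * r ^ k + cf) \<le> (- x - 1) * h"
          using le' unfolding dist_z dist_z' by auto
        moreover have "f * r ^ k \<le> g * r ^ k"
          using f_le_g r_pos[of k] by (intro mult_right_mono) auto
        ultimately have "(x + 1) * h \<le> g * r ^ k + \<bar>cg\<bar> + \<bar>cf\<bar>"
          by (auto simp: algebra_simps)
        also have "g * r ^ k = (wstar + 1) * (a * r ^ k)"
          using ws(2) by (metis mult.assoc mult.commute)
        also have "\<dots> \<le> (wstar + 1) * (h + \<bar>ca\<bar>)"
          using hk ws(1) by (intro mult_left_mono) auto
        finally show ?thesis using c(1) by (simp add: c'_def algebra_simps)
      qed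
      then have "lheight F \<le> c' / (x - wstar)" using xw by (simp add: field_simps h_def)
      with F show "\<alpha> \<in> (\<Union>P\<in>{P. P \<noteq> 0 \<and> degree P \<le> n \<and> lheight P \<le> c' / (x - wstar)}. {\<alpha>. annihilates P \<alpha>})"
        by blast
    qed
    moreover have "finite (\<Union>P\<in>{P. P \<noteq> 0 \<and> degree P \<le> n \<and> lheight P \<le> c' / (x - wstar)}. {\<alpha>. annihilates P \<alpha>})"
    proof (intro finite_UN_I finite_bounded_lheight)
      fix P assume "P \<in> {P. P \<noteq> 0 \<and> degree P \<le> n \<and> lheight P \<le> c' / (x - wstar)}"
      then have "coeff (map_poly embT P) (degree P) \<noteq> 0"
        by (simp add: coeff_map_poly)
      then have "map_poly embT P \<noteq> 0" by auto
      then show "finite {\<alpha>. annihilates P \<alpha>}" by (rule poly_roots_finite)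
    qed
    ultimately show False using inf finite_subset by blast
  qed
  then show ?thesis
    unfolding wstar_exp_def by (intro Sup_least) auto
qed

lemma z_inj: "inj z"
proof (rule injI)
  fix i j assume "z i = z j"
  then have "real CARD('a) powr (- (g * r ^ i + cg)) = real CARD('a) powr (- (g * r ^ j + cg))"
    using dist_z by metis
  then have "r ^ i = r ^ j" using g_pos by (simp add: powr_inj)
  then show "i = j" using r_gt_1 by (simp add: power_inject_exp)
qed

lemma quad_inj: "inj qpoly"
proof (rule injI)
  fix i j assume "qpoly i = qpoly j"
  then have "a * r ^ i + ca + 2 = a * r ^ j + ca + 2" using lheight_quad by metis
  then have "r ^ i = r ^ j" using a_pos by simp
  then show "i = j" using r_gt_1 by (simp add: power_inject_exp)
qed

lemma infinite_image_tail: "inj h \<Longrightarrow> infinite (h ` {k0::nat..})"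
  by (simp add: finite_image_iff inj_on_subset infinite_Ici)

lemma ereal_le_if_all_less:
  assumes "\<And>x. x < y \<Longrightarrow> ereal x \<le> S"
  shows "ereal y \<le> S"
proof (rule dense_le)
  fix x :: ereal assume "x < ereal y"
  then show "x \<le> S" by (cases x) (auto intro: assms)
qed

lemma wstar_exp_ge:
  assumes "2 \<le> n"
  shows "ereal wstar \<le> wstar_exp n \<xi>"
proof (rule ereal_le_if_all_less)
  fix x assume x: "x < wstar"
  have pos: "0 < g - (x + 1) * a"
    using x a_pos by (simp add: wstar_def field_simps)
  obtain k0 where k0: "\<And>k. k0 \<le> k \<Longrightarrow> (x + 1) * (ca + 2) - cg \<le> (g - (x + 1) * a) * r ^ k"
    using eventually_exponential_ge[OF r_gt_1 pos] by blast
  have "(\<lambda>k. to_ac (z k)) ` {k0..} \<subseteq> {\<alpha>. algebraicT \<alpha> \<and> degA \<alpha> \<le> n \<and>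
       0 < acabs (to_ac \<xi> - \<alpha>) \<and> acabs (to_ac \<xi> - \<alpha>) \<le> heightA \<alpha> powr (- x - 1)}"
  proof clarify
    fix k assume "k0 \<le> k"
    interpret irrational_conjugate_pair "A k" "B k" "C k" "z k" "z' k" by (rule pair)
    have "acabs (to_ac \<xi> - to_ac (z k)) = real CARD('a) powr (- (g * r ^ k + cg))"
      by (simp add: acabs_to_ac dist_z flip: to_ac_diff)
    moreover have "heightA (to_ac (z k)) powr (- x - 1) = real CARD('a) powr ((a * r ^ k + ca + 2) * (- x - 1))"
      unfolding heightA_conjugate height by (simp add: powr_powr)
    moreover have "- (g * r ^ k + cg) \<le> (a * r ^ k + ca + 2) * (- x - 1)"
      using k0[OF \<open>k0 \<le> k\<close>] by (simp add: algebra_simps)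
    ultimately show "algebraicT (to_ac (z k)) \<and> degA (to_ac (z k)) \<le> n \<and>
       0 < acabs (to_ac \<xi> - to_ac (z k)) \<and>
       acabs (to_ac \<xi> - to_ac (z k)) \<le> heightA (to_ac (z k)) powr (- x - 1)"
      using minpolyT_conjugates(1)[of "to_ac (z k)"] degA_conjugate assms by simp
  qed
  moreover have "infinite ((\<lambda>k. to_ac (z k)) ` {k0..})"
    by (rule infinite_image_tail) (use z_inj in \<open>auto simp: inj_def\<close>)
  ultimately have "infinite {\<alpha>. algebraicT \<alpha> \<and> degA \<alpha> \<le> n \<and>
       0 < acabs (to_ac \<xi> - \<alpha>) \<and> acabs (to_ac \<xi> - \<alpha>) \<le> heightA \<alpha> powr (- x - 1)}"
    using infinite_super by blast
  then show "ereal x \<le> wstar_exp n \<xi>"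
    unfolding wstar_exp_def by (intro Sup_upper) auto
qed

lemma w_exp_ge:
  assumes "2 \<le> n"
  shows "ereal w \<le> w_exp n \<xi>"
proof (rule ereal_le_if_all_less)
  fix x assume x: "x < w"
  have "a * x < a * w" using x a_pos by simp
  then have pos: "0 < g + f - a - x * a" by (simp add: a_times_w mult.commute)
  obtain k0 where k0: "\<And>k. k0 \<le> k \<Longrightarrow> x * (ca + 2) + ca - cg - cf \<le> (g + f - a - x * a) * r ^ k"
    using eventually_exponential_ge[OF r_gt_1 pos] by blast
  have "qpoly ` {k0..} \<subseteq> {P. degree P \<le> n \<and> 0 < fabs (evalT P \<xi>) \<and> fabs (evalT P \<xi>) \<le> heightT P powr (- x)}"
  proof clarify
    fix k assume "k0 \<le> k"
    have "heightT (qpoly k) powr (- x) = real CARD('a) powr ((a * r ^ k + ca + 2) * (- x))"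
      unfolding height by (simp add: powr_powr)
    moreover have "a * r ^ k + ca - (g * r ^ k + cg) - (f * r ^ k + cf) \<le> (a * r ^ k + ca + 2) * (- x)"
      using k0[OF \<open>k0 \<le> k\<close>] by (simp add: algebra_simps)
    moreover have "degree (qpoly k) \<le> n" using assms by simp
    moreover have "0 < fabs (evalT (qpoly k) \<xi>)" unfolding evalT_quad_xi by simp
    ultimately show "degree (qpoly k) \<le> n \<and> 0 < fabs (evalT (qpoly k) \<xi>) \<and>
        fabs (evalT (qpoly k) \<xi>) \<le> heightT (qpoly k) powr (- x)"
      unfolding evalT_quad_xi by simp
  qed
  moreover have "infinite (qpoly ` {k0..})"
    by (rule infinite_image_tail) (rule quad_inj)
  ultimately have "infinite {P. degree P \<le> n \<and> 0 < fabs (evalT P \<xi>) \<and>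
      fabs (evalT P \<xi>) \<le> heightT P powr (- x)}"
    using infinite_super by blast
  then show "ereal x \<le> w_exp n \<xi>"
    unfolding w_exp_def by (intro Sup_upper) auto
qed

theorem exponents_ge: "ereal wstar \<le> wstar_exp 2 \<xi>" "ereal w \<le> w_exp 2 \<xi>"
  by (rule wstar_exp_ge w_exp_ge, simp)+

theorem exponents_eq:
  assumes "2 \<le> n" "real n * a < g + f"
    and "2 * r * a * (real n * a - f) \<le> (g - 2 * a) * (g + f - real n * a)"
  shows "wstar_exp n \<xi> = ereal wstar" "w_exp n \<xi> = ereal w"
proof -
  have "2 * f \<le> real n * a"
    using assms(1) f_pos f_le_a a_pos by (intro mult_mono) auto
  then show "wstar_exp n \<xi> = ereal wstar" "w_exp n \<xi> = ereal w"
    using assms by (auto intro!: antisym wstar_exp_le w_exp_le wstar_exp_ge w_exp_ge)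
qed

end

section \<open>Characteristic two\<close>

lemma field_power_card:
  fixes x :: "'a::{field,finite}"
  shows "x ^ CARD('a) = x"
proof (cases "x = 0")
  case False
  let ?U = "UNIV - {0 :: 'a}"
  have "(\<Prod>y\<in>?U. x * y) = (\<Prod>y\<in>?U. y)"
    using False by (intro prod.reindex_bij_witness[of _ "\<lambda>y. y / x" "\<lambda>y. x * y"]) auto
  then have "x ^ card ?U = 1"
    by (simp add: prod.distrib)
  moreover have "Suc (card ?U) = CARD('a)"
    by (rule card_Suc_Diff1) auto
  ultimately show ?thesis by (metis power_Suc mult_1_right)
qed (simp add: card_gt_0_iff)

lemma field_power_card_power: "(x :: 'a::{field,finite}) ^ (CARD('a) ^ k) = x"
  by (induction k) (simp_all add: power_mult field_power_card)

text \<open>As \<open>q\<close> is even, the \<open>q\<close>-th power of -1 is 1, while Fermat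
  gives -1.\<close>

lemma CHAR_eq_2I:
  assumes "CARD('a::{field,finite}) = 2 ^ s" "1 \<le> s"
  shows "CHAR('a) = 2"
proof -
  have "even CARD('a)" using assms by simp
  then have "- 1 = (1 :: 'a)"
    using field_power_card[of "- 1 :: 'a"] by simp
  then have "1 + 1 = (0 :: 'a)"
    by (metis add.left_inverse)
  then have "of_nat 2 = (0 :: 'a)"
    by simp
  then have "CHAR('a) dvd 2"
    by (simp only: of_nat_eq_0_iff_char_dvd)
  then have "CHAR('a) \<le> 2" "CHAR('a) \<noteq> 0" by (auto dest: dvd_imp_le intro!: Nat.gr0I)
  moreover have "CHAR('a) \<noteq> 1" by simp
  ultimately show ?thesis by linarith
qed

locale char_2 =
  fixes char_2_type :: "'a::{field,finite} itself"
  assumes CHAR_2: "CHAR('a) = 2"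
begin

lemma two_eq_0: "(2 :: 'a) = 0" "(2 :: 'a poly) = 0" "(2 :: 'a fls) = 0"
  using of_nat_CHAR[where 'a = 'a] of_nat_CHAR[where 'a = "'a poly"] of_nat_CHAR[where 'a = "'a fls"]
  by (simp_all add: CHAR_2)

lemma add_self: "x + x = (0 :: 'a)" "p + p = (0 :: 'a poly)" "u + u = (0 :: 'a fls)"
  using two_eq_0 by (simp_all flip: mult_2)

lemma add_self': "x + (x + y) = (y :: 'a)" "p + (p + q) = (q :: 'a poly)" "u + (u + v) = (v :: 'a fls)"
  by (simp_all add: add_self flip: add.assoc)

lemma uminus_eq: "- x = (x :: 'a)" "- p = (p :: 'a poly)" "- u = (u :: 'a fls)"
  using add_self by (simp_all add: eq_neg_iff_add_eq_0 neg_eq_iff_add_eq_0)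

lemma minus_eq: "x - y = (x + y :: 'a)" "p - q = (p + q :: 'a poly)" "u - v = (u + v :: 'a fls)"
  by (simp_all only: diff_conv_add_uminus uminus_eq)

lemmas char_2_simps = add_self add_self' uminus_eq minus_eq two_eq_0

lemma frobenius_add:
  "(x + y) ^ (2 ^ n) = x ^ (2 ^ n) + (y :: 'a) ^ (2 ^ n)"
  "(p + q) ^ (2 ^ n) = p ^ (2 ^ n) + (q :: 'a poly) ^ (2 ^ n)"
  "(u + v) ^ (2 ^ n) = u ^ (2 ^ n) + (v :: 'a fls) ^ (2 ^ n)"
  by (rule freshmans_dream'; simp add: CHAR_2)+

lemma frobenius_eq_1:
  fixes x :: 'a
  shows "x ^ (2 ^ n) = 1 \<longleftrightarrow> x = 1"
proof
  assume "x ^ (2 ^ n) = 1"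
  then have "(x + 1) ^ (2 ^ n) = 0" by (simp add: frobenius_add add_self)
  then have "x + 1 = 0" by (simp only: power_eq_0_iff)
  then show "x = 1" by (simp add: add_eq_0_iff uminus_eq)
qed simp

text \<open>The terms \<open>i\<close> and \<open>n - i\<close> of the Cauchy product coincide and
  cancel; only a middle term survives.\<close>

lemma fps_square_nth:
  fixes y :: "'a fps"
  shows "fps_nth (y ^ 2) n = (if even n then fps_nth y (n div 2) ^ 2 else 0)"
proof -
  let ?f = "\<lambda>i. fps_nth y i * fps_nth y (n - i)"
  have split: "{0..n} = {i\<in>{0..n}. 2 * i < n} \<union> {i\<in>{0..n}. n < 2 * i} \<union> {i\<in>{0..n}. 2 * i = n}"
    by auto
  have "sum ?f {i\<in>{0..n}. n < 2 * i} = sum ?f {i\<in>{0..n}. 2 * i < n}"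
    by (rule sum.reindex_bij_witness[of _ "\<lambda>i. n - i" "\<lambda>i. n - i"]) (auto simp: mult.commute)
  moreover have "sum ?f {0..n} = sum ?f {i\<in>{0..n}. 2 * i < n} + sum ?f {i\<in>{0..n}. n < 2 * i}
      + sum ?f {i\<in>{0..n}. 2 * i = n}"
    by (subst (1) split, subst sum.union_disjoint, simp, simp, force,
        subst sum.union_disjoint) (auto simp: disjoint_iff)
  ultimately have "fps_nth (y ^ 2) n = sum ?f {i\<in>{0..n}. 2 * i = n}"
    by (simp add: power2_eq_square fps_mult_nth add_self)
  also have "{i\<in>{0..n}. 2 * i = n} = (if even n then {n div 2} else {})"
    by auto
  finally show ?thesis by (auto simp: power2_eq_square elim!: evenE)
qed

text \<open>In the variable \<open>X = 1 / T\<close> the root is \<open>c T y\<close> with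
  \<open>y = 1 + \<Sum>\<^sub>j (X / c) ^ 2 ^ Suc j\<close>, which satisfies \<open>y\<^sup>2 = y + X\<^sup>2 / c\<^sup>2\<close>.\<close>

lemma periodic_quadratic_root:
  fixes c :: 'a
  assumes "c \<noteq> 0"
  obtains x :: "'a fls" where "x ^ 2 = fls_const c * fls_X_inv * x + 1"
    "fabs (x - fls_const c * fls_X_inv) < real CARD('a)"
proof -
  define b where "b = inverse c"
  define y where "y = Abs_fps (\<lambda>n. if n = 0 then 1 else if \<exists>j. n = 2 ^ Suc j then b ^ n else 0)"
  have y: "fps_nth y n = (if n = 0 then 1 else if \<exists>j. n = 2 ^ Suc j then b ^ n else 0)" for n
    by (simp add: y_def)
  have odd: "fps_nth y n = 0" if "odd n" for n
    using that by (auto simp: y intro: Nat.gr0I)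
  have pow: "(\<exists>j. 2 * k = 2 ^ Suc j) \<longleftrightarrow> (\<exists>j. k = 2 ^ Suc j)" if "k \<noteq> 1" for k :: nat
  proof
    assume "\<exists>j. 2 * k = 2 ^ Suc j"
    then obtain j where "k = 2 ^ j" by auto
    with that show "\<exists>j. k = 2 ^ Suc j" by (cases j) auto
  next
    assume "\<exists>j. k = 2 ^ Suc j"
    then obtain j where "k = 2 ^ Suc j" ..
    then have "2 * k = 2 ^ Suc (Suc j)" by simp
    then show "\<exists>j. 2 * k = 2 ^ Suc j" ..
  qed
  have "y ^ 2 = y + fps_const (b ^ 2) * fps_X ^ 2"
  proof (rule fps_ext)
    fix n
    show "fps_nth (y ^ 2) n = fps_nth (y + fps_const (b ^ 2) * fps_X ^ 2) n"
    proof (cases "odd n")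
      case True
      then have "n \<noteq> 2" by auto
      with True show ?thesis by (simp add: fps_square_nth odd fps_X_power_nth)
    next
      case False
      then obtain k where k: "n = 2 * k" by (auto elim: evenE)
      consider "k = 0" | "k = 1" | "k \<noteq> 0" "k \<noteq> 1" by auto
      then show ?thesis
      proof cases
        case 1
        then show ?thesis by (simp add: k fps_square_nth y fps_X_power_nth)
      next
        case 2
        have "\<not> (\<exists>j. (1::nat) = 2 ^ Suc j)" "\<exists>j. (2::nat) = 2 ^ Suc j"
          by (auto intro: exI[of _ 0])
        then have "fps_nth y 1 = 0" "fps_nth y 2 = b ^ 2" by (simp_all only: y) simp_all
        with 2 show ?thesis by (simp add: k fps_square_nth fps_X_power_nth add_self)
      next
        case 3
        then have "fps_nth y (2 * k) = fps_nth y k ^ 2"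
          unfolding y pow[OF 3(2)] by (simp add: power_mult mult.commute)
        with 3 show ?thesis by (simp add: k fps_square_nth fps_X_power_nth)
      qed
    qed
  qed
  from arg_cong[OF this, of fps_to_fls]
  have Y: "fps_to_fls y ^ 2 = fps_to_fls y + fls_const (b ^ 2) * fls_X ^ 2"
    by (simp add: fps_to_fls_power fls_times_fps_to_fls)
  define x where "x = fls_const c * fls_X_inv * fps_to_fls y"
  have c: "fls_const c \<noteq> 0" using assms by simp
  have "fls_const (c ^ 2) * fls_const (b ^ 2) = 1"
    using assms by (simp add: b_def fls_const_mult_const power_inverse)
  moreover have X: "fls_X_inv ^ 2 * fls_X ^ 2 = (1 :: 'a fls)"
    using left_inverse[of "fls_X :: 'a fls"]
    by (simp add: fls_inverse_X flip: power_mult_distrib)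
  ultimately have one: "(fls_const (c ^ 2) * fls_X_inv ^ 2) * (fls_const (b ^ 2) * fls_X ^ 2) = 1"
    by (metis mult.assoc mult.left_commute mult_1_right)
  have "x ^ 2 = (fls_const (c ^ 2) * fls_X_inv ^ 2) * fps_to_fls y ^ 2"
    by (simp add: x_def power_mult_distrib const_hom.hom_power)
  also have "\<dots> = fls_const c * fls_X_inv * x + 1"
    unfolding Y distrib_left one
    by (simp add: x_def const_hom.hom_power power2_eq_square mult_ac)
  finally have x2: "x ^ 2 = fls_const c * fls_X_inv * x + 1" .
  have "fps_nth (y - 1) 0 = 0" by (simp add: y)
  moreover have "fabs (fps_to_fls z) < 1" if "fps_nth z 0 = 0" for z :: "'a fps"
  proof (cases "z = 0")
    case False
    then have "0 < fls_subdegree (fps_to_fls z)"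
      using that by (simp add: fls_subdegree_fls_to_fps subdegree_pos_iff)
    then show ?thesis
      using False by (simp add: fabs_nonzero powr_less_one)
  qed simp
  ultimately have "fabs (fps_to_fls (y - 1)) < 1" by blast
  then have "fabs (fls_const c * fls_X_inv * fps_to_fls (y - 1)) < real CARD('a)"
    using assms by (simp add: fabs_mult)
  also have "fls_const c * fls_X_inv * fps_to_fls (y - 1) = x - fls_const c * fls_X_inv"
    by (simp add: x_def fps_to_fls_minus algebra_simps)
  finally show ?thesis using that x2 by blast
qed

end

section \<open>Continued fractions and the Frobenius map\<close>

definition irrationalT :: "'a::field fls \<Rightarrow> bool" where
  "irrationalT z \<longleftrightarrow> (\<forall>U V. polyT U * z + polyT V = 0 \<longrightarrow> U = 0)"

lemma irrationalT_cf_step: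
  fixes z :: "'a::{field,finite} fls"
  assumes "irrationalT z" "z \<noteq> 0"
  shows "irrationalT (fls_const c * fls_X_inv + inverse z)"
  unfolding irrationalT_def
proof (intro allI impI)
  fix U V assume eq: "polyT U * (fls_const c * fls_X_inv + inverse z) + polyT V = 0"
  have "polyT (U * monom c 1 + V) * z + polyT U =
      z * (polyT U * (fls_const c * fls_X_inv + inverse z) + polyT V)"
    using assms(2) by (simp add: algebra_simps)
  then have 0: "polyT (U * monom c 1 + V) * z + polyT U = 0"
    unfolding eq by (simp only: mult_zero_right)
  then have "U * monom c 1 + V = 0"
    using assms(1) unfolding irrationalT_def by blast
  with 0 show "U = 0" by (simp only: polyT_hom.hom_0 mult_zero_left add_0 polyT_eq_0_iff)
qed

lemma fabs_linear:
  fixes w :: "'a::{field,finite} fls"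
  assumes "c \<noteq> 0" "fabs w < real CARD('a)"
  shows "fabs (fls_const c * fls_X_inv + w) = real CARD('a)"
  using assms by (subst fabs_add_eq1) (simp_all add: fabs_mult)

lemma fabs_inverse_less:
  fixes z :: "'a::{field,finite} fls"
  assumes "fabs z = real CARD('a)"
  shows "fabs (inverse z) < 1" "fabs (inverse z) < real CARD('a)"
proof -
  show "fabs (inverse z) < 1"
    using assms card_field_gt_1_real[where 'a = 'a]
    by (simp add: fabs_inverse inverse_less_1_iff del: card_field_gt_1_real)
  also have "1 < real CARD('a)" by simp
  finally show "fabs (inverse z) < real CARD('a)" .
qed

lemma fabs_cf_step:
  fixes z :: "'a::{field,finite} fls"
  shows "c \<noteq> 0 \<Longrightarrow> fabs z = real CARD('a) \<Longrightarrow>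
    fabs (fls_const c * fls_X_inv + inverse z) = real CARD('a)"
  by (intro fabs_linear fabs_inverse_less)

lemma nonzero_of_fabs: "fabs z = real CARD('a) \<Longrightarrow> z \<noteq> (0 :: 'a::{field,finite} fls)"
  by (metis card_field_pos_real fabs_0 less_irrefl)

text \<open>Inversion divides the difference by \<open>y * z\<close>, of size \<open>q^2\<close>.
  Every common partial quotient thus adds 2 to the logarithmic closeness, the source of all terms
  \<open>2 l\<close> and \<open>2 m\<close> below.\<close>

lemma fabs_cf_step_diff:
  fixes y z :: "'a::{field,finite} fls"
  assumes "fabs y = real CARD('a)" "fabs z = real CARD('a)"
  shows "fabs ((b + inverse y) - (b + inverse z)) = fabs (y - z) / real CARD('a) ^ 2"
proof -
  have nz: "y \<noteq> 0" "z \<noteq> 0" using assms nonzero_of_fabs by blast+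
  then have "(b + inverse y) - (b + inverse z) = (z - y) / (y * z)"
    by (simp add: field_simps)
  then show ?thesis
    using assms by (simp add: fabs_divide fabs_mult fabs_minus_commute power2_eq_square)
qed

text \<open>The limit and its late convergents differ from \<open>a 0\<close> by elements of the
  same size \<open>1 / q\<close>; removing \<open>a 0\<close> and inverting multiplies their
  distance by the fixed factor \<open>q^2\<close>, so convergence passes to the complete
  quotients.\<close>

lemma cf_fin_limit:
  fixes x :: "'a::{field,finite} fls"
  assumes a: "\<And>k. fabs (a k) = real CARD('a)"
    and lim: "(\<lambda>n. fabs (x - cf_fin a n)) \<longlonglongrightarrow> 0"
  shows "fabs (x - a 0) = 1 / real CARD('a)"
    and "(\<lambda>n. fabs (inverse (x - a 0) - cf_fin (\<lambda>k. a (Suc k)) n)) \<longlonglongrightarrow> 0"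
proof -
  let ?b = "\<lambda>k. a (Suc k)"
  have size: "fabs (cf_fin a n) = real CARD('a)" if "\<And>k. fabs (a k) = real CARD('a)"
    for a :: "nat \<Rightarrow> 'a fls" and n
    using that
  proof (induction n arbitrary: a)
    case (Suc n)
    have "fabs (cf_fin (\<lambda>k. a (Suc k)) n) = real CARD('a)"
      by (rule Suc.IH) (rule Suc.prems)
    then have "fabs (inverse (cf_fin (\<lambda>k. a (Suc k)) n)) < fabs (a 0)"
      using Suc.prems fabs_inverse_less by metis
    then show ?case using Suc.prems by (simp add: fabs_add_eq1)
  qed simp
  have inv: "fabs (inverse (cf_fin ?b n)) = 1 / real CARD('a)" for n
    using size[of ?b n] a by (simp add: fabs_inverse divide_inverse)
  have lim': "(\<lambda>n. fabs (x - cf_fin a (Suc n))) \<longlonglongrightarrow> 0"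
    using lim by (rule LIMSEQ_Suc)
  then have "eventually (\<lambda>n. fabs (x - cf_fin a (Suc n)) < 1 / real CARD('a)) sequentially"
    by (rule order_tendstoD) simp
  then obtain n where "fabs (x - cf_fin a (Suc n)) < 1 / real CARD('a)"
    using eventually_happens by force
  then have "fabs (x - cf_fin a (Suc n) + inverse (cf_fin ?b n)) = 1 / real CARD('a)"
    using inv[of n] by (subst fabs_add_eq2) (simp_all del: cf_fin.simps)
  then show d: "fabs (x - a 0) = 1 / real CARD('a)" by simp
  have "fabs (inverse (x - a 0) - cf_fin ?b n) = real CARD('a) ^ 2 * fabs (x - cf_fin a (Suc n))" for n
  proof -
    have nz: "x - a 0 \<noteq> 0" "cf_fin ?b n \<noteq> 0"
      using d size[of ?b n] a by (auto simp: divide_eq_0_iff)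
    then have "inverse (x - a 0) - cf_fin ?b n =
        - (x - cf_fin a (Suc n)) * cf_fin ?b n / (x - a 0)"
      by (simp add: field_simps)
    then show ?thesis
      using d size[of ?b n] a fabs_minus_commute[of "cf_fin a (Suc n)" x]
      by (simp add: fabs_divide fabs_mult power2_eq_square del: cf_fin.simps)
  qed
  then show "(\<lambda>n. fabs (inverse (x - a 0) - cf_fin ?b n)) \<longlonglongrightarrow> 0"
    using tendsto_mult_right_zero[OF lim'] by simp
qed

text \<open>The complete quotients. The value \<open>inverse 0 = 0\<close> never occurs in the
  intended use, since \<open>cf_tail_properties\<close> gives \<open>cf_tail a x n - a n\<close> the
  size \<open>1 / q\<close>.\<close>

primrec cf_tail :: "(nat \<Rightarrow> 'b::field) \<Rightarrow> 'b \<Rightarrow> nat \<Rightarrow> 'b" where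
  "cf_tail a x 0 = x"
| "cf_tail a x (Suc n) = inverse (cf_tail a x n - a n)"

lemma cf_tail_properties:
  fixes x :: "'a::{field,finite} fls"
  assumes a: "\<And>k. fabs (a k) = real CARD('a)"
    and lim: "(\<lambda>n. fabs (x - cf_fin a n)) \<longlonglongrightarrow> 0"
  shows "fabs (cf_tail a x i - a i) = 1 / real CARD('a)"
    and "cf_tail a x i = a i + inverse (cf_tail a x (Suc i))"
    and "fabs (cf_tail a x i) = real CARD('a)"
proof -
  have lim_i: "(\<lambda>n. fabs (cf_tail a x i - cf_fin (\<lambda>k. a (i + k)) n)) \<longlonglongrightarrow> 0" for i
  proof (induction i)
    case (Suc i)
    show ?case using cf_fin_limit(2)[of "\<lambda>k. a (i + k)", OF a Suc] by simp
  qed (use lim in simp)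
  show d: "fabs (cf_tail a x i - a i) = 1 / real CARD('a)"
    using cf_fin_limit(1)[of "\<lambda>k. a (i + k)", OF a lim_i] by simp
  show "cf_tail a x i = a i + inverse (cf_tail a x (Suc i))" by simp
  have "fabs (cf_tail a x i - a i) < fabs (a i)"
    unfolding d a using one_less_power[of "real CARD('a)" 2] by (simp add: field_simps power2_eq_square)
  then show "fabs (cf_tail a x i) = real CARD('a)"
    using a fabs_eqI by metis
qed

text \<open>\<open>frob_shift t\<close> is the polynomial \<open>u\<close> with \<open>J ^ 2 ^ t = T ^ (2 ^ t - 1) J + u\<close> for the
  matrix \<open>J = (T, 1; 1, 0)\<close> in characteristic two.\<close>

primrec frob_shift :: "nat \<Rightarrow> 'a::comm_ring_1 poly" where
  "frob_shift 0 = 0"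
| "frob_shift (Suc t) = frob_shift t ^ 2 + monom 1 (2 * 2 ^ t - 2)"

text \<open>In the recursion the new monomial has larger degree than the squared old value. The
  leading term, and not just the degree, is needed to locate a conjugate in
  \<open>quad_approx_base_2\<close>.\<close>

lemma fabs_frob_shift:
  fixes t :: nat
  assumes "1 \<le> t"
  shows "fabs (polyT (frob_shift t) - fls_X_inv ^ (2 ^ t - 2) :: 'a::{field,finite} fls) < real CARD('a) ^ (2 ^ t - 2)"
    "fabs (polyT (frob_shift t) :: 'a fls) = real CARD('a) ^ (2 ^ t - 2)"
proof -
  have eq: "fabs (polyT (frob_shift t) :: 'a fls) = real CARD('a) ^ (2 ^ t - 2)"
    if "fabs (polyT (frob_shift t) - fls_X_inv ^ (2 ^ t - 2) :: 'a fls) < real CARD('a) ^ (2 ^ t - 2)" for t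
    using fabs_eqI[of "polyT (frob_shift t) :: 'a fls" "fls_X_inv ^ (2 ^ t - 2)"] that
    by (simp add: fabs_X_inv_power)
  show "fabs (polyT (frob_shift t) - fls_X_inv ^ (2 ^ t - 2) :: 'a fls) < real CARD('a) ^ (2 ^ t - 2)"
    using assms
  proof (induction t rule: dec_induct)
    case base
    show ?case by simp
  next
    case (step t)
    have "fabs (polyT (frob_shift t) ^ 2 :: 'a fls) = real CARD('a) ^ (2 * (2 ^ t - 2))"
      unfolding fabs_power eq[OF step.IH] by (simp add: power_mult [symmetric] mult.commute)
    also have "\<dots> < real CARD('a) ^ (2 * 2 ^ t - 2)"
    proof (rule power_strict_increasing)
      have "(2::nat) \<le> 2 ^ t" using step.hyps power_increasing[of 1 t "2::nat"] by simp
      then show "2 * (2 ^ t - 2) < 2 * 2 ^ t - (2::nat)" by linarith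
    qed simp
    finally show ?case by simp
  qed
  then show "fabs (polyT (frob_shift t) :: 'a fls) = real CARD('a) ^ (2 ^ t - 2)" by (rule eq)
qed

lemma poly_frob_shift_0: "1 \<le> t \<Longrightarrow> poly (frob_shift t) 0 = (1 :: 'a::comm_ring_1)"
proof (induction t rule: dec_induct)
  case (step t)
  have "(2::nat) \<le> 2 ^ t" using step.hyps power_increasing[of 1 t "2::nat"] by simp
  then have "2 * 2 ^ t - 2 \<noteq> (0::nat)" by linarith
  then show ?case using step by (simp add: poly_monom zero_power)
qed (simp add: poly_monom)

context char_2
begin

text \<open>The determinant of \<open>J ^ 2 ^ t = T ^ (2 ^ t - 1) J + u\<close>, where
  \<open>det J = -1 = 1\<close>. The induction squares the identity, which is additive here.\<close>

lemma frob_shift_det: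
  "frob_shift t ^ 2 + frob_shift t * monom 1 (2 ^ t) + monom 1 (2 * 2 ^ t - 2) = (1 :: 'a poly)"
proof (induction t)
  case (Suc t)
  define u :: "'a poly" where "u = frob_shift t"
  define R :: nat where "R = 2 ^ t"
  define M :: "'a poly" where "M = monom 1 (2 * R - 2)"
  have R: "1 \<le> R" by (simp add: R_def)
  have sq: "(a + b) ^ 2 = a ^ 2 + b ^ 2" for a b :: "'a poly"
    using frobenius_add(2)[of a b 1] by simp
  have "(u ^ 2 + u * monom 1 R + M) ^ 2 = 1"
    using Suc by (simp add: u_def R_def M_def)
  then have IH: "(u ^ 2) ^ 2 + u ^ 2 * monom 1 (2 * R) + M ^ 2 = 1"
    by (simp add: sq power_mult_distrib monom_power mult.commute)
  have frob: "frob_shift (Suc t) = u ^ 2 + M" and exps: "2 ^ Suc t = 2 * R" "2 * (2 * R) - 2 = 4 * R - 2"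
    by (simp_all add: u_def M_def R_def)
  have "frob_shift (Suc t) ^ 2 + frob_shift (Suc t) * monom 1 (2 ^ Suc t) + monom 1 (2 * 2 ^ Suc t - 2) =
      ((u ^ 2) ^ 2 + u ^ 2 * monom 1 (2 * R) + M ^ 2) + (M * monom 1 (2 * R) + monom 1 (4 * R - 2))"
    unfolding frob exps sq by (simp only: distrib_right ac_simps)
  also have "M * monom 1 (2 * R) = monom 1 (4 * R - 2)"
    using R by (simp add: M_def mult_monom)
  finally show ?case by (simp only: IH add_self add_0_right)
qed simp

lemma frob_shift_det_fls:
  "polyT (frob_shift t) ^ 2 + polyT (frob_shift t) * fls_X_inv ^ (2 ^ t) + fls_X_inv ^ (2 * 2 ^ t - 2) = (1 :: 'a fls)"
  using arg_cong[OF frob_shift_det[of t], of polyT] by simp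

text \<open>The formula for \<open>J ^ 2 ^ t\<close> read on sequences obeying the recursion of
  \<open>J\<close>. Applying a shift by \<open>2 ^ t\<close> twice doubles it, and the two mixed
  terms \<open>S * u\<close> cancel.\<close>

lemma frobenius_recurrence:
  fixes N :: "nat \<Rightarrow> 'a fls"
  assumes "\<And>i. N (Suc (Suc i)) = fls_X_inv * N (Suc i) + N i"
  shows "N (2 ^ t + j) = fls_X_inv ^ (2 ^ t - 1) * N (Suc j) + polyT (frob_shift t) * N j"
proof (induction t arbitrary: j)
  case (Suc t)
  define u where "u = (polyT (frob_shift t) :: 'a fls)"
  define S where "S = (fls_X_inv :: 'a fls) ^ (2 ^ t - 1)"
  have "Suc (2 * p - 2) = 2 * p - 1" if "1 \<le> p" for p :: nat
    using that by arith
  then have "(2 ^ t - 1) * 2 = 2 * 2 ^ t - (2::nat)" "Suc (2 * 2 ^ t - 2) = 2 ^ Suc t - (1::nat)"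
    by simp_all
  then have S2: "S ^ 2 = fls_X_inv ^ (2 * 2 ^ t - 2)" "S ^ 2 * fls_X_inv = fls_X_inv ^ (2 ^ Suc t - 1)"
    unfolding S_def power_mult [symmetric] by (simp_all only: power_Suc2 [symmetric])
  have "N (2 ^ Suc t + j) = N (2 ^ t + (2 ^ t + j))" by (simp add: mult_2 add.assoc)
  also have "\<dots> = S * (S * N (Suc (Suc j)) + u * N (Suc j)) + u * (S * N (Suc j) + u * N j)"
    using Suc[of "2 ^ t + j"] Suc[of "Suc j"] Suc[of j] by (simp add: S_def u_def)
  also have "\<dots> = S ^ 2 * N (Suc (Suc j)) + u ^ 2 * N j"
    by (simp add: algebra_simps power2_eq_square char_2_simps)
  also have "\<dots> = S ^ 2 * fls_X_inv * N (Suc j) + (u ^ 2 + S ^ 2) * N j"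
    unfolding assms by (simp add: algebra_simps)
  also have "u ^ 2 + S ^ 2 = polyT (frob_shift (Suc t))"
    by (simp add: S2 u_def)
  finally show ?case unfolding S2(2) .
qed simp

end

text \<open>The affine map is chosen so that, in characteristic two, \<open>w = frob_map t z\<close>
  satisfies \<open>T ^ (2 ^ t - 1) * w + frob_shift t = z ^ (2 ^ t)\<close>; the left side is the
  denominator of the Moebius map of \<open>J ^ 2 ^ t\<close> at \<open>w\<close>.\<close>

definition frob_map :: "nat \<Rightarrow> 'a::field fls \<Rightarrow> 'a fls" where
  "frob_map t z = (z ^ (2 ^ t) + polyT (frob_shift t)) / fls_X_inv ^ (2 ^ t - 1)"

lemma frob_map_mult:
  fixes z :: "'a::{field,finite} fls"
  shows "frob_map t z * fls_X_inv ^ (2 ^ t - 1) = z ^ (2 ^ t) + polyT (frob_shift t)"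
proof -
  define S :: "'a fls" where "S = fls_X_inv ^ (2 ^ t - 1)"
  have "S \<noteq> 0" by (simp add: S_def)
  then show ?thesis unfolding frob_map_def S_def [symmetric] by simp
qed

abbreviation cf_one_step :: "'a::field fls \<Rightarrow> 'a fls" where
  "cf_one_step w \<equiv> fls_X_inv + inverse w"

lemma fabs_cf_one_step:
  fixes w :: "'a::{field,finite} fls"
  shows "fabs w = real CARD('a) \<Longrightarrow> fabs (cf_one_step w) = real CARD('a)"
  using fabs_cf_step[of 1 w] by simp

lemma fabs_cf_one_step_funpow:
  fixes w :: "'a::{field,finite} fls"
  shows "fabs w = real CARD('a) \<Longrightarrow> fabs ((cf_one_step ^^ n) w) = real CARD('a)"
  by (induction n) (simp_all add: fabs_cf_one_step)

lemma fabs_cf_one_step_funpow_diff: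
  fixes w v :: "'a::{field,finite} fls"
  assumes "fabs w = real CARD('a)" "fabs v = real CARD('a)"
  shows "fabs ((cf_one_step ^^ n) w - (cf_one_step ^^ n) v) = fabs (w - v) / real CARD('a) ^ (2 * n)"
proof (induction n)
  case (Suc n)
  show ?case
    using fabs_cf_step_diff[of "(cf_one_step ^^ n) w" "(cf_one_step ^^ n) v" fls_X_inv] Suc
      fabs_cf_one_step_funpow[OF assms(1), of n] fabs_cf_one_step_funpow[OF assms(2), of n]
    by (simp add: power2_eq_square)
qed simp

lemma two_le_pow2: "1 \<le> t \<Longrightarrow> (2::nat) \<le> 2 ^ t"
  using power_increasing[of 1 t "2::nat"] by simp

lemma fabs_frob_map:
  fixes z :: "'a::{field,finite} fls"
  assumes "1 \<le> t" "fabs z = real CARD('a)"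
  shows "fabs (frob_map t z) = real CARD('a)"
proof -
  have "fabs (polyT (frob_shift t) :: 'a fls) < fabs (z ^ (2 ^ t))"
    unfolding fabs_frob_shift(2)[OF assms(1)] fabs_power assms(2)
    using two_le_pow2[OF assms(1)] by (intro power_strict_increasing) auto
  then have "fabs (z ^ (2 ^ t) + polyT (frob_shift t)) = real CARD('a) ^ (2 ^ t)"
    by (simp add: fabs_add_eq1 fabs_power assms(2))
  moreover have "(2::nat) ^ t = Suc (2 ^ t - 1)" by simp
  ultimately show ?thesis
    unfolding frob_map_def fabs_divide fabs_power fabs_X_inv
    by (metis card_field_pos_real less_irrefl nonzero_mult_div_cancel_right power_Suc power_not_zero)
qed

section \<open>Action of the Frobenius map on continued fractions and quadratic equations\<close>

context char_2
begin

lemma frob_map_diff: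
  "fabs (frob_map t y - frob_map t (z :: 'a fls)) = fabs (y - z) ^ (2 ^ t) / real CARD('a) ^ (2 ^ t - 1)"
proof -
  have "frob_map t y - frob_map t z = (y - z) ^ (2 ^ t) / fls_X_inv ^ (2 ^ t - 1)"
    unfolding frob_map_def minus_eq frobenius_add add_divide_distrib
    by (simp add: algebra_simps char_2_simps)
  then show ?thesis by (simp only: fabs_divide fabs_power fabs_X_inv)
qed

lemma fls_X_inv_pow2:
  "fls_X_inv ^ (2 ^ t - 1) * fls_X_inv = (fls_X_inv :: 'a fls) ^ (2 ^ t)"
  "(fls_X_inv ^ (2 ^ t - 1)) ^ 2 = (fls_X_inv :: 'a fls) ^ (2 * 2 ^ t - 2)"
proof -
  have "(2::nat) ^ t = Suc (2 ^ t - 1)" "(2 ^ t - 1) * 2 = 2 * 2 ^ t - (2::nat)" by simp_all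
  then show "fls_X_inv ^ (2 ^ t - 1) * fls_X_inv = (fls_X_inv :: 'a fls) ^ (2 ^ t)"
    "(fls_X_inv ^ (2 ^ t - 1)) ^ 2 = (fls_X_inv :: 'a fls) ^ (2 * 2 ^ t - 2)"
    by (metis power_Suc2, metis power_mult)
qed

text \<open>The iterates are quotients \<open>N (Suc i) / N i\<close> of their own partial products;
  in terms of \<open>N\<close> the iteration becomes a linear recursion.\<close>

lemma cf_one_step_pow2:
  fixes w :: "'a fls"
  assumes "fabs w = real CARD('a)"
  shows "(cf_one_step ^^ (2 ^ t)) w * (fls_X_inv ^ (2 ^ t - 1) * w + polyT (frob_shift t)) =
    fls_X_inv ^ (2 ^ t - 1) * (fls_X_inv * w + 1) + polyT (frob_shift t) * w"
proof -
  define N where "N i = (\<Prod>j<i. (cf_one_step ^^ j) w)" for i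
  have nz: "(cf_one_step ^^ j) w \<noteq> 0" for j
    using fabs_cf_one_step_funpow[OF assms] nonzero_of_fabs by blast
  have N: "N (Suc i) = N i * (cf_one_step ^^ i) w" for i
    by (simp add: N_def)
  have "N (Suc (Suc i)) = fls_X_inv * N (Suc i) + N i" for i
    unfolding N[of "Suc i"] using nz[of i] by (simp add: N[of i] algebra_simps)
  note rec = frobenius_recurrence[of N, OF this]
  have N_small: "N 0 = 1" "N (Suc 0) = w" "N (Suc (Suc 0)) = fls_X_inv * w + 1"
    using nz[of 0] by (simp_all add: N_def algebra_simps)
  have "N (2 ^ t + 1) = (cf_one_step ^^ (2 ^ t)) w * N (2 ^ t + 0)"
    using N[of "2 ^ t"] by (simp add: mult.commute)
  then show ?thesis
    unfolding rec using N_small by simp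
qed

text \<open>This matches the recursion for \<lambda>_n: a partial quotient \<open>c T\<close>
  becomes \<open>c ^ r T\<close> followed by \<open>r - 1\<close> quotients \<open>T\<close>. The
  image \<open>w\<close> of \<open>z\<close> makes the denominator of \<open>r\<close> steps equal
  to \<open>z ^ r\<close>, so the result is affine in \<open>inverse z ^ r\<close>.\<close>

lemma frob_map_cf_step:
  fixes z :: "'a fls"
  assumes t: "1 \<le> t" and z: "fabs z = real CARD('a)"
  shows "frob_map t (fls_const c * fls_X_inv + inverse z) =
    fls_const (c ^ (2 ^ t)) * fls_X_inv + inverse ((cf_one_step ^^ (2 ^ t - 1)) (frob_map t z))"
proof -
  define r :: nat where "r = 2 ^ t"
  define S where "S = (fls_X_inv :: 'a fls) ^ (r - 1)"
  define u where "u = (polyT (frob_shift t) :: 'a fls)"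
  define w where "w = frob_map t z"
  have r: "r = Suc (r - 1)" by (simp add: r_def)
  have S: "S \<noteq> 0" "S * fls_X_inv = fls_X_inv ^ r" and S2: "S * S = fls_X_inv ^ (2 * r - 2)"
    using fls_X_inv_pow2[of t] by (simp_all add: S_def r_def power2_eq_square)
  have z0: "z \<noteq> 0" using z nonzero_of_fabs by blast
  have w: "fabs w = real CARD('a)" unfolding w_def by (rule fabs_frob_map[OF t z])
  have Sw: "S * w = z ^ r + u"
    unfolding w_def frob_map_def u_def [symmetric] r_def [symmetric] S_def [symmetric]
    using S by simp
  then have den: "S * w + u = z ^ r" by (simp add: add.assoc char_2_simps)
  have det: "u * u + u * fls_X_inv ^ r + S * S = 1"
    unfolding S2 using frob_shift_det_fls[of t] by (simp add: u_def r_def power2_eq_square)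
  have "(cf_one_step ^^ r) w * z ^ r = S * (fls_X_inv * w + 1) + u * w"
    using cf_one_step_pow2[OF w, of t] den by (simp add: S_def u_def r_def)
  then have "(S * (cf_one_step ^^ r) w) * z ^ r = S * fls_X_inv * (S * w) + S * S + u * (S * w)"
    by (simp add: algebra_simps)
  \<comment> \<open>The part without \<open>z ^ r\<close> is the determinant of
    \<open>J ^ r\<close>, that is, 1.\<close>
  also have "\<dots> = (fls_X_inv ^ r + u) * z ^ r + (u * u + u * fls_X_inv ^ r + S * S)"
    unfolding Sw S(2) by (simp add: algebra_simps)
  finally have "S * (cf_one_step ^^ r) w = fls_X_inv ^ r + u + inverse z ^ r"
    unfolding det using z0 by (simp add: field_simps)
  moreover have "(cf_one_step ^^ r) w = fls_X_inv + inverse ((cf_one_step ^^ (r - 1)) w)"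
    by (subst r) simp
  ultimately have "S * inverse ((cf_one_step ^^ (r - 1)) w) = u + inverse z ^ r"
    using S by (simp add: distrib_left add.assoc)
  then have inv: "inverse ((cf_one_step ^^ (r - 1)) w) = (u + inverse z ^ r) / S"
    using S by (simp add: field_simps)
  have "frob_map t (fls_const c * fls_X_inv + inverse z) =
      (fls_const (c ^ r) * fls_X_inv ^ r + inverse z ^ r + u) / S"
    unfolding frob_map_def frobenius_add unfolding r_def [symmetric] u_def [symmetric] S_def [symmetric]
    by (simp add: power_mult_distrib const_hom.hom_power)
  also have "\<dots> = fls_const (c ^ r) * fls_X_inv + (u + inverse z ^ r) / S"
    unfolding S(2) [symmetric] using S(1) by (simp add: field_simps)
  finally show ?thesis
    unfolding inv [symmetric] unfolding w_def r_def .
qed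

text \<open>Hides the equation and its roots, so that inductions only track \<open>B\<close>, the
  degree \<open>a\<close> and the distance exponent \<open>g\<close>. The predicate \<open>I\<close>
  carries the information on \<open>A\<close> and \<open>C\<close> that controls common
  factors.\<close>

definition quad_approx ::
    "('a poly \<Rightarrow> 'a poly \<Rightarrow> bool) \<Rightarrow> 'a poly \<Rightarrow> 'a fls \<Rightarrow> nat \<Rightarrow> real \<Rightarrow> bool" where
  "quad_approx I B y a g \<longleftrightarrow> (\<exists>A C z z'. conjugate_pair A B C z z' \<and> I A C \<and>
    fabs z = real CARD('a) \<and> fabs z' = real CARD('a) \<and> degree A = a \<and> irrationalT z \<and> fabs (y - z) = real CARD('a) powr (- g))"

text \<open>Inversion exchanges \<open>A\<close> and \<open>C\<close>, and the shift adds
  \<open>2 c T = 0\<close> to the trace; therefore \<open>B\<close> survives all continued fraction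
  steps.\<close>

lemma conjugate_pair_cf_step:
  assumes "conjugate_pair A B C z (z' :: 'a fls)" "z \<noteq> 0" "z' \<noteq> 0"
  shows "conjugate_pair C B (A + B * monom c 1 + C * monom (c ^ 2) 2)
    (fls_const c * fls_X_inv + inverse z) (fls_const c * fls_X_inv + inverse z')"
proof -
  interpret conjugate_pair A B C z z' by fact
  define b where "b = fls_const c * fls_X_inv"
  have inv: "polyT C * (inverse z + inverse z') = polyT B" "polyT C * (inverse z * inverse z') = polyT A"
    unfolding trace [symmetric] norm [symmetric] using assms(2,3) by (simp_all add: field_simps)
  have "polyT C \<noteq> 0" unfolding norm [symmetric] using assms(2,3) A_nonzero by simp
  moreover have "polyT C * ((b + inverse z) + (b + inverse z')) = polyT B"
    using inv(1) by (simp add: algebra_simps char_2_simps)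
  moreover have "polyT C * ((b + inverse z) * (b + inverse z')) =
      polyT C * (inverse z * inverse z') + polyT C * (inverse z + inverse z') * b + polyT C * b ^ 2"
    by (simp add: algebra_simps power2_eq_square)
  ultimately show ?thesis
    unfolding inv by unfold_locales
      (simp_all add: b_def power_mult_distrib const_hom.hom_power)
qed

lemma degree_eqI_fabs:
  assumes "p \<noteq> 0" "fabs (polyT p :: 'a fls) = real CARD('a) ^ n"
  shows "degree p = n"
  using assms fabs_polyT[OF assms(1)] by (simp add: power_inject_exp)

lemma degree_norm:
  assumes "conjugate_pair A B C z (z' :: 'a fls)" "fabs (z * z') = real CARD('a) ^ n"
  shows "degree C = degree A + n"
proof -
  interpret conjugate_pair A B C z z' by fact
  have "fabs (polyT C) = real CARD('a) ^ (degree A + n)"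
    unfolding norm [symmetric] fabs_mult[of "polyT A"] assms(2) fabs_polyT[OF A_nonzero]
    by (simp add: power_add)
  moreover from this have "C \<noteq> 0" by auto
  ultimately show ?thesis by (rule degree_eqI_fabs[rotated])
qed

lemma quad_approx_cf_step:
  assumes approx: "quad_approx I B y a g" and y: "fabs y = real CARD('a)" and c: "c \<noteq> 0"
    and I: "\<And>A C. I A C \<Longrightarrow> I C (A + B * monom c 1 + C * monom (c ^ 2) 2)"
  shows "quad_approx I B (fls_const c * fls_X_inv + inverse y) (a + 2) (g + 2)"
proof -
  obtain A C z z' where *: "conjugate_pair A B C z z'" "I A C" "fabs z = real CARD('a)" "fabs z' = real CARD('a)"
      "degree A = a" "irrationalT z" "fabs (y - z) = real CARD('a) powr (- g)"
    using approx unfolding quad_approx_def by blast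
  have nz: "z \<noteq> 0" "z' \<noteq> 0" using * nonzero_of_fabs by blast+
  let ?b = "fls_const c * fls_X_inv"
  have "fabs ((?b + inverse y) - (?b + inverse z)) = real CARD('a) powr (- (g + 2))"
    unfolding fabs_cf_step_diff[OF y *(3)] *(7) by (simp add: powr_diff powr_minus powr_add divide_inverse power2_eq_square)
  moreover have "degree C = a + 2"
    using degree_norm[OF *(1), of 2] * by (simp add: fabs_mult power2_eq_square)
  ultimately show ?thesis
    unfolding quad_approx_def
    using conjugate_pair_cf_step[OF *(1) nz, of c] I[OF *(2)] fabs_cf_step[OF c *(3)]
      fabs_cf_step[OF c *(4)] irrationalT_cf_step[OF *(6) nz(1), of c] by blast
qed

text \<open>The equation writes \<open>A z^2\<close> as \<open>B z + C\<close>, so a relation for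
  \<open>z^2\<close> becomes one for \<open>z\<close> with leading coefficient \<open>U * B\<close>.
  For \<open>B = 0\<close> the square would be rational.\<close>

lemma irrationalT_square:
  assumes "conjugate_pair A B C z (z' :: 'a fls)" "B \<noteq> 0" "irrationalT z"
  shows "irrationalT (z ^ 2)" "conjugate_pair (A ^ 2) (B ^ 2) (C ^ 2) (z ^ 2) (z' ^ 2)"
proof -
  interpret conjugate_pair A B C z z' by fact
  have sq: "polyT A * z ^ 2 = polyT B * z + polyT C"
    unfolding trace [symmetric] norm [symmetric]
    by (simp add: algebra_simps power2_eq_square char_2_simps)
  show "irrationalT (z ^ 2)"
    unfolding irrationalT_def
  proof (intro allI impI)
    fix U V assume eq: "polyT U * z ^ 2 + polyT V = 0"
    have "polyT (U * B) * z + polyT (U * C + A * V) =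
        polyT U * (polyT B * z + polyT C) + polyT A * polyT V"
      by (simp add: algebra_simps)
    also have "\<dots> = polyT A * (polyT U * z ^ 2 + polyT V)"
      unfolding sq [symmetric] by (simp add: algebra_simps)
    also have "\<dots> = 0" unfolding eq by simp
    finally have "U * B = 0" using assms(3) unfolding irrationalT_def by blast
    then show "U = 0" using assms(2) by simp
  qed
  have "(u + v) ^ 2 = u ^ 2 + v ^ 2" for u v :: "'a fls"
    using frobenius_add(3)[of u v 1] by simp
  then show "conjugate_pair (A ^ 2) (B ^ 2) (C ^ 2) (z ^ 2) (z' ^ 2)"
    using A_nonzero by unfold_locales
      (simp_all add: trace [symmetric] norm [symmetric] power_mult_distrib)
qed

lemma irrationalT_frobenius:
  assumes "conjugate_pair A B C z (z' :: 'a fls)" "B \<noteq> 0" "irrationalT z"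
  shows "irrationalT (z ^ (2 ^ t))"
  using assms
proof (induction t arbitrary: A B C z z')
  case (Suc t)
  have "irrationalT ((z ^ 2) ^ (2 ^ t))"
    by (rule Suc.IH[OF irrationalT_square(2)[OF Suc.prems] _ irrationalT_square(1)[OF Suc.prems]])
      (use Suc.prems in simp)
  then show ?case by (simp add: power_mult)
qed simp

lemma irrationalT_frob_map:
  assumes "conjugate_pair A B C z (z' :: 'a fls)" "B \<noteq> 0" "irrationalT z"
  shows "irrationalT (frob_map t z)"
  unfolding irrationalT_def
proof (intro allI impI)
  fix U V assume eq: "polyT U * frob_map t z + polyT V = 0"
  let ?S = "fls_X_inv ^ (2 ^ t - 1) :: 'a fls"
  have "polyT U * z ^ (2 ^ t) + polyT (U * frob_shift t + V * monom 1 (2 ^ t - 1)) =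
      (polyT U * frob_map t z + polyT V) * ?S"
    unfolding distrib_right mult.assoc frob_map_mult by (simp add: algebra_simps)
  also have "\<dots> = 0" unfolding eq by simp
  finally show "U = 0"
    using irrationalT_frobenius[OF assms, of t] unfolding irrationalT_def by blast
qed

text \<open>The images are roots of the equation with coefficients \<open>A^r S^2\<close>,
  \<open>B^r S\<close> and \<open>C^r + u B^r + u^2 A^r\<close>, where \<open>r = 2 ^ t\<close>. The
  two cases differ in how much of \<open>S^2\<close> can be cancelled.\<close>

lemma frob_map_pair:
  fixes z z' :: "'a fls" and t :: nat
  assumes "conjugate_pair A B C z z'"
  defines "S \<equiv> fls_X_inv ^ (2 ^ t - 1)" and "u \<equiv> polyT (frob_shift t)"
  shows "polyT A ^ (2 ^ t) * (frob_map t z + frob_map t z') * S = polyT B ^ (2 ^ t)"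
    "polyT A ^ (2 ^ t) * (frob_map t z * frob_map t z') * S ^ 2 =
      polyT C ^ (2 ^ t) + u * polyT B ^ (2 ^ t) + u ^ 2 * polyT A ^ (2 ^ t)"
proof -
  interpret conjugate_pair A B C z z' by fact
  have S: "S \<noteq> 0" by (simp add: S_def)
  have w: "frob_map t z * S = z ^ (2 ^ t) + u" "frob_map t z' * S = z' ^ (2 ^ t) + u"
    unfolding S_def u_def frob_map_mult by simp_all
  have "polyT A ^ (2 ^ t) * (frob_map t z + frob_map t z') * S =
      polyT A ^ (2 ^ t) * (frob_map t z * S + frob_map t z' * S)"
    by (simp add: algebra_simps)
  also have "\<dots> = polyT A ^ (2 ^ t) * (z ^ (2 ^ t) + z' ^ (2 ^ t))"
    unfolding w by (simp add: algebra_simps char_2_simps)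
  also have "\<dots> = polyT B ^ (2 ^ t)"
    unfolding trace [symmetric] by (simp add: power_mult_distrib frobenius_add)
  finally show "polyT A ^ (2 ^ t) * (frob_map t z + frob_map t z') * S = polyT B ^ (2 ^ t)" .
  have "polyT A ^ (2 ^ t) * (frob_map t z * frob_map t z') * S ^ 2 =
      polyT A ^ (2 ^ t) * ((frob_map t z * S) * (frob_map t z' * S))"
    by (simp add: algebra_simps power2_eq_square)
  also have "\<dots> = (polyT A * (z * z')) ^ (2 ^ t) + u * (polyT A * (z + z')) ^ (2 ^ t) + u ^ 2 * polyT A ^ (2 ^ t)"
    unfolding w power_mult_distrib frobenius_add by (simp add: algebra_simps power2_eq_square)
  finally show "polyT A ^ (2 ^ t) * (frob_map t z * frob_map t z') * S ^ 2 =
      polyT C ^ (2 ^ t) + u * polyT B ^ (2 ^ t) + u ^ 2 * polyT A ^ (2 ^ t)"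
    unfolding trace norm .
qed

lemma fabs_frob_map_diff_powr:
  assumes "fabs (y - z :: 'a fls) = real CARD('a) powr (- g)"
  shows "fabs (frob_map t y - frob_map t z) = real CARD('a) powr (- (2 ^ t * g + 2 ^ t - 1))"
proof -
  have "fabs (frob_map t y - frob_map t z) = real CARD('a) powr (- (2 ^ t * g)) / real CARD('a) ^ (2 ^ t - 1)"
    unfolding frob_map_diff assms by (simp add: power_powr_eq)
  also have "real CARD('a) ^ (2 ^ t - 1) = real CARD('a) powr (2 ^ t - 1)"
    by (simp add: of_nat_diff flip: powr_realpow)
  finally show ?thesis by (simp add: powr_diff [symmetric] algebra_simps)
qed

end

section \<open>Cancellation in the Frobenius step, and the periodic starting points\<close>

context char_2
begin

text \<open>With \<open>B = T\<close>, these congruences make the equation of the image under \<open>frob_map\<close> divisible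
  by \<open>T ^ (2 * 2 ^ t - 2)\<close>.\<close>

definition inv1 :: "'a poly \<Rightarrow> 'a poly \<Rightarrow> bool" where
  "inv1 A C \<longleftrightarrow> (\<exists>E F. A + C = monom 1 2 * E \<and> A + 1 = monom 1 1 * F)"

text \<open>As \<open>B\<close> is a monomial, only \<open>T\<close> could divide all coefficients.
  Distinct values of \<open>A\<close> and \<open>C\<close> at 0 exclude this and persist: after
  \<open>frob_map\<close> these values are 0 and \<open>(C(0) + A(0)) ^ r\<close>. Having one
  nonzero value would not be enough for that.\<close>

definition inv2 :: "'a poly \<Rightarrow> 'a poly \<Rightarrow> bool" where
  "inv2 A C \<longleftrightarrow> poly A 0 \<noteq> poly C 0"

text \<open>With \<open>B = T\<close> both terms added to the norm are multiples of
  \<open>T^2\<close>.\<close>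

lemma inv1_cf_step:
  assumes "inv1 A C"
  shows "inv1 C (A + monom 1 1 * monom c 1 + C * monom (c ^ 2) 2)"
proof -
  obtain E F where EF: "A + C = monom 1 2 * E" "A + 1 = monom 1 1 * F"
    using assms unfolding inv1_def by blast
  have m: "monom c 2 = monom 1 2 * [:c:]" "monom (c ^ 2) 2 = monom 1 2 * [:c ^ 2:]"
    "monom 1 2 = monom 1 1 * (monom 1 1 :: 'a poly)"
    by (simp_all add: smult_monom mult_monom numeral_2_eq_2)
  have "C + (A + monom 1 1 * monom c 1 + C * monom (c ^ 2) 2) = (A + C) + monom c 2 + C * monom (c ^ 2) 2"
    by (simp add: mult_monom add_ac numeral_2_eq_2)
  also have "\<dots> = monom 1 2 * (E + [:c:] + C * [:c ^ 2:])"
    unfolding EF m(1,2) by (simp only: distrib_left distrib_right mult_ac)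
  finally have 1: "C + (A + monom 1 1 * monom c 1 + C * monom (c ^ 2) 2) =
    monom 1 2 * (E + [:c:] + C * [:c ^ 2:])" .
  have "C + 1 = (A + C) + (A + 1)" by (simp add: algebra_simps char_2_simps)
  also have "\<dots> = monom 1 1 * (monom 1 1 * E + F)"
    unfolding EF m(3) by (simp only: distrib_left mult.assoc)
  finally show ?thesis using 1 unfolding inv1_def by blast
qed

lemma inv2_cf_step: "inv2 A C \<Longrightarrow> inv2 C (A + B * monom c 1 + C * monom (c ^ 2) 2)"
  by (auto simp: inv2_def poly_monom)

text \<open>Under Frobenius the congruences modulo \<open>T^2\<close> and \<open>T\<close> become
  congruences modulo \<open>T ^ (2 r)\<close> and \<open>T ^ r\<close>. Together with
  \<open>frob_shift_det\<close> they make the new norm divisible by \<open>S^2\<close>; after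
  cancellation \<open>B\<close> is \<open>T ^ r / S = T\<close> again and the degree of
  \<open>A\<close> is just multiplied by \<open>r\<close>.\<close>

lemma quad_approx_frob_map_1:
  assumes approx: "quad_approx inv1 (monom 1 1) y a g" and t: "1 \<le> t"
  shows "quad_approx inv1 (monom 1 1) (frob_map t y) (2 ^ t * a) (2 ^ t * g + 2 ^ t - 1)"
proof -
  obtain A C z z' where *: "conjugate_pair A (monom 1 1) C z z'" "inv1 A C" "fabs z = real CARD('a)" "fabs z' = real CARD('a)"
      "degree A = a" "irrationalT z" "fabs (y - z) = real CARD('a) powr (- g)"
    using approx unfolding quad_approx_def by blast
  obtain E F where EF: "A + C = monom 1 2 * E" "A + 1 = monom 1 1 * F"
    using *(2) unfolding inv1_def by blast
  define r :: nat where "r = 2 ^ t"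
  have r: "r = Suc (r - 1)" by (simp add: r_def)
  define S :: "'a fls" where "S = fls_X_inv ^ (r - 1)"
  define T :: "'a fls" where "T = fls_X_inv"
  define u :: "'a fls" where "u = polyT (frob_shift t)"
  define A' where "A' = A ^ r"
  define C' where "C' = A ^ r + monom 1 2 * (E ^ r + frob_shift t * F ^ r)"
  let ?w = "frob_map t z" and ?w' = "frob_map t z'"
  have A0: "A \<noteq> 0" using *(1) by (rule conjugate_pair.A_nonzero)
  have S: "S \<noteq> 0" "S * T = T ^ r" "S ^ 2 = T ^ (2 * r - 2)"
    using fls_X_inv_pow2[of t] by (simp_all add: S_def T_def r_def)
  have trace: "polyT A ^ r * (?w + ?w') * S = T ^ r"
    using frob_map_pair(1)[OF *(1), of t] by (simp add: r_def S_def T_def)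
  then have trace': "polyT A' * (?w + ?w') = polyT (monom 1 1)"
    using S(1) unfolding S(2) [symmetric] by (simp add: A'_def T_def mult_ac)
  have norm: "polyT A ^ r * (?w * ?w') * S ^ 2 = polyT C ^ r + u * T ^ r + u ^ 2 * polyT A ^ r"
    using frob_map_pair(2)[OF *(1), of t] by (simp add: r_def S_def T_def u_def)
  have e: "polyT A ^ r + polyT C ^ r = T ^ (2 * r) * polyT E ^ r"
    using arg_cong[OF EF(1), of "\<lambda>p. polyT p ^ r"]
    by (simp add: r_def T_def frobenius_add power_mult_distrib power_mult [symmetric] mult.commute)
  have f: "polyT A ^ r + 1 = T ^ r * polyT F ^ r"
    using arg_cong[OF EF(2), of "\<lambda>p. polyT p ^ r"]
    by (simp add: r_def T_def frobenius_add power_mult_distrib)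
  have det: "u ^ 2 + u * T ^ r + S ^ 2 = 1"
    unfolding S(3) using frob_shift_det_fls[of t] by (simp add: u_def r_def T_def)
  have T2: "T ^ (2 * r) = S ^ 2 * T ^ 2"
    unfolding power_mult_distrib [symmetric] S(2) by (simp add: power_mult [symmetric] mult.commute)
  \<comment> \<open>Terms are added twice to collect the quantities controlled by \<open>e\<close>,
    \<open>f\<close> and \<open>det\<close>; the last bracket is \<open>1 + 1 = 0\<close>.\<close>
  have "polyT C ^ r + u * T ^ r + u ^ 2 * polyT A ^ r =
      (polyT A ^ r + polyT C ^ r) + u * T ^ r * (polyT A ^ r + 1)
      + S ^ 2 * polyT A ^ r + polyT A ^ r * (1 + (u ^ 2 + u * T ^ r + S ^ 2))"
    by (simp add: algebra_simps char_2_simps)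
  also have "\<dots> = S ^ 2 * polyT A ^ r + T ^ (2 * r) * (polyT E ^ r + u * polyT F ^ r)"
    unfolding det e f mult_2 power_add by (simp add: add_self algebra_simps)
  also have "\<dots> = polyT C' * S ^ 2"
    unfolding T2 by (simp add: C'_def u_def T_def algebra_simps)
  finally have "polyT A' * (?w * ?w') = polyT C'"
    using norm S(1) by (simp add: A'_def)
  with trace' A0 have pair: "conjugate_pair A' (monom 1 1) C' ?w ?w'"
    by unfold_locales (simp_all add: A'_def)
  have "A' + C' = monom 1 2 * (E ^ r + frob_shift t * F ^ r)"
    by (simp add: A'_def C'_def char_2_simps)
  moreover have "A' + 1 = monom 1 1 * (monom 1 (r - 1) * F ^ r)"
  proof -
    have "A' + 1 = (A + 1) ^ r" by (simp add: A'_def r_def frobenius_add)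
    also have "\<dots> = monom 1 r * F ^ r"
      unfolding EF(2) power_mult_distrib by (simp add: monom_power)
    also have "monom 1 r = monom 1 1 * (monom 1 (r - 1) :: 'a poly)"
      using r by (simp add: mult_monom)
    finally show ?thesis by (simp only: mult.assoc)
  qed
  ultimately have "inv1 A' C'" unfolding inv1_def by blast
  moreover have "degree A' = 2 ^ t * a"
    using *(5) by (simp add: A'_def degree_power_eq[OF A0] r_def)
  moreover have "irrationalT ?w"
    using irrationalT_frob_map[OF *(1) _ *(6)] by simp
  ultimately show ?thesis
    unfolding quad_approx_def
    using pair fabs_frob_map[OF t *(3)] fabs_frob_map[OF t *(4)] fabs_frob_map_diff_powr[OF *(7)]
    by blast
qed

text \<open>Nothing cancels: \<open>inv2\<close> keeps the new \<open>C\<close> prime to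
  \<open>T\<close>, so \<open>A\<close> retains the factor \<open>S^2\<close> and \<open>B\<close>
  becomes \<open>B^r S\<close>. The condition \<open>b ^ r = b\<close> fixes the constant of the
  monomial.\<close>

lemma quad_approx_frob_map_2:
  assumes approx: "quad_approx inv2 (monom b j) y a g" and t: "1 \<le> t"
    and b: "b \<noteq> 0" "b ^ (2 ^ t) = b" and j: "1 \<le> j"
  shows "quad_approx inv2 (monom b (2 ^ t * j + 2 ^ t - 1)) (frob_map t y)
    (2 ^ t * a + (2 * 2 ^ t - 2)) (2 ^ t * g + 2 ^ t - 1)"
proof -
  obtain A C z z' where *: "conjugate_pair A (monom b j) C z z'" "inv2 A C" "fabs z = real CARD('a)" "fabs z' = real CARD('a)"
      "degree A = a" "irrationalT z" "fabs (y - z) = real CARD('a) powr (- g)"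
    using approx unfolding quad_approx_def by blast
  define r :: nat where "r = 2 ^ t"
  have r: "2 \<le> r" using two_le_pow2[OF t] by (simp add: r_def)
  define S :: "'a fls" where "S = fls_X_inv ^ (r - 1)"
  define A' where "A' = A ^ r * monom 1 (2 * r - 2)"
  define C' where "C' = C ^ r + frob_shift t * monom b j ^ r + frob_shift t ^ 2 * A ^ r"
  let ?w = "frob_map t z" and ?w' = "frob_map t z'"
  have A0: "A \<noteq> 0" using *(1) by (rule conjugate_pair.A_nonzero)
  then have A': "A' \<noteq> 0" by (simp add: A'_def)
  have S: "S ^ 2 = fls_X_inv ^ (2 * r - 2)"
    using fls_X_inv_pow2[of t] by (simp_all add: S_def r_def)
  have pA': "polyT A' = polyT A ^ r * S ^ 2" unfolding S by (simp add: A'_def)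
  have "polyT A' * (?w + ?w') = polyT (monom b j) ^ r * S"
    using frob_map_pair(1)[OF *(1), of t] by (simp add: pA' r_def S_def power2_eq_square mult_ac)
  also have "\<dots> = polyT (monom b (r * j + r - 1))"
  proof -
    have "r * j + r - 1 = j * r + (r - 1)" using r by (simp add: mult.commute)
    then show ?thesis
      unfolding polyT_monom S_def
      using b(2) by (simp only: power_add power_mult power_mult_distrib r_def mult.assoc
          flip: const_hom.hom_power)
  qed
  finally have trace: "polyT A' * (?w + ?w') = polyT (monom b (r * j + r - 1))" .
  have "polyT A' * (?w * ?w') = polyT C'"
    using frob_map_pair(2)[OF *(1), of t]
    by (simp add: pA' C'_def r_def S_def mult_ac del: polyT_monom)
  with trace A' have pair: "conjugate_pair A' (monom b (r * j + r - 1)) C' ?w ?w'"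
    by unfold_locales
  have "poly A' 0 = 0" using r by (simp add: A'_def poly_monom power_0_left)
  moreover have "poly C' 0 = (poly C 0 + poly A 0) ^ r"
    using j r by (simp add: C'_def poly_monom power_0_left poly_frob_shift_0[OF t] r_def frobenius_add)
  moreover have "poly C 0 + poly A 0 \<noteq> 0"
    using *(2) by (metis inv2_def add_eq_0_iff uminus_eq(1))
  ultimately have "inv2 A' C'" by (simp add: inv2_def)
  moreover have "degree A' = 2 ^ t * a + (2 * 2 ^ t - 2)"
    using *(5) A0 by (simp add: A'_def degree_mult_eq degree_monom_eq degree_power_eq r_def)
  moreover have "irrationalT ?w"
    using irrationalT_frob_map[OF *(1) _ *(6)] b(1) by simp
  ultimately show ?thesis
    unfolding quad_approx_def r_def [symmetric]
    using pair fabs_frob_map[OF t *(3)] fabs_frob_map[OF t *(4)]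
      fabs_frob_map_diff_powr[OF *(7), of t, folded r_def]
    unfolding r_def by blast
qed

text \<open>Infinite descent: the continued fraction step turns a relation with leading coefficient
  \<open>U\<close> into one whose leading coefficient is smaller by the factor
  \<open>|x| = q\<close>.\<close>

lemma irrationalT_periodic:
  fixes x :: "'a fls"
  assumes x: "x = fls_const c * fls_X_inv + inverse x" "fabs x = real CARD('a)"
  shows "irrationalT x"
proof -
  have x0: "x \<noteq> 0" using x(2) nonzero_of_fabs by blast
  have "U = 0" if "polyT U * x + polyT V = 0" for U V
    using that
  proof (induction "degree U" arbitrary: U V rule: less_induct)
    case less
    show ?case
    proof (rule ccontr)
      assume U: "U \<noteq> 0"
      let ?U = "U * monom c 1 + V"
      have eq: "polyT U * (fls_const c * fls_X_inv + inverse x) + polyT V = 0"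
        using less.prems x(1) by simp
      have "polyT ?U * x + polyT U =
          x * (polyT U * (fls_const c * fls_X_inv + inverse x) + polyT V)"
        using x0 by (simp add: algebra_simps)
      then have 0: "polyT ?U * x + polyT U = 0"
        unfolding eq by (simp only: mult_zero_right)
      then have "polyT ?U * x = polyT U"
        by (metis add_eq_0_iff uminus_eq(3))
      then have *: "fabs (polyT ?U) * real CARD('a) = fabs (polyT U)"
        using x(2) by (metis fabs_mult)
      then have "fabs (polyT ?U) \<noteq> 0" using U by (metis fabs_eq_0_iff mult_zero_left polyT_eq_0_iff)
      then have U': "?U \<noteq> 0" by (metis fabs_0 polyT_hom.hom_0)
      have "real CARD('a) ^ Suc (degree ?U) = real CARD('a) ^ degree U"
        using * unfolding fabs_polyT[OF U'] fabs_polyT[OF U] by (simp add: mult.commute)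
      then have "Suc (degree ?U) = degree U" by (simp only: power_inject_exp card_field_gt_1_real)
      then have "?U = 0" using less.hyps[of ?U U] 0 by simp
      with U' show False ..
    qed
  qed
  then show ?thesis unfolding irrationalT_def by blast
qed

lemma periodic_cf:
  assumes "(c :: 'a) \<noteq> 0"
  obtains x where "x = fls_const c * fls_X_inv + inverse x" "fabs x = real CARD('a)"
    "fabs (x - fls_const c * fls_X_inv) < real CARD('a)"
proof -
  obtain x :: "'a fls" where x: "x ^ 2 = fls_const c * fls_X_inv * x + 1"
    "fabs (x - fls_const c * fls_X_inv) < real CARD('a)"
    using periodic_quadratic_root[OF assms] by blast
  have "fabs (fls_const c * fls_X_inv) = real CARD('a)"
    using assms by (simp add: fabs_mult)
  then have "fabs x = real CARD('a)" using fabs_eqI x(2) by metis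
  moreover from this have "x \<noteq> 0" using nonzero_of_fabs by blast
  then have "x = fls_const c * fls_X_inv + inverse x"
    using x(1) by (simp add: field_simps power2_eq_square)
  ultimately show ?thesis using that x(2) by blast
qed

end

section \<open>The series with \<open>\<epsilon>_1 = \<epsilon>_2 = 1\<close> and its complete
  quotients\<close>

locale hyperquadratic_cf = char_2 char_2_type
  for char_2_type :: "'a::{field,finite} itself" +
  fixes t l :: nat and lam :: "nat \<Rightarrow> 'a" and Phi :: "'a fls"
  assumes t: "1 \<le> t" and l: "1 \<le> l"
    and lam_initial: "\<And>i. 1 \<le> i \<Longrightarrow> i \<le> l \<Longrightarrow> lam i \<noteq> 0"
    and lam_first: "\<And>k. lam (l + 2 ^ t * k + 1) = lam (k + 1) ^ (2 ^ t)"
    and lam_one: "\<And>k i. 2 \<le> i \<Longrightarrow> i \<le> 2 ^ t \<Longrightarrow> lam (l + 2 ^ t * k + i) = 1"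
    and Phi_limit: "(\<lambda>n. fabs (Phi - cf_fin (\<lambda>k. fls_const (lam (k + 1)) * fls_X_inv) n)) \<longlonglongrightarrow> 0"
begin

text \<open>The index is shifted: \<open>tail i\<close> begins with the partial quotient
  \<open>lam (i + 1)\<close>.\<close>

definition tail :: "nat \<Rightarrow> 'a fls" where
  "tail = cf_tail (\<lambda>k. fls_const (lam (k + 1)) * fls_X_inv) Phi"

lemma tail_0 [simp]: "tail 0 = Phi"
  by (simp add: tail_def)

lemma lam_nonzero: "1 \<le> i \<Longrightarrow> lam i \<noteq> 0"
proof (induction i rule: less_induct)
  case (less i)
  show ?case
  proof (cases "i \<le> l")
    case False
    define k j where "k = (i - l - 1) div 2 ^ t" and "j = (i - l - 1) mod 2 ^ t + 1"
    have i: "i = l + 2 ^ t * k + j"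
      using False by (simp add: k_def j_def)
    have j: "1 \<le> j" "j \<le> 2 ^ t" by (simp_all add: j_def Suc_le_eq)
    show ?thesis
    proof (cases "j = 1")
      case True
      have "k \<le> 2 ^ t * k" by simp
      then have "k + 1 < i" using i l True by linarith
      then show ?thesis using less.IH[of "k + 1"] lam_first[of k] i True by simp
    next
      case False
      then show ?thesis using lam_one[of j k] i j by simp
    qed
  qed (use lam_initial less.prems in blast)
qed

lemma fabs_tail: "fabs (tail i) = real CARD('a)"
  and tail_step: "tail i = fls_const (lam (i + 1)) * fls_X_inv + inverse (tail (Suc i))"
  and fabs_tail_diff: "fabs (tail i - fls_const (lam (i + 1)) * fls_X_inv) < real CARD('a)"
proof -
  have a: "fabs (fls_const (lam (k + 1)) * fls_X_inv) = real CARD('a)" for k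
    using lam_nonzero[of "k + 1"] by (simp add: fabs_mult)
  note props = cf_tail_properties[OF a Phi_limit, folded tail_def]
  show "fabs (tail i) = real CARD('a)" by (rule props(3))
  show "tail i = fls_const (lam (i + 1)) * fls_X_inv + inverse (tail (Suc i))" by (rule props(2))
  have "1 / real CARD('a) < real CARD('a)"
    using one_less_power[of "real CARD('a)" 2] by (simp add: field_simps power2_eq_square)
  then show "fabs (tail i - fls_const (lam (i + 1)) * fls_X_inv) < real CARD('a)"
    using props(1)[of i] by linarith
qed

lemma tail_funpow:
  assumes "\<And>j. j < n \<Longrightarrow> lam (i + j + 1) = 1"
  shows "tail i = (cf_one_step ^^ n) (tail (i + n))"
  using assms
proof (induction n)
  case (Suc n)
  have "tail i = (cf_one_step ^^ n) (tail (i + n))"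
    using Suc by simp
  also have "tail (i + n) = cf_one_step (tail (i + Suc n))"
    using tail_step[of "i + n"] Suc.prems[of n] by simp
  finally show ?case by (simp add: funpow_Suc_right del: funpow.simps)
qed simp

text \<open>Both sides have the same partial quotients; agreement of the first \<open>n\<close> blocks makes their
  distance at most \<open>real CARD('a) / (real CARD('a) ^ (2 r)) ^ n\<close>.\<close>

lemma tail_l: "tail l = frob_map t Phi"
proof -
  define r :: nat where "r = 2 ^ t"
  have r: "2 \<le> r" using two_le_pow2[OF t] by (simp add: r_def)
  define D where "D k = fabs (tail (l + r * k) - frob_map t (tail k))" for k
  have step: "D k = D (Suc k) / real CARD('a) ^ (2 * r)" for k
  proof -
    let ?v = "tail (l + r * Suc k)" and ?w = "frob_map t (tail (Suc k))"
    let ?b = "fls_const (lam (k + 1) ^ r) * fls_X_inv"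
    have "tail (Suc (l + r * k)) = (cf_one_step ^^ (r - 1)) (tail (Suc (l + r * k) + (r - 1)))"
    proof (rule tail_funpow)
      fix j assume "j < r - 1"
      then show "lam (Suc (l + r * k) + j + 1) = 1"
        using lam_one[of "j + 2" k] by (simp add: r_def)
    qed
    also have "Suc (l + r * k) + (r - 1) = l + r * Suc k" using r by simp
    finally have v: "tail (l + r * k) = ?b + inverse ((cf_one_step ^^ (r - 1)) ?v)"
      using tail_step[of "l + r * k"] lam_first[of k] by (simp add: r_def)
    have w: "frob_map t (tail k) = ?b + inverse ((cf_one_step ^^ (r - 1)) ?w)"
      using frob_map_cf_step[OF t fabs_tail, of "lam (k + 1)" "Suc k"] tail_step[of k]
      by (simp add: r_def)
    have sizes: "fabs ?v = real CARD('a)" "fabs ?w = real CARD('a)"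
      using fabs_tail fabs_frob_map[OF t fabs_tail] by blast+
    have "D k = fabs ((cf_one_step ^^ (r - 1)) ?v - (cf_one_step ^^ (r - 1)) ?w) / real CARD('a) ^ 2"
      unfolding D_def v w
      by (rule fabs_cf_step_diff) (rule fabs_cf_one_step_funpow, rule sizes)+
    also have "\<dots> = fabs (?v - ?w) / real CARD('a) ^ (2 * (r - 1)) / real CARD('a) ^ 2"
      unfolding fabs_cf_one_step_funpow_diff[OF sizes] ..
    also have "\<dots> = D (Suc k) / real CARD('a) ^ (2 * (r - 1) + 2)"
      by (simp add: D_def power_add power2_eq_square)
    also have "2 * (r - 1) + 2 = 2 * r" using r by simp
    finally show ?thesis .
  qed
  have bound: "D k \<le> real CARD('a)" for k
    unfolding D_def by (rule fabs_diff_bound) (simp_all add: fabs_tail fabs_frob_map[OF t])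
  have iter: "D 0 * (real CARD('a) ^ (2 * r)) ^ k = D k" for k
  proof (induction k)
    case (Suc k)
    have "D (Suc k) = D k * real CARD('a) ^ (2 * r)" using step[of k] by simp
    then show ?case using Suc by (simp add: mult_ac)
  qed simp
  have "D 0 = 0"
  proof (rule ccontr)
    assume "D 0 \<noteq> 0"
    then have D0: "0 < D 0" by (simp add: D_def)
    have "1 < real CARD('a) ^ (2 * r)" using r by (intro one_less_power) auto
    then obtain k where "real CARD('a) / D 0 < (real CARD('a) ^ (2 * r)) ^ k" using real_arch_pow by blast
    then have "real CARD('a) < D 0 * (real CARD('a) ^ (2 * r)) ^ k" using D0 by (simp add: field_simps)
    with iter[of k] bound[of k] show False by simp
  qed
  then show ?thesis by (simp add: D_def)
qed

lemma run_distance: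
  assumes c: "c \<noteq> 0" and x: "x = fls_const c * fls_X_inv + inverse x" "fabs x = real CARD('a)"
    and run: "\<And>j. j < n \<Longrightarrow> lam (i + j + 1) = c"
  shows "fabs (tail i - x) = fabs (tail (i + n) - x) / real CARD('a) ^ (2 * n)"
  using run
proof (induction n)
  case (Suc n)
  have "tail (i + n) - x = (fls_const c * fls_X_inv + inverse (tail (i + Suc n))) -
      (fls_const c * fls_X_inv + inverse x)"
    using tail_step[of "i + n"] Suc.prems[of n] x(1) by simp
  then have "fabs (tail (i + n) - x) = fabs (tail (i + Suc n) - x) / real CARD('a) ^ 2"
    by (simp only: fabs_cf_step_diff[OF fabs_tail x(2)])
  moreover have "fabs (tail i - x) = fabs (tail (i + n) - x) / real CARD('a) ^ (2 * n)"
    using Suc by simp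
  ultimately show ?case by (simp add: power2_eq_square)
qed simp

lemma differing_distance:
  assumes x: "fabs (x - fls_const c * fls_X_inv) < real CARD('a)" and "lam (i + 1) \<noteq> c"
  shows "fabs (tail i - x) = real CARD('a)"
proof -
  have "tail i - x = fls_const (lam (i + 1) - c) * fls_X_inv +
      ((tail i - fls_const (lam (i + 1)) * fls_X_inv) - (x - fls_const c * fls_X_inv))"
    by (simp add: algebra_simps const_hom.hom_diff)
  also have "fabs \<dots> = real CARD('a)"
    by (rule fabs_linear) (use assms fabs_tail_diff fabs_diff_less in \<open>auto\<close>)
  finally show ?thesis .
qed

lemma quad_approx_tail:
  assumes "\<And>A C c. I A C \<Longrightarrow> I C (A + B * monom c 1 + C * monom (c ^ 2) 2)"
    and "quad_approx I B (tail i) a g"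
  shows "quad_approx I B Phi (a + 2 * i) (g + 2 * real i)"
  using assms(2)
proof (induction i arbitrary: a g)
  case (Suc i)
  have "quad_approx I B (tail i) (a + 2) (g + 2)"
    using quad_approx_cf_step[OF Suc.prems fabs_tail lam_nonzero[of "i + 1"] assms(1)]
      tail_step[of i] by simp
  from Suc.IH[OF this] show ?case by (simp add: algebra_simps)
qed simp

lemma quad_approx_next_1:
  assumes "quad_approx inv1 (monom 1 1) Phi a g"
  shows "quad_approx inv1 (monom 1 1) Phi (2 ^ t * a + 2 * l) (2 ^ t * g + 2 ^ t - 1 + 2 * real l)"
  by (intro quad_approx_tail[where I = inv1] inv1_cf_step)
    (simp_all only: tail_l quad_approx_frob_map_1[OF assms t])

lemma quad_approx_next_2:
  assumes "quad_approx inv2 (monom b j) Phi a g" "b \<noteq> 0" "b ^ (2 ^ t) = b" "1 \<le> j"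
  shows "quad_approx inv2 (monom b (2 ^ t * j + 2 ^ t - 1)) Phi
    (2 ^ t * a + (2 * 2 ^ t - 2) + 2 * l) (2 ^ t * g + 2 ^ t - 1 + 2 * real l)"
  by (intro quad_approx_tail[where I = inv2] inv2_cf_step)
    (simp_all only: tail_l quad_approx_frob_map_2[OF assms(1) t assms(2-4)])

end

section \<open>Heights, primitivity and distances of the conjugates\<close>

lemma polyT_smult: "polyT (smult c p) = fls_const c * polyT p"
proof -
  have "smult c p = [:c:] * p" by simp
  then show ?thesis by (simp only: polyT_hom.hom_mult) (simp add: polyT_pCons)
qed

context char_2
begin

lemma fabs_eq_powr_degree: "p \<noteq> 0 \<Longrightarrow> fabs (polyT p :: 'a fls) = real CARD('a) powr real (degree p)"
  by (simp add: fabs_polyT powr_realpow)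

text \<open>Both roots have size \<open>q\<close>, so \<open>C\<close> dominates:
  \<open>|C| = q^2 |A|\<close>, while \<open>|B|\<close> is at most \<open>q |A|\<close>.\<close>

lemma height_conjugate_pair:
  assumes "conjugate_pair A B C z (z' :: 'a fls)" "fabs z = real CARD('a)" "fabs z' = real CARD('a)"
  shows "heightT [:C, - B, A:] = real CARD('a) ^ (degree A + 2)"
proof -
  interpret conjugate_pair A B C z z' by fact
  have q1: "1 \<le> real CARD('a)" by (simp add: Suc_leI)
  have A: "fabs (polyT A) = real CARD('a) ^ degree A" using fabs_polyT[OF A_nonzero] .
  have C: "fabs (polyT C) = real CARD('a) ^ (degree A + 2)"
    unfolding norm [symmetric] fabs_mult A assms(2,3) by (simp add: power_add power2_eq_square)
  have "fabs (polyT B) \<le> real CARD('a) ^ degree A * real CARD('a)"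
    unfolding trace [symmetric] fabs_mult A using assms(2,3)
    by (intro mult_left_mono fabs_add_bound) auto
  also have "\<dots> = real CARD('a) ^ (degree A + 1)" by simp
  also have "\<dots> \<le> real CARD('a) ^ (degree A + 2)" by (rule power_increasing[OF _ q1]) simp
  finally have B: "fabs (polyT B) \<le> real CARD('a) ^ (degree A + 2)" .
  have A': "fabs (polyT A) \<le> real CARD('a) ^ (degree A + 2)"
    unfolding A by (rule power_increasing[OF _ q1]) simp
  show ?thesis
  proof (rule antisym)
    show "heightT [:C, - B, A:] \<le> real CARD('a) ^ (degree A + 2)"
      unfolding heightT_eq_gnorm
      by (rule gnorm_le) (use A' B C in \<open>auto simp: coeff_pCons split: nat.split\<close>)
    show "real CARD('a) ^ (degree A + 2) \<le> heightT [:C, - B, A:]"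
      using fabs_coeff_le_heightT[of "[:C, - B, A:]" 0] C by simp
  qed
qed

lemma inv1_primitive: "inv1 A C \<Longrightarrow> primitive_poly [:C, - monom 1 1, A:]"
  unfolding primitive_poly_def
proof (intro allI impI)
  fix c assume "inv1 A C" and dvd: "\<forall>i. c dvd coeff [:C, - monom 1 1, A:] i"
  then obtain F where F: "A + 1 = monom 1 1 * F" unfolding inv1_def by blast
  have "c dvd monom 1 1" "c dvd A" using dvd[rule_format, of 1] dvd[rule_format, of 2]
    by (simp_all add: numeral_2_eq_2)
  then have "c dvd monom 1 1 * F - A" by (intro dvd_diff dvd_mult2)
  also have "monom 1 1 * F - A = 1" unfolding F [symmetric] by simp
  finally show "is_unit c" .
qed

lemma unit_if_dvd_monom:
  fixes c :: "'a poly"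
  assumes "b \<noteq> 0" "poly c 0 \<noteq> 0"
  shows "c dvd monom b j \<Longrightarrow> is_unit c"
proof (induction j)
  case 0
  then show ?case using assms(1) by (metis dvd_trans is_unit_const_poly_iff monom_0 dvd_field_iff)
next
  case (Suc j)
  from Suc.prems obtain e where e: "monom b (Suc j) = c * e" by (rule dvdE)
  from arg_cong[OF e, of "\<lambda>p. poly p 0"] have "poly e 0 = 0"
    using assms(2) by (simp add: poly_monom)
  then obtain e' where "e = [:0, 1:] * e'"
    using poly_eq_0_iff_dvd[of e 0] by (auto elim: dvdE)
  then have "pCons 0 (monom b j) = pCons 0 (c * e')"
    using e by (simp add: monom_Suc)
  then have "c dvd monom b j" by simp
  then show ?case by (rule Suc.IH)
qed

lemma inv2_primitive:
  assumes "inv2 A C" "b \<noteq> 0"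
  shows "primitive_poly [:C, - monom b j, A:]"
  unfolding primitive_poly_def
proof (intro allI impI)
  fix c assume dvd: "\<forall>i. c dvd coeff [:C, - monom b j, A:] i"
  have c: "c dvd monom b j" "c dvd A" "c dvd C"
    using dvd[rule_format, of 1] dvd[rule_format, of 2] dvd[rule_format, of 0]
    by (simp_all add: numeral_2_eq_2)
  have "poly c 0 \<noteq> 0"
  proof
    assume "poly c 0 = 0"
    then have "poly A 0 = 0" "poly C 0 = 0" using c(2,3) by (auto elim!: dvdE)
    with assms(1) show False by (simp add: inv2_def)
  qed
  then show "is_unit c" using unit_if_dvd_monom assms(2) c(1) by blast
qed

text \<open>In characteristic two \<open>z - z' = z + z'\<close>, so the distance of the conjugates
  is \<open>|B / A|\<close>. By \<open>less\<close> this exceeds \<open>|\<xi> - z|\<close>, hence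
  it is also \<open>|\<xi> - z'|\<close>: the degree of \<open>B\<close> determines \<open>f\<close>
  and \<open>cf\<close>.\<close>

lemma quadratic_approximationsI:
  fixes r a f g ca cf cg :: real
  assumes approx: "\<And>k. \<exists>n. quad_approx I (B k) \<xi> n (g * r ^ k + cg) \<and> real n = a * r ^ k + ca"
    and primitive: "\<And>A C k. I A C \<Longrightarrow> primitive_poly [:C, - B k, A:]"
    and B: "\<And>k. B k \<noteq> 0" "\<And>k. real (degree (B k)) = (a - f) * r ^ k + (ca - cf)"
    and less: "\<And>k. f * r ^ k + cf < g * r ^ k + cg"
    and params: "1 < r" "0 < a" "0 < f" "f \<le> a" "f \<le> g" and \<xi>: "fabs \<xi> = real CARD('a)"
  shows "\<exists>A C z z'. quadratic_approximations \<xi> A B C z z' r a f g ca cf cg"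
proof -
  define R where "R k p \<longleftrightarrow> (case p of (A, C, z, z') \<Rightarrow> conjugate_pair A (B k) C z z' \<and> I A C \<and>
    fabs z = real CARD('a) \<and> fabs z' = real CARD('a) \<and> real (degree A) = a * r ^ k + ca \<and> irrationalT z \<and>
    fabs (\<xi> - z) = real CARD('a) powr (- (g * r ^ k + cg)))" for k p
  have "\<exists>p. R k p" for k
    using approx[of k] unfolding quad_approx_def R_def by auto
  then obtain p where p: "R k (p k)" for k by metis
  define A where "A k = fst (p k)" for k
  define C where "C k = fst (snd (p k))" for k
  define z where "z k = fst (snd (snd (p k)))" for k
  define z' where "z' k = snd (snd (snd (p k)))" for k
  have *: "conjugate_pair (A k) (B k) (C k) (z k) (z' k)" "I (A k) (C k)" "fabs (z k) = real CARD('a)"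
    "fabs (z' k) = real CARD('a)" "real (degree (A k)) = a * r ^ k + ca" "irrationalT (z k)"
    "fabs (\<xi> - z k) = real CARD('a) powr (- (g * r ^ k + cg))" for k
    using p[of k] by (auto simp: R_def A_def C_def z_def z'_def split: prod.splits)
  have A0: "A k \<noteq> 0" for k using conjugate_pair.A_nonzero[OF *(1)] .
  have fabs_A: "fabs (polyT (A k)) = real CARD('a) powr (a * r ^ k + ca)" for k
    unfolding fabs_eq_powr_degree[OF A0] *(5) ..
  have "quadratic_approximations \<xi> A B C z z' r a f g ca cf cg"
  proof (rule quadratic_approximations.intro)
    fix k
    show "irrational_conjugate_pair (A k) (B k) (C k) (z k) (z' k)"
      using *(1,6)[of k] primitive[OF *(2), of k]
      by (intro irrational_conjugate_pair.intro irrational_conjugate_pair_axioms.intro)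
        (auto simp: irrationalT_def)
    show "heightT [:C k, - B k, A k:] = real CARD('a) powr (a * r ^ k + ca + 2)"
    proof -
      have "real (degree (A k) + 2) = a * r ^ k + ca + 2" using *(5)[of k] by simp
      then show ?thesis
        unfolding height_conjugate_pair[OF *(1,3,4)] by (metis card_field_pos_real powr_realpow)
    qed
    have "polyT (A k) * (z k - z' k) = polyT (B k)"
      using conjugate_pair.trace[OF *(1)[of k]] by (simp only: minus_eq)
    then have "fabs (polyT (A k)) * fabs (z k - z' k) = real CARD('a) powr ((a - f) * r ^ k + (ca - cf))"
      using fabs_eq_powr_degree[OF B(1), of k] unfolding B(2) by (simp flip: fabs_mult)
    then have d: "fabs (z k - z' k) = real CARD('a) powr (- (f * r ^ k + cf))"
      unfolding fabs_A by (simp add: field_simps powr_add powr_diff powr_minus)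
    then have "fabs (\<xi> - z k) < fabs (z k - z' k)"
      unfolding *(7) using less[of k] by simp
    then show "fabs (\<xi> - z' k) = real CARD('a) powr (- (f * r ^ k + cf))"
      using fabs_add_eq2[of "\<xi> - z k" "z k - z' k"] d by simp
  qed (use *(3,4,7) params \<xi> fabs_A in auto)
  then show ?thesis by blast
qed

end

section \<open>Starting approximations and exponents in the two cases\<close>

context hyperquadratic_cf
begin

abbreviation "r \<equiv> (2::real) ^ t"

lemma r_ge_2: "2 \<le> r"
  using power_increasing[of 1 t "2::real"] t by simp

lemma fabs_Phi: "fabs Phi = real CARD('a)"
  using fabs_tail[of 0] by simp

text \<open>\<open>Phi\<close> shares its first \<open>m\<close> partial quotients with \<open>[\<lambda>T, T, T, \<dots>]\<close>.\<close>

lemma quad_approx_base_1: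
  assumes m: "1 \<le> m" "m \<le> l" and lam1: "lam 1 \<noteq> 1"
    and ones: "\<And>i. 2 \<le> i \<Longrightarrow> i \<le> m \<Longrightarrow> lam i = 1" and next_m: "m < l \<Longrightarrow> lam (m + 1) \<noteq> 1"
  shows "quad_approx inv1 (monom 1 1) Phi 0 (2 * real m - 1)"
proof -
  obtain x :: "'a fls" where x: "x = fls_const 1 * fls_X_inv + inverse x" "fabs x = real CARD('a)"
      "fabs (x - fls_const 1 * fls_X_inv) < real CARD('a)"
    using periodic_cf[of 1] by auto
  have x0: "x \<noteq> 0" using x(2) nonzero_of_fabs by blast
  define b where "b = lam 1"
  \<comment> \<open>From \<open>x^2 = T x + 1\<close> the conjugate of \<open>x\<close> is
    \<open>1 / x\<close>; so \<open>b T + 1 / x\<close> has the conjugate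
    \<open>b T + x = (b + 1) T + 1 / x\<close>. As \<open>lam 1 \<noteq> 1\<close>, this too has
    size \<open>q\<close>.\<close>
  define \<mu> where "\<mu> = b + 1"
  have b: "b \<noteq> 0" "\<mu> \<noteq> 0"
    using lam_nonzero[of 1] lam1 by (auto simp: b_def \<mu>_def add_eq_0_iff uminus_eq)
  \<comment> \<open>The agreement must end after exactly \<open>m\<close> quotients. For
    \<open>m = l\<close> the next coefficient is a Frobenius power of \<open>lam 1\<close>, and
    Frobenius is injective.\<close>
  have "lam (m + 1) \<noteq> 1"
  proof (cases "m < l")
    case False
    then have "lam (m + 1) = lam 1 ^ (2 ^ t)" using m lam_first[of 0] by simp
    then show ?thesis using frobenius_eq_1 lam1 by simp
  qed (rule next_m)
  then have "fabs (tail m - x) = real CARD('a)" by (rule differing_distance[OF x(3)])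
  moreover have "fabs (tail 1 - x) = fabs (tail (1 + (m - 1)) - x) / real CARD('a) ^ (2 * (m - 1))"
    by (rule run_distance[OF _ x(1,2)]) (use ones in auto)
  ultimately have d: "fabs (tail 1 - x) = real CARD('a) / real CARD('a) ^ (2 * (m - 1))" using m by simp
  let ?z = "fls_const b * fls_X_inv + inverse x"
  let ?z' = "fls_const \<mu> * fls_X_inv + inverse x"
  have Phi: "Phi = fls_const b * fls_X_inv + inverse (tail 1)"
    using tail_step[of 0] by (simp add: b_def)
  have "fabs (Phi - ?z) = fabs (tail 1 - x) / real CARD('a) ^ 2"
    by (subst Phi) (rule fabs_cf_step_diff[OF fabs_tail x(2)])
  also have "\<dots> = real CARD('a) / real CARD('a) ^ (2 * (m - 1) + 2)"
    unfolding d power_add by (simp only: divide_divide_eq_left)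
  also have "2 * (m - 1) + 2 = 2 * m" using m by simp
  also have "real CARD('a) / real CARD('a) ^ (2 * m) = real CARD('a) powr (1 - real (2 * m))"
    by (simp add: powr_diff powr_realpow del: of_nat_mult)
  finally have dist: "fabs (Phi - ?z) = real CARD('a) powr (- (2 * real m - 1))" by simp
  have inv_x: "fls_X_inv * inverse x + inverse x * inverse x = 1"
  proof -
    have "x * inverse x = (fls_X_inv + inverse x) * inverse x" using x(1) by simp
    then show ?thesis using x0 by (simp add: distrib_right)
  qed
  have sum: "fls_const b + fls_const \<mu> = 1"
    by (simp add: \<mu>_def fls_plus_const char_2_simps)
  have "?z + ?z' = (fls_const b + fls_const \<mu>) * fls_X_inv + (inverse x + inverse x)"
    by (simp add: algebra_simps)
  then have trace: "?z + ?z' = fls_X_inv"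
    unfolding sum add_self by simp
  have "?z * ?z' = fls_const b * fls_const \<mu> * fls_X_inv ^ 2 +
      (fls_const b + fls_const \<mu>) * (fls_X_inv * inverse x) + inverse x * inverse x"
    by (simp add: algebra_simps power2_eq_square)
  then have norm: "?z * ?z' = fls_const b * fls_const \<mu> * fls_X_inv ^ 2 + 1"
    unfolding sum using inv_x by (simp add: add.assoc)
  have "polyT 1 * (?z + ?z') = polyT (monom 1 1)" unfolding trace by simp
  moreover have "polyT 1 * (?z * ?z') = polyT (1 + monom (b * \<mu>) 2)"
    unfolding norm by (simp add: add.commute)
  ultimately have "conjugate_pair 1 (monom 1 1) (1 + monom (b * \<mu>) 2) ?z ?z'"
    by (intro conjugate_pair.intro) simp_all
  moreover have "inv1 1 (1 + monom (b * \<mu>) 2)"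
    unfolding inv1_def
    by (intro exI[of _ "[:b * \<mu>:]"] exI[of _ 0])
      (simp add: char_2_simps smult_monom)
  moreover have "irrationalT ?z"
    using irrationalT_cf_step[OF irrationalT_periodic[OF x(1,2)] x0] .
  ultimately show ?thesis
    unfolding quad_approx_def
    using fabs_cf_step[OF b(1) x(2)] fabs_cf_step[OF b(2) x(2)] dist degree_1 by blast
qed

text \<open>One round acts by \<open>n -> r n + 2 l\<close> and
  \<open>g -> r g + r - 1 + 2 l\<close>, with fixed points \<open>- L\<close> and
  \<open>- 1 - L\<close>; the factors of \<open>r ^ k\<close> are the deviations of the starting
  values from them.\<close>

lemma quad_approx_sequence_1:
  assumes "quad_approx inv1 (monom 1 1) Phi 0 (2 * real m - 1)"
  defines "L \<equiv> 2 * real l / (r - 1)"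
  shows "\<exists>n. quad_approx inv1 (monom 1 1) Phi n ((2 * real m + L) * r ^ k + (- 1 - L)) \<and>
    real n = L * r ^ k + (- L)"
proof (induction k)
  case 0
  show ?case using assms(1) by (intro exI[of _ 0]) (simp add: algebra_simps)
next
  case (Suc k)
  then obtain n where n: "quad_approx inv1 (monom 1 1) Phi n ((2 * real m + L) * r ^ k + (- 1 - L))"
    "real n = L * r ^ k + (- L)" by blast
  have L: "L * r = L + 2 * real l" using r_ge_2 by (simp add: L_def field_simps)
  have "r * ((2 * real m + L) * r ^ k + (- 1 - L)) + r - 1 + 2 * real l =
      (2 * real m + L) * r ^ Suc k - L * r - 1 + 2 * real l"
    by (simp add: algebra_simps)
  also have "\<dots> = (2 * real m + L) * r ^ Suc k + (- 1 - L)" unfolding L by simp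
  finally have g: "r * ((2 * real m + L) * r ^ k + (- 1 - L)) + r - 1 + 2 * real l =
      (2 * real m + L) * r ^ Suc k + (- 1 - L)" .
  have "real (2 ^ t * n + 2 * l) = r * real n + 2 * real l" by simp
  also have "\<dots> = L * r ^ Suc k - L * r + 2 * real l"
    unfolding n(2) by (simp add: algebra_simps)
  also have "\<dots> = L * r ^ Suc k + (- L)" unfolding L by simp
  finally show ?case
    using quad_approx_next_1[OF n(1)] unfolding g by blast
qed

text \<open>As \<open>B\<close> stays \<open>T\<close>, the conjugates are at distance
  \<open>q / |A|\<close>, so \<open>f = a = L\<close> and the two exponents differ by 1. The
  relation \<open>g = (w + 1) * L\<close> turns the general condition into the stated one.\<close>

lemma exponents_1:
  assumes m: "1 \<le> m" "m \<le> l" and lam1: "lam 1 \<noteq> 1"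
    and ones: "\<And>i. 2 \<le> i \<Longrightarrow> i \<le> m \<Longrightarrow> lam i = 1" and next_m: "m < l \<Longrightarrow> lam (m + 1) \<noteq> 1"
  defines "w \<equiv> real m / real l * (r - 1)"
  shows "ereal w \<le> wstar_exp 2 Phi" "ereal (1 + w) \<le> w_exp 2 Phi"
    "\<And>n. 2 \<le> n \<Longrightarrow> real n < w + 2 \<Longrightarrow> 2 * r * (real n - 1) \<le> (w - 1) * (w + 2 - real n) \<Longrightarrow>
      wstar_exp n Phi = ereal w \<and> w_exp n Phi = ereal (1 + w)"
proof -
  define L where "L = 2 * real l / (r - 1)"
  have L: "0 < L" using l r_ge_2 by (simp add: L_def)
  have g: "2 * real m + L = (w + 1) * L"
    using l r_ge_2 by (simp add: L_def w_def field_simps)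
  have w: "0 \<le> w" using r_ge_2 by (simp add: w_def)
  have "\<exists>A C z z'. quadratic_approximations Phi A (\<lambda>_. monom 1 1) C z z' r L L (2 * real m + L)
      (- L) (- 1 - L) (- 1 - L)"
  proof (rule quadratic_approximationsI[where I = inv1])
    show "\<exists>n. quad_approx inv1 (monom 1 1) Phi n ((2 * real m + L) * r ^ k + (- 1 - L)) \<and>
        real n = L * r ^ k + (- L)" for k
      unfolding L_def by (rule quad_approx_sequence_1[OF quad_approx_base_1[OF assms(1-5)]])
    show "L * r ^ k + (- 1 - L) < (2 * real m + L) * r ^ k + (- 1 - L)" for k
      using m r_ge_2 by (simp add: algebra_simps)
    show "primitive_poly [:C, - monom 1 1, A:]" if "inv1 A C" for A C
      using that by (rule inv1_primitive)
  qed (use L m r_ge_2 fabs_Phi in \<open>auto simp: degree_monom_eq\<close>)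
  then obtain A C z z' where
    "quadratic_approximations Phi A (\<lambda>_. monom 1 1) C z z' r L L (2 * real m + L) (- L) (- 1 - L) (- 1 - L)"
    by blast
  then interpret QA: quadratic_approximations Phi A "\<lambda>_. monom 1 1" C z z' r L L "2 * real m + L"
    "- L" "- 1 - L" "- 1 - L" .
  have ws: "QA.wstar = w" "QA.w = 1 + w"
    unfolding QA.w_def QA.wstar_def unfolding g using L by simp_all
  show "ereal w \<le> wstar_exp 2 Phi" "ereal (1 + w) \<le> w_exp 2 Phi"
    using QA.exponents_ge unfolding ws .
  fix n assume n: "2 \<le> n" "real n < w + 2" "2 * r * (real n - 1) \<le> (w - 1) * (w + 2 - real n)"
  have 1: "real n * L < (2 * real m + L) + L"
    using mult_strict_right_mono[OF n(2) L] unfolding g by (simp add: algebra_simps)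
  have "2 * r * (real n - 1) * L ^ 2 \<le> (w - 1) * (w + 2 - real n) * L ^ 2"
    by (rule mult_right_mono[OF n(3)]) simp
  then have 2: "2 * r * L * (real n * L - L) \<le> (2 * real m + L - 2 * L) * (2 * real m + L + L - real n * L)"
    unfolding g by (simp add: algebra_simps power2_eq_square)
  show "wstar_exp n Phi = ereal w \<and> w_exp n Phi = ereal (1 + w)"
    using QA.exponents_eq[OF n(1) 1 2] unfolding ws by blast
qed

text \<open>The first approximation is the image under \<open>frob_map\<close> of \<open>\<alpha> = [cT, cT, \<dots>]\<close>, whose
  conjugate \<open>1 / \<alpha>\<close> is small; this is why the first of the \<open>l\<close> steps back to \<open>Phi\<close> is special.\<close>

lemma quad_approx_base_2:
  assumes c: "c \<noteq> 1" "c ^ (2 ^ t) = c" and lam: "\<And>i. 1 \<le> i \<Longrightarrow> i \<le> l \<Longrightarrow> lam i = c"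
  shows "quad_approx inv2 (monom c (2 ^ t - 1)) Phi (2 ^ t - 2 + 2 * (l - 1))
    (r * (2 * real l + 1) + r - 1 + 2 * real l)"
proof -
  define R :: nat where "R = 2 ^ t"
  have R: "2 \<le> R" using two_le_pow2[OF t] by (simp add: R_def)
  have c0: "c \<noteq> 0" using lam[of 1] lam_nonzero[of 1] l by simp
  obtain x :: "'a fls" where x: "x = fls_const c * fls_X_inv + inverse x" "fabs x = real CARD('a)"
      "fabs (x - fls_const c * fls_X_inv) < real CARD('a)"
    using periodic_cf[OF c0] by blast
  have x0: "x \<noteq> 0" using x(2) nonzero_of_fabs by blast
  \<comment> \<open>\<open>Phi\<close> and \<open>x\<close> share exactly \<open>l + 1\<close>
    quotients: the next one after the initial block is \<open>c ^ r T = c T\<close>, the one after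
    that is \<open>T\<close>.\<close>
  have "lam (l + 2) = 1" using lam_one[of 2 0] R by (simp add: R_def)
  then have "fabs (tail (l + 1) - x) = real CARD('a)"
    using c(1) by (intro differing_distance[OF x(3)]) simp
  moreover have "fabs (tail 0 - x) = fabs (tail (0 + (l + 1)) - x) / real CARD('a) ^ (2 * (l + 1))"
  proof (rule run_distance[OF c0 x(1,2)])
    fix j assume "j < l + 1"
    moreover have "lam (l + 1) = c" using lam_first[of 0] lam[of 1] l c(2) by simp
    ultimately show "lam (0 + j + 1) = c" using lam[of "j + 1"] by (cases "j = l") auto
  qed
  ultimately have "fabs (Phi - x) = real CARD('a) / real CARD('a) ^ (2 * (l + 1))" by simp
  also have "\<dots> = real CARD('a) powr (1 - real (2 * (l + 1)))"
    by (simp only: powr_diff powr_realpow card_field_pos_real powr_one)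
  finally have "fabs (Phi - x) = real CARD('a) powr (- (2 * real l + 1))" by (simp add: algebra_simps)
  from fabs_frob_map_diff_powr[OF this, of t]
  have dist: "fabs (tail l - frob_map t x) = real CARD('a) powr (- (r * (2 * real l + 1) + r - 1))"
    unfolding tail_l .
  define w where "w = frob_map t x"
  define w' where "w' = frob_map t (inverse x)"
  define u :: "'a fls" where "u = polyT (frob_shift t)"
  define S :: "'a fls" where "S = fls_X_inv ^ (R - 1)"
  define V :: "'a fls" where "V = fls_X_inv ^ (R - 2)"
  define T :: "'a fls" where "T = fls_X_inv"
  have S0: "S \<noteq> 0" by (simp add: S_def)
  have exps: "R - 1 = Suc (R - 2)" using R by simp
  have TS: "S = T * V" unfolding S_def T_def V_def exps by simp
  have TR: "T ^ R = T * S" using fls_X_inv_pow2(1)[of t] by (simp add: S_def T_def R_def mult.commute)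
  have w: "fabs w = real CARD('a)" unfolding w_def by (rule fabs_frob_map[OF t x(2)])
  have w0: "w \<noteq> 0" using w nonzero_of_fabs by blast
  have fabs_u: "fabs u = real CARD('a) ^ (R - 2)" "fabs (u - V) < real CARD('a) ^ (R - 2)"
    using fabs_frob_shift[OF t, where 'a = 'a] by (simp_all add: u_def V_def R_def)
  have small: "fabs (inverse x ^ R) < 1"
    unfolding fabs_power using fabs_inverse_less(1)[OF x(2)] R by (intro power_less_one_iff[THEN iffD2]) auto
  have "1 \<le> real CARD('a) ^ (R - 2)" by (rule one_le_power) (simp add: Suc_leI)
  with small have small': "fabs (inverse x ^ R) < real CARD('a) ^ (R - 2)" by linarith
  have w'S: "w' * S = inverse x ^ R + u"
    using frob_map_mult[of t "inverse x"] by (simp add: w'_def S_def u_def R_def)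
  have fabs_w'S: "fabs (w' * S) = real CARD('a) ^ (R - 2)"
    unfolding w'S using small' fabs_u(1) by (simp add: fabs_add_eq2)
  then have w'0: "w' \<noteq> 0" by auto
  have fabs_V: "fabs V = real CARD('a) ^ (R - 2)" by (simp add: V_def fabs_power)
  \<comment> \<open>For a small argument the shift \<open>u\<close>, of size
    \<open>q ^ (R - 2)\<close>, dominates the numerator of \<open>frob_map\<close>.\<close>
  have fabs_w': "fabs w' = 1 / real CARD('a)"
    using fabs_w'S unfolding TS fabs_mult fabs_V by (simp add: T_def field_simps)
  let ?z = "fls_const c * fls_X_inv + inverse w"
  let ?z' = "fls_const c * fls_X_inv + inverse w'"
  \<comment> \<open>Since \<open>w'\<close> is close to \<open>u / S\<close> and \<open>u\<close> to
    \<open>V = S / T\<close>, its inverse is close to \<open>T\<close>; so the conjugate is close to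
    \<open>(c + 1) T\<close>, and \<open>c \<noteq> 1\<close> keeps it of size
    \<open>q\<close>.\<close>
  have z': "fabs ?z' = real CARD('a)"
  proof -
    have eq: "inverse w' - T = T * (V - u - inverse x ^ R) / (w' * S)"
    proof -
      have "(inverse w' - T) * (w' * S) = S - T * (w' * S)"
        using w'0 by (simp add: left_diff_distrib)
      also have "\<dots> = T * (V - u - inverse x ^ R)"
        unfolding w'S by (simp add: TS algebra_simps)
      finally show ?thesis using w'0 S0 by (simp add: eq_divide_eq)
    qed
    have "fabs (V - u) < real CARD('a) ^ (R - 2)"
      using fabs_u(2) fabs_minus_commute[of u V] by simp
    then have less: "fabs (V - u - inverse x ^ R) < real CARD('a) ^ (R - 2)"
      by (rule fabs_diff_less) (rule small')
    have "fabs (inverse w' - T) = real CARD('a) * fabs (V - u - inverse x ^ R) / real CARD('a) ^ (R - 2)"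
      unfolding eq fabs_divide fabs_w'S fabs_mult[of T] by (simp add: T_def)
    also have "\<dots> < real CARD('a)" using less by (simp add: divide_less_eq)
    finally have "fabs (inverse w' - T) < real CARD('a)" .
    moreover have "c + 1 \<noteq> 0" using c(1) by (simp add: add_eq_0_iff uminus_eq)
    ultimately have "fabs (fls_const (c + 1) * fls_X_inv + (inverse w' - T)) = real CARD('a)"
      by (intro fabs_linear)
    also have "fls_const (c + 1) * fls_X_inv + (inverse w' - T) = ?z'"
      by (simp add: T_def algebra_simps flip: fls_plus_const)
    finally show ?thesis .
  qed
  have z: "fabs ?z = real CARD('a)" by (rule fabs_cf_step[OF c0 w])
  have x_pair: "conjugate_pair 1 (monom c 1) 1 x (inverse x)"
  proof
    have "x + inverse x = fls_const c * fls_X_inv + (inverse x + inverse x)"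
      by (subst (1) x(1)) (simp add: add.assoc)
    then show "polyT 1 * (x + inverse x) = polyT (monom c 1)" by (simp add: add_self)
  qed (use x0 in simp_all)
  \<comment> \<open>For \<open>A = C = 1\<close> and \<open>B = c T\<close> the equation from
    \<open>frob_map_pair\<close> has the common factor \<open>T ^ R\<close>; \<open>A'\<close>,
    \<open>monom c (R - 1)\<close> and \<open>C'\<close> are what remains.\<close>
  define A' :: "'a poly" where "A' = monom 1 (R - 2)"
  define C' where "C' = smult (1 + c) (frob_shift t) + A'"
  have pA': "polyT A' = V" by (simp add: A'_def V_def)
  have const_pow: "fls_const c ^ R = fls_const c"
    using c(2) by (simp add: R_def flip: const_hom.hom_power)
  have "(w + w') * S = fls_const c * T ^ R"
    using frob_map_pair(1)[OF x_pair, of t] const_pow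
    by (simp add: w_def w'_def S_def R_def T_def power_mult_distrib)
  then have "w + w' = fls_const c * T" using S0 by (simp add: TR)
  then have "polyT A' * (w + w') = fls_const c * S"
    by (simp add: pA' TS)
  then have trace: "polyT A' * (w + w') = polyT (monom c (R - 1))"
    by (simp add: S_def)
  have det: "u ^ 2 + u * T ^ R + S ^ 2 = 1"
    using frob_shift_det_fls[of t] fls_X_inv_pow2(2)[of t] by (simp add: u_def R_def T_def S_def)
  have "(w * w') * S ^ 2 = 1 + u * (fls_const c * T ^ R) + u ^ 2"
    using frob_map_pair(2)[OF x_pair, of t] const_pow
    by (simp add: w_def w'_def S_def R_def T_def u_def power_mult_distrib)
  also have "\<dots> = (u ^ 2 + u * T ^ R + S ^ 2) + u * (fls_const c * T ^ R) + u ^ 2"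
    unfolding det ..
  also have "\<dots> = u * T * S + S ^ 2 + u * fls_const c * T * S"
    unfolding TR by (simp add: algebra_simps char_2_simps)
  finally have ww': "(w * w') * S ^ 2 = u * T * S + S ^ 2 + u * fls_const c * T * S" .
  have "V * (w * w') * S ^ 2 = V * (u * T * S + S ^ 2 + u * fls_const c * T * S)"
    unfolding ww' [symmetric] by (simp only: mult.assoc)
  also have "\<dots> = (u + V + u * fls_const c) * S ^ 2"
    by (simp add: TS algebra_simps power2_eq_square)
  finally have "polyT A' * (w * w') = u + V + u * fls_const c"
    using S0 by (simp add: pA')
  also have "\<dots> = polyT C'"
    by (simp add: C'_def u_def pA' polyT_smult smult_add_left algebra_simps)
  finally have norm: "polyT A' * (w * w') = polyT C'" .
  have w_pair: "conjugate_pair A' (monom c (R - 1)) C' w w'"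
    by unfold_locales (use trace norm in \<open>simp_all add: A'_def\<close>)
  \<comment> \<open>Here \<open>|w w'| = 1\<close> instead of \<open>q^2\<close>, so the first step
    back does not raise the degree; hence \<open>2 * (l - 1)\<close> instead of \<open>2 * l\<close>
    in the conclusion.\<close>
  have "degree C' = degree A' + 0"
    by (rule degree_norm[OF w_pair]) (simp add: fabs_mult w fabs_w')
  then have deg: "degree C' = R - 2" by (simp add: A'_def degree_monom_eq)
  have "inv2 A' C'"
    using c(1) by (simp add: inv2_def C'_def poly_frob_shift_0[OF t] add_eq_0_iff uminus_eq)
  note inv = inv2_cf_step[OF this, of "monom c (R - 1)" c]
  have "irrationalT w"
    unfolding w_def by (rule irrationalT_frob_map[OF x_pair _ irrationalT_periodic[OF x(1,2)]])
      (use c0 in simp)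
  note irr = irrationalT_cf_step[OF this w0, of c]
  have "tail (l - 1) = fls_const c * fls_X_inv + inverse (tail l)"
    using tail_step[of "l - 1"] lam[of l] l by simp
  then have "fabs (tail (l - 1) - ?z) = fabs (tail l - w) / real CARD('a) ^ 2"
    using fabs_cf_step_diff[OF fabs_tail[of l] w] by metis
  also have "\<dots> = real CARD('a) powr (- (r * (2 * real l + 1) + r - 1 + 2))"
    unfolding w_def dist by (simp add: powr_diff powr_minus powr_add divide_inverse power2_eq_square)
  finally have "quad_approx inv2 (monom c (R - 1)) (tail (l - 1)) (R - 2)
      (r * (2 * real l + 1) + r - 1 + 2)"
    unfolding quad_approx_def
    using conjugate_pair_cf_step[OF w_pair w0 w'0, of c] inv z z' deg irr by blast
  from quad_approx_tail[where I = inv2, OF inv2_cf_step this]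
  have "quad_approx inv2 (monom c (R - 1)) Phi (R - 2 + 2 * (l - 1))
      (r * (2 * real l + 1) + r - 1 + 2 + 2 * real (l - 1))" by blast
  then show ?thesis using l by (simp add: R_def algebra_simps of_nat_diff)
qed

end

context hyperquadratic_cf
begin

text \<open>The degree recursion now contains the uncancelled \<open>2 r - 2\<close>, which moves
  its fixed point to \<open>- 2 - L\<close>. The exponent of \<open>B\<close> obeys
  \<open>j + 1 -> r (j + 1)\<close>, whence \<open>r ^ (k + 1) - 1\<close>.\<close>

lemma quad_approx_sequence_2:
  assumes c: "c \<noteq> 1" "c ^ (2 ^ t) = c" and lam: "\<And>i. 1 \<le> i \<Longrightarrow> i \<le> l \<Longrightarrow> lam i = c"
  defines "L \<equiv> 2 * real l / (r - 1)"
  shows "\<exists>n. quad_approx inv2 (monom c ((2 ^ t) ^ Suc k - 1)) Phi n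
      ((2 * r * (real l + 1) + L * r) * r ^ k + (- 1 - L)) \<and>
    real n = (2 * real l + r - 2 + L) * r ^ k + (- 2 - L)"
proof (induction k)
  case 0
  have L: "L * r = L + 2 * real l" using r_ge_2 by (simp add: L_def field_simps)
  have g: "r * (2 * real l + 1) + r - 1 + 2 * real l = (2 * r * (real l + 1) + L * r) * r ^ 0 + (- 1 - L)"
    using L by (simp add: algebra_simps)
  have "real (2 ^ t - 2 + 2 * (l - 1)) = (2 * real l + r - 2 + L) * r ^ 0 + (- 2 - L)"
    using two_le_pow2[OF t] l by (simp add: of_nat_diff)
  moreover have "quad_approx inv2 (monom c ((2 ^ t) ^ Suc 0 - 1)) Phi (2 ^ t - 2 + 2 * (l - 1))
      (r * (2 * real l + 1) + r - 1 + 2 * real l)"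
    using quad_approx_base_2[OF assms(1-3)] by simp
  ultimately show ?case unfolding g by blast
next
  case (Suc k)
  let ?g = "(2 * r * (real l + 1) + L * r) * r ^ k + (- 1 - L)"
  define j :: nat where "j = (2 ^ t) ^ Suc k - 1"
  obtain n where n: "quad_approx inv2 (monom c j) Phi n ?g"
    "real n = (2 * real l + r - 2 + L) * r ^ k + (- 2 - L)"
    using Suc unfolding j_def by blast
  have L: "L * r = L + 2 * real l" using r_ge_2 by (simp add: L_def field_simps)
  have c0: "c \<noteq> 0" using lam[of 1] lam_nonzero[of 1] l by simp
  have "(2::nat) ^ t \<le> (2 ^ t) ^ Suc k" by simp
  then have j: "1 \<le> j" "Suc j = (2 ^ t) ^ Suc k"
    using two_le_pow2[OF t] unfolding j_def by linarith+
  have "2 ^ t * j + 2 ^ t = 2 ^ t * Suc j" by simp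
  then have j': "2 ^ t * j + 2 ^ t - 1 = (2 ^ t) ^ Suc (Suc k) - (1::nat)"
    unfolding j(2) by simp
  have "r * ?g + r - 1 + 2 * real l =
      (2 * r * (real l + 1) + L * r) * r ^ Suc k - L * r - 1 + 2 * real l"
    by (simp add: algebra_simps)
  also have "\<dots> = (2 * r * (real l + 1) + L * r) * r ^ Suc k + (- 1 - L)"
    by (simp add: L)
  finally have g: "r * ?g + r - 1 + 2 * real l =
      (2 * r * (real l + 1) + L * r) * r ^ Suc k + (- 1 - L)" .
  have "real (2 ^ t * n + (2 * 2 ^ t - 2) + 2 * l) = r * real n + 2 * r - 2 + 2 * real l"
  proof -
    have "real (2 * 2 ^ t - 2) = 2 * r - 2"
      using two_le_pow2[OF t] by (simp add: of_nat_diff)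
    then show ?thesis by (simp only: of_nat_add) simp
  qed
  also have "\<dots> = (2 * real l + r - 2 + L) * r ^ Suc k - L * r - 2 + 2 * real l"
    unfolding n(2) by (simp add: algebra_simps)
  also have "\<dots> = (2 * real l + r - 2 + L) * r ^ Suc k + (- 2 - L)"
    by (simp add: L)
  finally have a: "real (2 ^ t * n + (2 * 2 ^ t - 2) + 2 * l) =
      (2 * real l + r - 2 + L) * r ^ Suc k + (- 2 - L)" .
  have "quad_approx inv2 (monom c (2 ^ t * j + 2 ^ t - 1)) Phi
      (2 ^ t * n + (2 * 2 ^ t - 2) + 2 * l) (r * ?g + r - 1 + 2 * real l)"
    by (rule quad_approx_next_2[OF n(1) c0 c(2) j(1)])
  then show ?case unfolding g j' using a by blast
qed

text \<open>The degree \<open>r ^ (k + 1) - 1\<close> of \<open>B\<close> yields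
  \<open>f = a - r\<close>. The exponents therefore differ by \<open>1 - r / a\<close>, and
  \<open>a * (r - 1) = D\<close> explains the change from \<open>r - 4\<close> to
  \<open>r - 3\<close> between the two formulas.\<close>

lemma exponents_2:
  assumes c: "c \<noteq> 1" "c ^ (2 ^ t) = c" and lam: "\<And>i. 1 \<le> i \<Longrightarrow> i \<le> l \<Longrightarrow> lam i = c"
  defines "D \<equiv> 2 * real l * r + (r - 1) * (r - 2)"
  defines "w \<equiv> r - 1 - r * (r - 1) * (r - 4) / D" and "w' \<equiv> r - r * (r - 1) * (r - 3) / D"
  shows "ereal w \<le> wstar_exp 2 Phi" "ereal w' \<le> w_exp 2 Phi"
    "\<And>n d. 2 \<le> n \<Longrightarrow> n \<le> d \<Longrightarrow> 2 * r * real d \<le> (w - 1) * (w + 1 - real d) \<Longrightarrow>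
      wstar_exp n Phi = ereal w \<and> w_exp n Phi = ereal w'"
proof -
  define L where "L = 2 * real l / (r - 1)"
  define a where "a = 2 * real l + r - 2 + L"
  define f where "f = a - r"
  define g where "g = 2 * r * (real l + 1) + L * r"
  have r: "2 \<le> r" by (rule r_ge_2)
  have L: "L * r = L + 2 * real l" using r by (simp add: L_def field_simps)
  have L0: "0 < L" using l r by (simp add: L_def)
  have a: "a * (r - 1) = D"
    using r by (simp add: a_def L_def D_def field_simps)
  have l1: "1 \<le> real l" using l by simp
  have f0: "0 < f" using l1 L0 by (simp add: f_def a_def)
  have a0: "0 < a" using f0 r by (simp add: f_def)
  have D0: "0 < D" using a a0 r by (metis diff_gt_0_iff_gt less_le_trans mult_pos_pos one_less_numeral_iff semiring_norm(76))
  have rl: "real l + 1 \<le> r * (real l + 1)" using mult_right_mono[of 1 r "real l + 1"] r by simp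
  have g_gt: "2 * a < g"
  proof -
    have "g = 2 * (r * real l) + 2 * r + L + 2 * real l" by (simp add: g_def L algebra_simps)
    moreover have "L \<le> 2 * real l" using r l1 by (simp add: L_def field_simps mult_left_mono)
    moreover have "2 * real l \<le> r * real l" using r by (intro mult_right_mono) auto
    ultimately show ?thesis by (simp add: a_def)
  qed
  have c0: "c \<noteq> 0" using lam[of 1] lam_nonzero[of 1] l by simp
  have "\<exists>A C z z'. quadratic_approximations Phi A (\<lambda>k. monom c ((2 ^ t) ^ Suc k - 1)) C z z'
      r a f g (- 2 - L) (- 1 - L) (- 1 - L)"
  proof (rule quadratic_approximationsI[where I = inv2])
    show "\<exists>n. quad_approx inv2 (monom c ((2 ^ t) ^ Suc k - 1)) Phi n (g * r ^ k + (- 1 - L)) \<and>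
        real n = a * r ^ k + (- 2 - L)" for k
      unfolding L_def g_def a_def by (rule quad_approx_sequence_2[OF assms(1-3)])
    show "f * r ^ k + (- 1 - L) < g * r ^ k + (- 1 - L)" for k
      using g_gt a0 r by (simp add: f_def)
    show "primitive_poly [:C, - monom c ((2 ^ t) ^ Suc k - 1), A:]" if "inv2 A C" for A C k
      using that c0 by (rule inv2_primitive)
    show "real (degree (monom c ((2 ^ t) ^ Suc k - 1))) = (a - f) * r ^ k + (- 2 - L - (- 1 - L))" for k
      using c0 by (simp add: degree_monom_eq of_nat_diff f_def)
  qed (use c0 f0 a0 r g_gt fabs_Phi in \<open>auto simp: f_def\<close>)
  then obtain A C z z' where
    "quadratic_approximations Phi A (\<lambda>k. monom c ((2 ^ t) ^ Suc k - 1)) C z z'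
      r a f g (- 2 - L) (- 1 - L) (- 1 - L)"
    by blast
  then interpret QA: quadratic_approximations Phi A "\<lambda>k. monom c ((2 ^ t) ^ Suc k - 1)" C z z'
    r a f g "- 2 - L" "- 1 - L" "- 1 - L" .
  have gD: "g * (r - 1) = w * D + D"
  proof -
    have "g * (r - 1) = 2 * r * (real l * r + r - 1)"
      using r by (simp add: g_def L_def field_simps)
    also have "\<dots> = r * D - r * (r - 1) * (r - 4)" by (simp add: D_def algebra_simps)
    also have "\<dots> = w * D + D" using D0 by (simp add: w_def field_simps)
    finally show ?thesis .
  qed
  then have "(g - (w + 1) * a) * (r - 1) = 0"
    unfolding a [symmetric] by (simp add: algebra_simps)
  then have g: "g = (w + 1) * a" using r by simp
  define \<rho> where "\<rho> = r / a"
  have \<rho>: "0 < \<rho>" "\<rho> < 1" and fa: "f = (1 - \<rho>) * a"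
    using a0 f0 r by (simp_all add: \<rho>_def f_def field_simps)
  have "\<rho> = r * (r - 1) / D"
    unfolding a [symmetric] using r a0 by (simp add: \<rho>_def)
  then have w': "w' = w + 1 - \<rho>"
    using D0 by (simp add: w'_def w_def field_simps)
  have ws: "QA.wstar = w" "QA.w = w'"
    unfolding QA.w_def QA.wstar_def w' unfolding g fa using a0 by simp_all
  show "ereal w \<le> wstar_exp 2 Phi" "ereal w' \<le> w_exp 2 Phi"
    using QA.exponents_ge unfolding ws .
  have w1: "1 < w" using g_gt a0 unfolding g by simp
  fix n d :: nat assume n: "2 \<le> n" "n \<le> d" and cond: "2 * r * real d \<le> (w - 1) * (w + 1 - real d)"
  have "0 < 2 * r * real d" using n r by simp
  with cond have "0 < (w - 1) * (w + 1 - real d)" by linarith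
  then have wd: "0 < w + 1 - real d" using w1 by (simp add: zero_less_mult_iff)
  have nd: "real n \<le> real d" using n by simp
  have n_less: "real n < w + 2 - \<rho>" using wd nd \<rho> by linarith
  have 1: "real n * a < g + f"
    using mult_strict_right_mono[OF n_less a0] unfolding g fa by (simp add: algebra_simps)
  \<comment> \<open>In terms of \<open>w\<close> and \<rho> the general condition for
    \<open>n\<close> follows from the one for \<open>d\<close>, because \<open>n \<le> d\<close> and
    \<rho> lies between 0 and 1.\<close>
  have "2 * r * (real n - (1 - \<rho>)) \<le> 2 * r * real d"
    using nd \<rho> r by (intro mult_left_mono) auto
  also have "\<dots> \<le> (w - 1) * (w + 1 - real d)" by (rule cond)
  also have "\<dots> \<le> (w - 1) * (w + 2 - \<rho> - real n)"
    using nd \<rho> w1 by (intro mult_left_mono) auto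
  finally have "2 * r * (real n - (1 - \<rho>)) * a ^ 2 \<le> (w - 1) * (w + 2 - \<rho> - real n) * a ^ 2"
    by (rule mult_right_mono) simp
  then have 2: "2 * r * a * (real n * a - f) \<le> (g - 2 * a) * (g + f - real n * a)"
    unfolding g fa by (simp add: algebra_simps power2_eq_square)
  show "wstar_exp n Phi = ereal w \<and> w_exp n Phi = ereal w'"
    using QA.exponents_eq[OF n(1) 1 2] unfolding ws by blast
qed

end

text \<open>The hypothesis says that \<open>2 * w\<close> is at least \<open>d\<close> plus the
  square root, so \<open>w\<close> is at least the larger root of
  \<open>w^2 - d w = (2 r - 1) d + 1\<close>. This settles \<open>n = d\<close>; since
  \<open>w \<ge> d\<close>, smaller \<open>n\<close> only help.\<close>

lemma condition_1:
  fixes r :: real and l m d n :: nat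
  assumes r: "2 \<le> r" and l: "1 \<le> l" and m: "1 \<le> m" and n: "2 \<le> n" "n \<le> d"
    and cond: "real l / real m \<le> 2 * (r - 1) / (real d + sqrt ((real d)\<^sup>2 + 4 * (2 * r - 1) * real d + 4))"
  defines "w \<equiv> real m / real l * (r - 1)"
  shows "real n < w + 2" "2 * r * (real n - 1) \<le> (w - 1) * (w + 2 - real n)"
proof -
  define S where "S = sqrt ((real d)\<^sup>2 + 4 * (2 * r - 1) * real d + 4)"
  have arg: "(real d)\<^sup>2 \<le> (real d)\<^sup>2 + 4 * (2 * r - 1) * real d + 4"
    using r by simp
  have S2: "S\<^sup>2 = (real d)\<^sup>2 + 4 * (2 * r - 1) * real d + 4"
    unfolding S_def using arg by (intro real_sqrt_pow2) (use zero_le_power2[of "real d"] in linarith)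
  have Sd: "real d \<le> S"
    unfolding S_def using arg by (rule real_le_rsqrt)
  have d: "2 \<le> real d" using n by simp
  have "real l * (real d + S) \<le> 2 * (r - 1) * real m"
    using cond m d Sd unfolding S_def [symmetric] by (simp add: field_simps)
  then have wS: "real d + S \<le> 2 * w"
    using l by (simp add: w_def field_simps)
  have wd: "real d \<le> w" using wS Sd by simp
  have nd: "real n \<le> real d" using n by simp
  show "real n < w + 2" using wd nd by simp
  have "S ^ 2 \<le> (2 * w - real d) ^ 2"
    using wS Sd d by (intro power_mono) auto
  then have "(2 * r - 1) * real d + 1 \<le> w * w - w * real d"
    unfolding S2 by (simp add: power2_eq_square algebra_simps)
  then have "2 * r * (real d - 1) \<le> (w - 1) * (w + 2 - real d)"
    using r wd d by (simp add: algebra_simps)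
  moreover have "(w - 1) * (w + 2 - real d) \<le> (w - 1) * (w + 2 - real n)"
    using nd wd d by (intro mult_left_mono) auto
  moreover have "2 * r * (real n - 1) \<le> 2 * r * (real d - 1)"
    using nd r by (intro mult_left_mono) auto
  ultimately show "2 * r * (real n - 1) \<le> (w - 1) * (w + 2 - real n)" by linarith
qed

theorem theorem3p4:
  fixes s t l m d :: nat
    and lam0 :: "'a::{field,finite}"
    and lam :: "nat \<Rightarrow> 'a"
    and e1 e2 :: 'a
    and Phi :: "'a fls"
  assumes q: "card (UNIV :: 'a set) = 2 ^ s" and s: "s \<ge> 1" and t: "t \<ge> 1"
    and l: "l \<ge> 1" and m: "m \<ge> 1" and d: "d \<ge> 2" and ml: "m \<le> l"
    and lam0: "lam0 \<noteq> 0" "lam0 \<noteq> 1"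
    and lam_nz: "\<forall>i\<in>{1..l}. lam i \<noteq> 0"
    and e_nz: "e1 \<noteq> 0" "e2 \<noteq> 0"
    and rec1: "\<forall>m'. lam (l + 2 ^ t * m' + 1) =
                 (e2 / e1) * (if even (m' + 1) then e2 else inverse e2) * lam (m' + 1) ^ (2 ^ t)"
    and rec2: "\<forall>m' i. 2 \<le> i \<and> i \<le> 2 ^ t \<longrightarrow>
                 lam (l + 2 ^ t * m' + i) = (if even i then e1 / e2 else inverse (e1 / e2))"
    and Phi: "(\<lambda>n. fabs (Phi - cf_fin (\<lambda>k. fls_const (lam (k + 1)) * fls_X_inv) n))
                \<longlonglongrightarrow> 0"
  shows
   "(lam 1 = lam0 \<and> (\<forall>i. 2 \<le> i \<and> i \<le> m \<longrightarrow> lam i = 1) \<and> e1 = 1 \<and> e2 = 1 \<and>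
      (m < l \<longrightarrow> lam (m + 1) \<noteq> 1) \<longrightarrow>
      ereal (real m / real l * (2 ^ t - 1)) \<le> wstar_exp 2 Phi \<and>
      ereal (1 + real m / real l * (2 ^ t - 1)) \<le> w_exp 2 Phi \<and>
      (real l / real m \<le> 2 * (2 ^ t - 1) /
          (real d + sqrt ((real d)\<^sup>2 + 4 * (2 * 2 ^ t - 1) * real d + 4)) \<longrightarrow>
        (\<forall>n. 2 \<le> n \<and> n \<le> d \<longrightarrow>
           wstar_exp n Phi = ereal (real m / real l * (2 ^ t - 1)) \<and>
           w_exp n Phi = ereal (1 + real m / real l * (2 ^ t - 1)))))
    \<and>
    ((\<exists>k. (2::nat) ^ t = card (UNIV :: 'a set) ^ k) \<and> e1 = 1 \<and> e2 = 1 \<and>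
      (\<forall>i\<in>{1..l}. lam i = lam0) \<longrightarrow>
      (let r = (2::real) ^ t;
           D = 2 * real l * r + (r - 1) * (r - 2) in
        ereal (r - 1 - r * (r - 1) * (r - 4) / D) \<le> wstar_exp 2 Phi \<and>
        ereal (r - r * (r - 1) * (r - 3) / D) \<le> w_exp 2 Phi \<and>
        (2 * r * real d \<le> (r - 2 - r * (r - 1) * (r - 4) / D) *
                          (r - real d - r * (r - 1) * (r - 4) / D) \<longrightarrow>
          (\<forall>n. 2 \<le> n \<and> n \<le> d \<longrightarrow>
             wstar_exp n Phi = ereal (r - 1 - r * (r - 1) * (r - 4) / D) \<and>
             w_exp n Phi = ereal (r - r * (r - 1) * (r - 3) / D)))))"
proof -
  have CHAR: "CHAR('a) = 2" using q s by (rule CHAR_eq_2I)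
  have cf: "hyperquadratic_cf t l lam Phi" if "e1 = 1" "e2 = 1"
  proof
    show "lam i \<noteq> 0" if "1 \<le> i" "i \<le> l" for i using lam_nz that by auto
    show "lam (l + 2 ^ t * k + 1) = lam (k + 1) ^ (2 ^ t)" for k
      using rec1[rule_format, of k] \<open>e1 = 1\<close> \<open>e2 = 1\<close> by simp
    show "lam (l + 2 ^ t * k + i) = 1" if "2 \<le> i" "i \<le> 2 ^ t" for k i
      using rec2[rule_format, of i k] that \<open>e1 = 1\<close> \<open>e2 = 1\<close> by simp
  qed (use CHAR t l Phi in auto)
  have r: "(2::real) \<le> 2 ^ t" using power_increasing[of 1 t "2::real"] t by simp
  show ?thesis
  proof (rule conjI; intro impI)
    assume *: "lam 1 = lam0 \<and> (\<forall>i. 2 \<le> i \<and> i \<le> m \<longrightarrow> lam i = 1) \<and> e1 = 1 \<and> e2 = 1 \<and>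
      (m < l \<longrightarrow> lam (m + 1) \<noteq> 1)"
    then interpret hyperquadratic_cf "TYPE('a)" t l lam Phi using cf by blast
    have "lam 1 \<noteq> 1" using * lam0 by simp
    note exps = exponents_1[OF m ml this]
    let ?w = "real m / real l * (2 ^ t - 1)"
    have "wstar_exp n Phi = ereal ?w \<and> w_exp n Phi = ereal (1 + ?w)"
      if "2 \<le> n" "n \<le> d" "real l / real m \<le> 2 * (2 ^ t - 1) /
        (real d + sqrt ((real d)\<^sup>2 + 4 * (2 * 2 ^ t - 1) * real d + 4))" for n
      using exps(3)[OF _ _ that(1) condition_1[OF r l m that]] * by blast
    moreover have "ereal ?w \<le> wstar_exp 2 Phi" "ereal (1 + ?w) \<le> w_exp 2 Phi"
      using exps(1,2) * by blast+
    ultimately show "ereal ?w \<le> wstar_exp 2 Phi \<and> ereal (1 + ?w) \<le> w_exp 2 Phi \<and>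
      (real l / real m \<le> 2 * (2 ^ t - 1) /
          (real d + sqrt ((real d)\<^sup>2 + 4 * (2 * 2 ^ t - 1) * real d + 4)) \<longrightarrow>
        (\<forall>n. 2 \<le> n \<and> n \<le> d \<longrightarrow> wstar_exp n Phi = ereal ?w \<and> w_exp n Phi = ereal (1 + ?w)))"
      by blast
  next
    assume *: "(\<exists>k. (2::nat) ^ t = CARD('a) ^ k) \<and> e1 = 1 \<and> e2 = 1 \<and> (\<forall>i\<in>{1..l}. lam i = lam0)"
    then interpret hyperquadratic_cf "TYPE('a)" t l lam Phi using cf by blast
    obtain k where "(2::nat) ^ t = CARD('a) ^ k" using * by blast
    then have c: "lam0 ^ (2 ^ t) = lam0" by (simp only: field_power_card_power)
    have lam: "lam i = lam0" if "1 \<le> i" "i \<le> l" for i using * that by simp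
    note exps = exponents_2[OF lam0(2) c lam]
    let ?D = "2 * real l * 2 ^ t + (2 ^ t - 1) * (2 ^ t - 2)"
    let ?X = "2 ^ t * (2 ^ t - 1) * (2 ^ t - 4) / ?D" and ?Y = "2 ^ t * (2 ^ t - 1) * (2 ^ t - 3) / ?D"
    have "wstar_exp n Phi = ereal (2 ^ t - 1 - ?X) \<and> w_exp n Phi = ereal (2 ^ t - ?Y)"
      if "2 \<le> n" "n \<le> d" "2 * 2 ^ t * real d \<le> (2 ^ t - 2 - ?X) * (2 ^ t - real d - ?X)" for n
    proof (rule exps(3)[OF _ _ that(1,2)])
      have "2 ^ t - 1 - x - 1 = 2 ^ t - 2 - x" "2 ^ t - 1 - x + 1 - real d = 2 ^ t - real d - x"
        for x :: real by simp_all
      then show "2 * 2 ^ t * real d \<le> (2 ^ t - 1 - ?X - 1) * (2 ^ t - 1 - ?X + 1 - real d)"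
        using that(3) by (simp only:)
    qed
    with exps(1,2) show "let r = (2::real) ^ t; D = 2 * real l * r + (r - 1) * (r - 2) in
        ereal (r - 1 - r * (r - 1) * (r - 4) / D) \<le> wstar_exp 2 Phi \<and>
        ereal (r - r * (r - 1) * (r - 3) / D) \<le> w_exp 2 Phi \<and>
        (2 * r * real d \<le> (r - 2 - r * (r - 1) * (r - 4) / D) *
                          (r - real d - r * (r - 1) * (r - 4) / D) \<longrightarrow>
          (\<forall>n. 2 \<le> n \<and> n \<le> d \<longrightarrow>
             wstar_exp n Phi = ereal (r - 1 - r * (r - 1) * (r - 4) / D) \<and>
             w_exp n Phi = ereal (r - r * (r - 1) * (r - 3) / D)))"
      unfolding Let_def by blast
  qed
qed

end
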